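(* Let $n \ge 2$ and let $G$ be a Lie group that is locally isomorphic to $\mathrm{SO}(1,n)$. Let $H$ be a closed subgroup of $G$ such that (i) the closure of $\mathrm{Ad}_G H$ is not compact, and (ii) there is a $G$-invariant Lorentz metric on $G/H$. Let $\mathfrak{g}$ and $\mathfrak{h} \subset \mathfrak{g}$ be the Lie algebras of $G$ and $H$. Then either (1) after any identification of $\mathfrak{g}$ with $\mathfrak{so}(1,n)$ (that is, under any Lie algebra isomorphism $\mathfrak{g} \to \mathfrak{so}(1,n)$), the subalgebra $\mathfrak{h}$ is conjugate to a standard copy of $\mathfrak{so}(1,n-1)$ in $\mathfrak{so}(1,n)$; or (2) $n = 2$ and $H$ is discrete.
   Context: $\mathrm{SO}(p,q)$ is the group of determinant-one linear transformations of $\mathbb{R}^{p+q}$ preserving the quadratic form $-x_1^2-\cdots-x_p^2+x_{p+1}^2+\cdots+x_{p+q}^2$, with Lie algebra $\mathfrak{so}(p,q)$. A standard copy of $\mathfrak{so}(1,n-1)$ in $\mathfrak{so}(1,n)$ is the subalgebra annihilating a coordinate vector on which the form is positive (e.g. the last one); "conjugate" means conjugate under the adjoint action of $\mathrm{SO}(1,n)$ on $\mathfrak{so}(1,n)$. A Minkowski form on a finite-dimensional real vector space $V$ is a nondegenerate quadratic form isometric to $-x_1^2 + x_2^2 + \cdots + x_{m+1}^2$ on $\mathbb{R}^{m+1}$, where $\dim V = m+1 \ge 2$ (in particular $\dim V\ge 2$ is required). A Lorentz metric on a smooth manifold $M$ is a choice of Minkowski form on each tangent space $T_pM$, varying smoothly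 with $p \in M$. A Lorentz metric on $G/H$ is $G$-invariant if the left-translation action of $G$ on $G/H$ preserves it. $\mathrm{Ad}_G$ is the adjoint representation of $G$ on $\mathfrak{g}$, and the closure of $\mathrm{Ad}_G H$ is taken in $\mathrm{GL}(\mathfrak{g})$. *)

theory Defs
  imports "HOL-Analysis.Analysis" "HOL-Algebra.Left_Coset"
begin

section \<open>Smooth maps between open subsets of Euclidean spaces\<close>

text \<open>These are meant for open sets \<open>S\<close> only. All directional derivatives of a differentiable
  function being of class \<open>C\<^sup>k\<close> is the same as the derivative being of class \<open>C\<^sup>k\<close>.\<close>

primrec Ck_on :: "nat \<Rightarrow> 'e::euclidean_space set \<Rightarrow> ('e \<Rightarrow> 'f::real_normed_vector) \<Rightarrow> bool" where
  "Ck_on 0 S f \<longleftrightarrow> continuous_on S f"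
| "Ck_on (Suc k) S f \<longleftrightarrow>
     (\<forall>x\<in>S. f differentiable at x) \<and> (\<forall>v. Ck_on k S (\<lambda>x. frechet_derivative f (at x) v))"

definition smooth_on :: "'e::euclidean_space set \<Rightarrow> ('e \<Rightarrow> 'f::real_normed_vector) \<Rightarrow> bool" where
  "smooth_on S f \<longleftrightarrow> (\<forall>k. Ck_on k S f)"


section \<open>Smooth manifolds\<close>

text \<open>A chart is a pair of its domain and its coordinate map; outside of the domain the values
  of the coordinate map are irrelevant. The atlas of a manifold need not be maximal.\<close>

type_synonym ('a, 'e) chart = "'a set \<times> ('a \<Rightarrow> 'e)"

definition chart_inv :: "('a, 'e) chart \<Rightarrow> 'e \<Rightarrow> 'a" where
  "chart_inv c = inv_into (fst c) (snd c)"

record ('a, 'e) manifold =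
  mtop :: "'a topology"
  atlas :: "('a, 'e) chart set"

definition charts_at :: "('a, 'e) manifold \<Rightarrow> 'a \<Rightarrow> ('a, 'e) chart set" where
  "charts_at M p = {c \<in> atlas M. p \<in> fst c}"

definition second_countable_top :: "'a topology \<Rightarrow> bool" where
  "second_countable_top X \<longleftrightarrow>
     (\<exists>\<B>. countable \<B> \<and> (\<forall>V\<in>\<B>. openin X V) \<and>
          (\<forall>U x. openin X U \<and> x \<in> U \<longrightarrow> (\<exists>V\<in>\<B>. x \<in> V \<and> V \<subseteq> U)))"

locale smooth_manifold =
  fixes M :: "('a, 'e::euclidean_space) manifold"
  assumes Hausdorff: "Hausdorff_space (mtop M)"
    and second_countable: "second_countable_top (mtop M)"
    and chart_open: "c \<in> atlas M \<Longrightarrow> openin (mtop M) (fst c)"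
    and chart_image_open: "c \<in> atlas M \<Longrightarrow> open (snd c ` fst c)"
    and chart_homeomorphic: "c \<in> atlas M \<Longrightarrow>
      homeomorphic_map (subtopology (mtop M) (fst c)) (top_of_set (snd c ` fst c)) (snd c)"
    and charts_cover: "(\<Union>c\<in>atlas M. fst c) = topspace (mtop M)"
    and charts_compatible: "\<lbrakk>c \<in> atlas M; d \<in> atlas M\<rbrakk> \<Longrightarrow>
      smooth_on (snd c ` (fst c \<inter> fst d)) (snd d \<circ> chart_inv c)"

definition smooth_map :: "('a, 'e::euclidean_space) manifold \<Rightarrow> ('b, 'f::euclidean_space) manifold
    \<Rightarrow> ('a \<Rightarrow> 'b) \<Rightarrow> bool" where
  "smooth_map M N f \<longleftrightarrow> continuous_map (mtop M) (mtop N) f \<and>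
     (\<forall>p\<in>topspace (mtop M). \<exists>c\<in>charts_at M p. \<exists>d\<in>charts_at N (f p).
        smooth_on (snd c ` (fst c \<inter> f -` fst d)) (snd d \<circ> f \<circ> chart_inv c))"

definition diffeomorphism :: "('a, 'e::euclidean_space) manifold
    \<Rightarrow> ('b, 'f::euclidean_space) manifold \<Rightarrow> ('a \<Rightarrow> 'b) \<Rightarrow> bool" where
  "diffeomorphism M N f \<longleftrightarrow> bij_betw f (topspace (mtop M)) (topspace (mtop N)) \<and>
     smooth_map M N f \<and> smooth_map N M (inv_into (topspace (mtop M)) f)"

definition open_submanifold :: "('a, 'e) manifold \<Rightarrow> 'a set \<Rightarrow> ('a, 'e) manifold" where
  "open_submanifold M U =
     \<lparr>mtop = subtopology (mtop M) U, atlas = (\<lambda>(W, \<phi>). (W \<inter> U, \<phi>)) ` atlas M\<rparr>"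

definition prod_manifold :: "('a, 'e) manifold \<Rightarrow> ('b, 'f) manifold
    \<Rightarrow> ('a \<times> 'b, 'e \<times> 'f) manifold" where
  "prod_manifold M N =
     \<lparr>mtop = prod_topology (mtop M) (mtop N),
      atlas = {(U \<times> V, map_prod \<phi> \<psi>) |U \<phi> V \<psi>. (U, \<phi>) \<in> atlas M \<and> (V, \<psi>) \<in> atlas N}\<rparr>"

definition euclidean_manifold :: "('e::euclidean_space, 'e) manifold" where
  "euclidean_manifold = \<lparr>mtop = euclidean, atlas = {(UNIV, id)}\<rparr>"

text \<open>The structure of an embedded submanifold \<open>S\<close> of a Euclidean space: charts are the inverses
  of all regular parametrisations of relatively open pieces of \<open>S\<close>. The charts cover \<open>S\<close> iff \<open>S\<close>
  is an embedded submanifold of dimension \<open>DIM('e)\<close>.\<close>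

definition embedded_manifold :: "'v::euclidean_space set \<Rightarrow> ('v, 'e::euclidean_space) manifold" where
  "embedded_manifold S =
     \<lparr>mtop = top_of_set S,
      atlas = {c. openin (top_of_set S) (fst c) \<and> open (snd c ` fst c) \<and>
                  homeomorphism (fst c) (snd c ` fst c) (snd c) (chart_inv c) \<and>
                  smooth_on (snd c ` fst c) (chart_inv c) \<and>
                  (\<forall>x\<in>snd c ` fst c. inj (frechet_derivative (chart_inv c) (at x)))}\<rparr>"

text \<open>The tangent space at \<open>p\<close> is represented, for each chart \<open>c\<close> around \<open>p\<close>, by the model space
  \<open>'e\<close>, the vector \<open>v\<close> standing for the tangent vector with components \<open>v\<close> in the coordinates
  \<open>c\<close>. The representations in two charts \<open>c\<close> and \<open>d\<close> are identified by \<open>tangent_map c d id p\<close>;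
  in general \<open>tangent_map c d f p\<close> is the differential of \<open>f\<close> at \<open>p\<close> with respect to a chart
  \<open>c\<close> around \<open>p\<close> and a chart \<open>d\<close> around \<open>f p\<close>.\<close>

definition tangent_map :: "('a, 'e::euclidean_space) chart \<Rightarrow> ('b, 'f::euclidean_space) chart
    \<Rightarrow> ('a \<Rightarrow> 'b) \<Rightarrow> 'a \<Rightarrow> 'e \<Rightarrow> 'f" where
  "tangent_map c d f p = frechet_derivative (snd d \<circ> f \<circ> chart_inv c) (at (snd c p))"

definition smooth_submersion :: "('a, 'e::euclidean_space) manifold
    \<Rightarrow> ('b, 'f::euclidean_space) manifold \<Rightarrow> ('a \<Rightarrow> 'b) \<Rightarrow> bool" where
  "smooth_submersion M N f \<longleftrightarrow> smooth_map M N f \<and>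
     (\<forall>p\<in>topspace (mtop M). \<forall>c\<in>charts_at M p. \<forall>d\<in>charts_at N (f p).
        surj (tangent_map c d f p))"


section \<open>Lorentz metrics\<close>

text \<open>A quadratic form on a space of dimension \<open>m + 1\<close> is compared with the standard Minkowski form
  in the orthonormal coordinates of the type, \<open>b\<^sub>0\<close> being the timelike direction.\<close>

definition minkowski_form :: "('e::euclidean_space \<Rightarrow> real) \<Rightarrow> bool" where
  "minkowski_form Q \<longleftrightarrow> DIM('e) \<ge> 2 \<and>
     (\<exists>L::'e \<Rightarrow> 'e. \<exists>b\<^sub>0\<in>Basis. linear L \<and> bij L \<and>
        (\<forall>v. Q v = - (L v \<bullet> b\<^sub>0)\<^sup>2 + (\<Sum>b\<in>Basis - {b\<^sub>0}. (L v \<bullet> b)\<^sup>2)))"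

text \<open>\<open>Q c p\<close> is the quadratic form on the tangent space at \<open>p\<close>, in the coordinates of the chart
  \<open>c\<close> around \<open>p\<close>; the second condition says that it does not depend on the chart.\<close>

definition lorentz_metric :: "('a, 'e::euclidean_space) manifold
    \<Rightarrow> (('a, 'e) chart \<Rightarrow> 'a \<Rightarrow> 'e \<Rightarrow> real) \<Rightarrow> bool" where
  "lorentz_metric M Q \<longleftrightarrow>
     (\<forall>p\<in>topspace (mtop M). \<forall>c\<in>charts_at M p. minkowski_form (Q c p)) \<and>
     (\<forall>p\<in>topspace (mtop M). \<forall>c\<in>charts_at M p. \<forall>d\<in>charts_at M p. \<forall>v.
        Q d p (tangent_map c d id p v) = Q c p v) \<and>
     (\<forall>c\<in>atlas M. \<forall>v. smooth_on (snd c ` fst c) (\<lambda>x. Q c (chart_inv c x) v))"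

definition preserves_metric :: "('a, 'e::euclidean_space) manifold
    \<Rightarrow> (('a, 'e) chart \<Rightarrow> 'a \<Rightarrow> 'e \<Rightarrow> real) \<Rightarrow> ('a \<Rightarrow> 'a) \<Rightarrow> bool" where
  "preserves_metric M Q f \<longleftrightarrow>
     (\<forall>p\<in>topspace (mtop M). \<forall>c\<in>charts_at M p. \<forall>d\<in>charts_at M (f p). \<forall>v.
        Q d (f p) (tangent_map c d f p v) = Q c p v)"


section \<open>Lie groups\<close>

locale lie_group = group G + smooth_manifold M
  for G :: "('g, 'm) monoid_scheme" (structure)
    and M :: "('g, 'e::euclidean_space) manifold" +
  assumes topspace_eq_carrier: "topspace (mtop M) = carrier G"
    and smooth_mult: "smooth_map (prod_manifold M M) M (\<lambda>(x, y). x \<otimes> y)"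
    and smooth_inv: "smooth_map M M (\<lambda>x. inv x)"

definition locally_isomorphic :: "('g, 'm) monoid_scheme \<Rightarrow> ('g, 'e::euclidean_space) manifold
    \<Rightarrow> ('h, 'k) monoid_scheme \<Rightarrow> ('h, 'f::euclidean_space) manifold \<Rightarrow> bool" where
  "locally_isomorphic G M G' M' \<longleftrightarrow>
     (\<exists>U V f. openin (mtop M) U \<and> \<one>\<^bsub>G\<^esub> \<in> U \<and> openin (mtop M') V \<and> \<one>\<^bsub>G'\<^esub> \<in> V \<and>
        diffeomorphism (open_submanifold M U) (open_submanifold M' V) f \<and>
        (\<forall>x\<in>U. \<forall>y\<in>U. x \<otimes>\<^bsub>G\<^esub> y \<in> U \<longrightarrow> f (x \<otimes>\<^bsub>G\<^esub> y) = f x \<otimes>\<^bsub>G'\<^esub> f y))"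

text \<open>The Lie algebra of \<open>G\<close> is the tangent space at the identity, represented by the model space
  in the coordinates of a chart \<open>c\<close> around the identity. Its bracket is the commutator at the
  identity of the left-invariant vector fields; \<open>left_invariant_field G c X x\<close> is the value,
  at the point with coordinates \<open>x\<close>, of the field extending \<open>X\<close>.\<close>

definition left_invariant_field :: "('g, 'm) monoid_scheme \<Rightarrow> ('g, 'e::euclidean_space) chart
    \<Rightarrow> 'e \<Rightarrow> 'e \<Rightarrow> 'e" where
  "left_invariant_field G c X x = tangent_map c c (\<lambda>y. chart_inv c x \<otimes>\<^bsub>G\<^esub> y) \<one>\<^bsub>G\<^esub> X"

definition lie_bracket :: "('g, 'm) monoid_scheme \<Rightarrow> ('g, 'e::euclidean_space) chart
    \<Rightarrow> 'e \<Rightarrow> 'e \<Rightarrow> 'e" where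
  "lie_bracket G c X Y =
     frechet_derivative (left_invariant_field G c Y) (at (snd c \<one>\<^bsub>G\<^esub>)) X -
     frechet_derivative (left_invariant_field G c X) (at (snd c \<one>\<^bsub>G\<^esub>)) Y"

definition Ad :: "('g, 'm) monoid_scheme \<Rightarrow> ('g, 'e::euclidean_space) chart \<Rightarrow> 'g \<Rightarrow> 'e \<Rightarrow>\<^sub>L 'e" where
  "Ad G c g = Blinfun (tangent_map c c (\<lambda>x. g \<otimes>\<^bsub>G\<^esub> x \<otimes>\<^bsub>G\<^esub> inv\<^bsub>G\<^esub> g) \<one>\<^bsub>G\<^esub>)"

definition GL :: "('e::euclidean_space \<Rightarrow>\<^sub>L 'e) set" where
  "GL = {T. \<exists>S. S o\<^sub>L T = id_blinfun \<and> T o\<^sub>L S = id_blinfun}"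

text \<open>The Lie algebra of a closed subgroup \<open>H\<close>: the initial velocities of the one-parameter
  subgroups of \<open>G\<close> that lie in \<open>H\<close>.\<close>

definition subgroup_lie_algebra :: "('g, 'm) monoid_scheme \<Rightarrow> ('g, 'e::euclidean_space) manifold
    \<Rightarrow> ('g, 'e) chart \<Rightarrow> 'g set \<Rightarrow> 'e set" where
  "subgroup_lie_algebra G M c H =
     {X. \<exists>\<gamma>::real \<Rightarrow> 'g. smooth_map euclidean_manifold M \<gamma> \<and>
           (\<forall>s t. \<gamma> (s + t) = \<gamma> s \<otimes>\<^bsub>G\<^esub> \<gamma> t) \<and> (\<forall>t. \<gamma> t \<in> H) \<and>
           (snd c \<circ> \<gamma> has_vector_derivative X) (at 0)}"

text \<open>The manifold \<open>G/H\<close>. There is exactly one smooth structure on the set of left cosets for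
  which the projection is a smooth submersion (its topology is then the quotient topology).\<close>

definition quotient_manifold :: "('g, 'm) monoid_scheme \<Rightarrow> ('g, 'e::euclidean_space) manifold
    \<Rightarrow> 'g set \<Rightarrow> ('g set, 'f::euclidean_space) manifold \<Rightarrow> bool" where
  "quotient_manifold G M H N \<longleftrightarrow> smooth_manifold N \<and> topspace (mtop N) = lcosets\<^bsub>G\<^esub> H \<and>
     smooth_submersion M N (\<lambda>a. a <#\<^bsub>G\<^esub> H)"


section \<open>The groups \<open>SO(p,q)\<close> and their Lie algebras\<close>

text \<open>Vectors of \<open>\<real>\<^sup>p\<^sup>+\<^sup>q\<close> are indexed by the sum type \<open>'p + 'q\<close>, where \<open>'p\<close> and \<open>'q\<close> have \<open>p\<close>
  and \<open>q\<close> elements; \<open>Inl\<close> marks the coordinates on which the form is negative.\<close>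

definition pq_inner :: "real ^ ('p::finite + 'q::finite) \<Rightarrow> real ^ ('p + 'q) \<Rightarrow> real" where
  "pq_inner x y = - (\<Sum>i\<in>UNIV. x $ Inl i * y $ Inl i) + (\<Sum>j\<in>UNIV. x $ Inr j * y $ Inr j)"

definition pq_form :: "real ^ ('p::finite + 'q::finite) \<Rightarrow> real" where
  "pq_form x = - (\<Sum>i\<in>UNIV. (x $ Inl i)\<^sup>2) + (\<Sum>j\<in>UNIV. (x $ Inr j)\<^sup>2)"

definition SO_pq :: "(real ^ ('p::finite + 'q::finite) ^ ('p + 'q)) monoid" where
  "SO_pq = \<lparr>carrier = {A. det A = 1 \<and> (\<forall>x. pq_form (A *v x) = pq_form x)},
            mult = (**), one = mat 1\<rparr>"

definition so_pq :: "(real ^ ('p::finite + 'q::finite) ^ ('p + 'q)) set" where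
  "so_pq = {X. \<forall>x y. pq_inner (X *v x) y + pq_inner x (X *v y) = 0}"

definition lie_isomorphism_so_pq :: "('g, 'm) monoid_scheme \<Rightarrow> ('g, 'e::euclidean_space) chart
    \<Rightarrow> ('e \<Rightarrow> real ^ ('p::finite + 'q::finite) ^ ('p + 'q)) \<Rightarrow> bool" where
  "lie_isomorphism_so_pq G c f \<longleftrightarrow> linear f \<and> bij_betw f UNIV so_pq \<and>
     (\<forall>X Y. f (lie_bracket G c X Y) = f X ** f Y - f Y ** f X)"

text \<open>The standard copy of \<open>so(p,q-1)\<close> in \<open>so(p,q)\<close> that annihilates the \<open>j\<close>-th of the coordinate
  vectors on which the form is positive.\<close>

definition standard_copy :: "'q \<Rightarrow> (real ^ ('p::finite + 'q::finite) ^ ('p + 'q)) set" where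
  "standard_copy j = {X \<in> so_pq. X *v axis (Inr j) 1 = 0}"

end

theory Submission
  imports Defs
begin

text \<open>
  The tangent space of \<open>G/H\<close> at the base point is \<open>\<gg>/\<hh>\<close>. So, after the choice of an isomorphism of \<open>\<gg>\<close> with
  \<open>so(1,n)\<close>, the metric is a symmetric form \<open>b\<close> on \<open>so(1,n)\<close> with radical \<open>\<hh>\<close> that is invariant under the
  unbounded group \<open>Ad H\<close>, and two orthogonal isotropic vectors are linearly dependent modulo \<open>\<hh>\<close>.

  Let \<open>T\<close> be an automorphism of \<open>so(1,n)\<close> of large norm. It preserves the Killing form, so its adjoint for the
  Frobenius inner product is the inverse of \<open>T\<close> conjugated by the Cartan involution, and \<open>T\<^sup>* T\<close> is again an
  automorphism. An eigenvector of \<open>T\<^sup>* T\<close> for the largest eigenvalue lies in a root space of some boost, and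
  therefore \<open>T\<^sup>* T\<close> is a scalar on each root space and the identity on the centralizer of the boost: this is
  the Cartan decomposition of \<open>T\<close>. Hence each large element of \<open>Ad H\<close> contracts the horospherical subalgebra
  \<open>\<nn>\<close> of some null frame and expands no vector of the parabolic subalgebra \<open>\<pp> \<supseteq> \<nn>\<close>. Along a sequence with
  convergent frames, invariance gives a parabolic \<open>\<pp>\<close> with \<open>b(\<nn>, \<pp>) = 0\<close>.

  In particular \<open>\<nn>\<close> is isotropic, so \<open>\<hh> \<inter> \<nn>\<close> has codimension at most 1 in \<open>\<nn>\<close>. If \<open>\<nn> \<subseteq> \<hh>\<close>, then the infinitesimal
  invariance of \<open>b\<close> under \<open>\<nn>\<close> forces \<open>b = 0\<close>. If the codimension is 1, then either \<open>n = 2\<close> and \<open>\<hh> = 0\<close>, or \<open>\<hh>\<close>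
  contains a boost of \<open>\<pp>\<close>, which makes \<open>\<hh>\<close> graded and determines it: it is the annihilator of a spacelike
  vector. \<open>SO(1,n)\<close> acts transitively on spacelike vectors of given length.

  The link with the group is that \<open>\<hh>\<close> is the kernel of the differential of \<open>G \<rightarrow> G/H\<close> at the identity. A vector
  in this kernel is the velocity of a one-parameter subgroup, an integral curve of a left-invariant vector
  field, and the projection of this curve to \<open>G/H\<close> has velocity zero everywhere.
\<close>


section \<open>The Lie algebra \<open>so(1,n)\<close>\<close>

text \<open>The obstacle is that noncompactness of the closure of Ad H says nothing about \<hh>,
  since \<open>H\<close> may be discrete. Group and Lie algebra therefore enter separately: large
  elements of Ad H give b(n,p) = 0 for one parabolic p, and from there on only the infinitesimal
  invariance of the form under its own radical is used. The exceptional alternative is genuine: on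
  so(1,2) the Killing form is itself a Minkowski form, invariant under all of Ad G. The boost of the
  Cartan decomposition is the bracket of the top eigenvector X of the Gram operator with its
  transpose. It is fixed by that operator because X and its transpose have inverse eigenvalues. It
  is nonzero because otherwise ad X would be normal with nonzero cube, whereas the spectrum,
  contained in an interval [1/s, s] with s the eigenvalue of X, leaves room for only two
  applications of ad X. The frames vary with the group element, so only norm inequalities on n and p
  survive the passage to the limit. This is why exactly b(n,p) = 0 remains, and the rest is algebra
  in a graded Lie algebra.\<close>

type_synonym 'n lvec = "real ^ (1 + 'n)"
type_synonym 'n lmat = "real ^ (1 + 'n) ^ (1 + 'n)"

definition e0 :: "'n::finite lvec" where "e0 = axis (Inl 1) 1"

text \<open>The fundamental symmetry of the Minkowski form: it reverses the time coordinate, so that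
  \<open>eta x y\<close> is the Euclidean product of \<open>x\<close> and \<open>Jv y\<close>.
  Conjugation by it is the Cartan involution on \<open>so_pq\<close>.\<close>

definition Jv :: "'n::finite lvec \<Rightarrow> 'n lvec" where "Jv x = x - (2 * (x \<bullet> e0)) *\<^sub>R e0"

text \<open>The identification of the exterior square of Minkowski space with so(1,n), where
  \<open>Jv\<close> lowers an index. Through these products the algebra is handled without matrix
  entries.\<close>

definition wedge :: "'n::finite lvec \<Rightarrow> 'n lvec \<Rightarrow> 'n lmat" where
  "wedge u w = (\<chi> i j. u $ i * Jv w $ j - w $ i * Jv u $ j)"

definition br :: "'n::finite lmat \<Rightarrow> 'n lmat \<Rightarrow> 'n lmat" where
  "br X Y = X ** Y - Y ** X"

lemma e0_norm [simp]: "e0 \<bullet> e0 = 1"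
  by (simp add: e0_def inner_axis)

lemma linear_Jv: "linear Jv"
  by (rule linearI) (auto simp: Jv_def inner_left_distrib algebra_simps)

lemma Jv_Jv [simp]: "Jv (Jv x) = x"
  by (simp add: Jv_def inner_diff_left algebra_simps)

lemma Jv_inner: "Jv x \<bullet> y = x \<bullet> Jv y"
  by (simp add: Jv_def inner_diff_left inner_diff_right inner_commute)

lemma Jv_nth: "Jv x $ Inl 1 = - x $ Inl 1" "Jv x $ Inr j = x $ Inr j"
  by (auto simp: Jv_def e0_def inner_axis) (simp_all add: axis_def)

lemma sum_UNIV_lvec: "(\<Sum>i\<in>UNIV. f i) = f (Inl 1) + (\<Sum>j\<in>UNIV. f (Inr j))"
  for f :: "1 + 'n::finite \<Rightarrow> 'b::comm_monoid_add"
proof -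
  have "(\<Sum>i\<in>UNIV. f i) = (\<Sum>i\<in>UNIV <+> UNIV. f i)"
    by (simp only: UNIV_Plus_UNIV)
  also have "\<dots> = f (Inl 1) + (\<Sum>j\<in>UNIV. f (Inr j))"
    by (subst sum.Plus) (auto simp: UNIV_1)
  finally show ?thesis .
qed

lemma pq_inner_Jv: "pq_inner x y = x \<bullet> Jv y" for x :: "'n::finite lvec"
  unfolding pq_inner_def inner_vec_def sum_UNIV_lvec by (simp add: Jv_nth UNIV_1)

lemma pq_form_inner: "pq_form x = pq_inner x x" for x :: "real ^ ('p::finite + 'q::finite)"
  by (simp add: pq_form_def pq_inner_def power2_eq_square)

abbreviation eta :: "'n::finite lvec \<Rightarrow> 'n lvec \<Rightarrow> real" where "eta \<equiv> pq_inner"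

lemma eta_sym: "eta x y = eta y x"
  by (simp add: pq_inner_def mult.commute)

lemma eta_bilin:
  "eta (x + y) z = eta x z + eta y z" "eta z (x + y) = eta z x + eta z y"
  "eta (x - y) z = eta x z - eta y z" "eta z (x - y) = eta z x - eta z y"
  "eta (c *\<^sub>R x) z = c * eta x z" "eta z (c *\<^sub>R x) = c * eta z x"
  "eta (- x) z = - eta x z" "eta z (- x) = - eta z x"
  "eta 0 z = 0" "eta z 0 = 0"
  by (auto simp: pq_inner_Jv linear_add[OF linear_Jv] linear_diff[OF linear_Jv]
      linear_scale[OF linear_Jv] linear_neg[OF linear_Jv] linear_0[OF linear_Jv]
      inner_add_left inner_add_right inner_diff_left inner_diff_right)

lemma so_iff: "X \<in> so_pq \<longleftrightarrow> (\<forall>x y. eta (X *v x) y = - eta x (X *v y))"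
  unfolding so_pq_def by (simp add: eq_neg_iff_add_eq_0)

lemma soD: "X \<in> so_pq \<Longrightarrow> eta (X *v x) y = - eta x (X *v y)"
  by (simp add: so_iff)

lemma wedge_apply: "wedge u w *v z = eta w z *\<^sub>R u - eta u z *\<^sub>R w"
proof -
  have "(wedge u w *v z) $ i = (eta w z *\<^sub>R u - eta u z *\<^sub>R w) $ i" for i
    unfolding pq_inner_Jv Jv_inner[symmetric]
    by (simp add: wedge_def matrix_vector_mult_def inner_vec_def sum_subtractf sum_distrib_left
        algebra_simps)
  then show ?thesis by (simp add: vec_eq_iff)
qed

lemma mat_eqI: "(\<And>z. X *v z = Y *v z) \<Longrightarrow> X = Y" for X Y :: "'n::finite lmat"
  by (simp add: matrix_eq)

lemma mat_uminus: "(- X) *v z = - (X *v z)" "X *v (- z) = - (X *v z)" for X :: "real^'a^'b"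
  using matrix_vector_mult_diff_rdistrib[of 0 X z] matrix_vector_mult_diff_distrib[of X 0 z]
  by auto

declare transpose_matrix_vector [simp del]

lemmas mat_distrib = mat_uminus matrix_vector_mult_add_rdistrib matrix_vector_mult_diff_rdistrib
  matrix_vector_right_distrib matrix_vector_mult_diff_distrib
  matrix_vector_mult_scaleR scaleR_matrix_vector_assoc[symmetric]

lemma wedge_in_so [simp]: "wedge u w \<in> so_pq"
  by (auto simp: so_iff wedge_apply eta_bilin eta_sym)

lemma wedge_bilin:
  "wedge (x + y) z = wedge x z + wedge y z" "wedge z (x + y) = wedge z x + wedge z y"
  "wedge (x - y) z = wedge x z - wedge y z" "wedge z (x - y) = wedge z x - wedge z y"
  "wedge (c *\<^sub>R x) z = c *\<^sub>R wedge x z" "wedge z (c *\<^sub>R x) = c *\<^sub>R wedge z x"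
  "wedge x x = 0" "wedge 0 z = 0" "wedge z 0 = 0"
  by (rule mat_eqI; simp add: wedge_apply mat_distrib eta_bilin algebra_simps)+

lemma wedge_swap: "wedge x y = - wedge y x"
  by (rule mat_eqI) (simp add: wedge_apply mat_distrib)

lemma br_apply: "br X Y *v z = X *v (Y *v z) - Y *v (X *v z)"
  by (simp add: br_def mat_distrib matrix_vector_mul_assoc)

lemma so_subspace: "subspace (so_pq :: 'n::finite lmat set)"
  by (auto simp: subspace_def so_iff mat_distrib eta_bilin)

lemmas so_add = subspace_add[OF so_subspace]
  and so_diff = subspace_diff[OF so_subspace]
  and so_scale = subspace_scale[OF so_subspace]
  and so_0 = subspace_0[OF so_subspace]
  and so_neg = subspace_neg[OF so_subspace]

lemma br_in_so: "X \<in> so_pq \<Longrightarrow> Y \<in> so_pq \<Longrightarrow> br X Y \<in> so_pq"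
  by (auto simp: so_iff br_apply eta_bilin)

text \<open>The adjoint action is the derivation action on the exterior square. The bracket
  relations of the grading below all rest on this identity.\<close>

lemma br_wedge: "X \<in> so_pq \<Longrightarrow> br X (wedge u w) = wedge (X *v u) w + wedge u (X *v w)"
  by (rule mat_eqI) (simp add: br_apply wedge_apply mat_distrib soD algebra_simps)

lemma br_bilin:
  "br (X + Y) Z = br X Z + br Y Z" "br Z (X + Y) = br Z X + br Z Y"
  "br (X - Y) Z = br X Z - br Y Z" "br Z (X - Y) = br Z X - br Z Y"
  "br (c *\<^sub>R X) Z = c *\<^sub>R br X Z" "br Z (c *\<^sub>R X) = c *\<^sub>R br Z X"
  "br X X = 0" "br 0 Z = 0" "br Z 0 = 0" "br (-X) Z = - br X Z" "br Z (-X) = - br Z X"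
  by (rule mat_eqI; simp add: br_apply mat_distrib algebra_simps)+

lemma br_swap: "br X Y = - br Y X"
  by (simp add: br_def)

lemma br_jacobi: "br X (br Y Z) = br (br X Y) Z + br Y (br X Z)"
  by (rule mat_eqI) (simp add: br_apply mat_distrib)

lemma linear_br: "linear (br X)"
  by (rule linearI) (simp_all add: br_bilin)

lemma linear_wedge1: "linear (\<lambda>u. wedge u w)" and linear_wedge2: "linear (wedge u)"
  by (rule linearI; simp add: wedge_bilin)+

lemma bounded_bilinear_wedge: "bounded_bilinear wedge"
  by (rule bilinear_conv_bounded_bilinear[THEN iffD1])
     (auto simp: bilinear_def linear_wedge1 linear_wedge2)

section \<open>The Cartan involution and the trace form\<close>

lemma transpose_wedge: "transpose (wedge u w) = - wedge (Jv u) (Jv w)"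
  by (simp add: wedge_def transpose_def vec_eq_iff mult.commute)

lemma inner_transpose: "(transpose X *v x) \<bullet> y = x \<bullet> (X *v y)" for X :: "real^'a^'b"
  by (simp add: dot_lmul_matrix transpose_matrix_vector)

lemma so_transpose_apply:
  assumes "X \<in> so_pq" shows "transpose X *v z = - Jv (X *v Jv z)"
proof -
  have "(transpose X *v z) \<bullet> y = (- Jv (X *v Jv z)) \<bullet> y" for y
    using soD[OF assms, of "Jv z" y] by (simp add: inner_transpose pq_inner_Jv Jv_inner)
  then show ?thesis using vector_eq_rdot by blast
qed

lemma eta_Jv: "eta (Jv x) y = eta x (Jv y)"
  by (simp add: pq_inner_Jv Jv_inner)

lemma so_transpose: fixes X :: "'n::finite lmat" assumes "X \<in> so_pq" shows "transpose X \<in> so_pq"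
  unfolding so_iff
proof (intro allI)
  fix x y
  show "eta (transpose X *v x) y = - eta x (transpose X *v y)"
    using soD[OF assms, of "Jv x" "Jv y"]
    by (simp add: so_transpose_apply[OF assms] eta_bilin eta_Jv)
qed

lemma transpose_linear [simp]:
  "transpose (X + Y) = transpose X + transpose Y"
  "transpose (X - Y) = transpose X - transpose Y"
  "transpose (- X) = - transpose X"
  "transpose (c *\<^sub>R X) = c *\<^sub>R transpose X" for X Y :: "real^'a^'b"
  by (auto simp: transpose_def vec_eq_iff)

lemma transpose_br: "transpose (br X Y) = - br (transpose X) (transpose Y)"
  by (simp add: br_def matrix_transpose_mul)

lemma inner_transpose_transpose: "transpose X \<bullet> transpose Y = X \<bullet> Y" for X Y :: "real^'a^'b"
  by (simp add: inner_vec_def transpose_def) (rule sum.swap)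

lemma inner_matrix_mult_left: "(A ** X) \<bullet> Y = X \<bullet> (transpose A ** Y)"
  for A X Y :: "real^'a^'a"
proof -
  have "(A ** X) \<bullet> Y = (\<Sum>i\<in>UNIV. \<Sum>j\<in>UNIV. \<Sum>k\<in>UNIV. A$i$k * X$k$j * Y$i$j)"
    by (simp add: inner_vec_def matrix_matrix_mult_def sum_distrib_right)
  also have "\<dots> = (\<Sum>i\<in>UNIV. \<Sum>k\<in>UNIV. \<Sum>j\<in>UNIV. A$i$k * X$k$j * Y$i$j)"
    by (rule sum.cong[OF refl], rule sum.swap)
  also have "\<dots> = (\<Sum>k\<in>UNIV. \<Sum>i\<in>UNIV. \<Sum>j\<in>UNIV. A$i$k * X$k$j * Y$i$j)"
    by (rule sum.swap)
  also have "\<dots> = (\<Sum>k\<in>UNIV. \<Sum>j\<in>UNIV. \<Sum>i\<in>UNIV. A$i$k * X$k$j * Y$i$j)"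
    by (rule sum.cong[OF refl], rule sum.swap)
  also have "\<dots> = X \<bullet> (transpose A ** Y)"
    by (simp add: inner_vec_def matrix_matrix_mult_def sum_distrib_left transpose_def algebra_simps)
  finally show ?thesis .
qed

lemma inner_matrix_mult_right: "(X ** A) \<bullet> Y = X \<bullet> (Y ** transpose A)"
  for A X Y :: "real^'a^'a"
  using inner_matrix_mult_left[of "transpose A" "transpose X" "transpose Y"]
  by (metis inner_transpose_transpose matrix_transpose_mul transpose_transpose)

text \<open>Left and right multiplication by \<open>Z\<close> both have multiplication by
  \<open>transpose Z\<close> as adjoint. In particular \<open>br X\<close> is normal as soon as
  \<open>X\<close> commutes with its transpose.\<close>

lemma inner_br: "br Z X \<bullet> Y = X \<bullet> br (transpose Z) Y"
  unfolding br_def inner_diff_left inner_diff_right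
  by (simp only: inner_matrix_mult_left[of Z X Y] inner_matrix_mult_right[of X Z Y])

text \<open>The orthogonal projection onto \<open>so_pq\<close>. Composition with it turns a trace
  over this subspace into a trace over all matrices, where an explicit basis is at hand.\<close>

definition so_proj :: "'n::finite lmat \<Rightarrow> 'n lmat" where
  "so_proj Z = (1/2) *\<^sub>R (Z - matrix Jv ** transpose Z ** matrix Jv)"

definition op_trace :: "('v::euclidean_space \<Rightarrow> 'v) \<Rightarrow> real" where
  "op_trace F = (\<Sum>b\<in>Basis. F b \<bullet> b)"

lemma matrix_Jv_apply [simp]: "matrix Jv *v x = Jv x"
  by (simp add: linear_Jv matrix_vector_mul(1))

lemma transpose_matrix_Jv [simp]: "transpose (matrix Jv) = matrix Jv"
proof (rule mat_eqI)
  fix z show "transpose (matrix Jv) *v z = matrix Jv *v z"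
    by (rule vector_eq_rdot[THEN iffD1]) (simp add: inner_transpose Jv_inner)
qed

lemma so_proj_apply: "so_proj Z *v z = (1/2) *\<^sub>R (Z *v z - Jv (transpose Z *v Jv z))"
  by (simp add: so_proj_def mat_distrib flip: matrix_vector_mul_assoc)

lemma linear_so_proj: "linear so_proj"
proof (rule linearI; rule mat_eqI)
  show "so_proj (X + Y) *v z = (so_proj X + so_proj Y) *v z" for X Y z
    by (simp add: so_proj_apply mat_distrib linear_add[OF linear_Jv] algebra_simps)
  show "so_proj (r *\<^sub>R X) *v z = (r *\<^sub>R so_proj X) *v z" for r X z
    by (simp add: so_proj_apply mat_distrib linear_scale[OF linear_Jv] scaleR_diff_right)
qed

lemma so_proj_in_so: "so_proj Z \<in> so_pq"
proof -
  have *: "eta (so_proj Z *v x) y = (1/2) * ((Z *v x) \<bullet> Jv y - Jv x \<bullet> (Z *v y))" for x y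
    by (simp add: so_proj_def mat_distrib eta_bilin matrix_vector_mul_assoc[symmetric] pq_inner_Jv
        Jv_inner inner_transpose inner_diff_left)
  have "eta (so_proj Z *v x) y = - eta x (so_proj Z *v y)" for x y
    unfolding eta_sym[of x "so_proj Z *v y"] * by (simp add: inner_commute field_simps)
  then show ?thesis by (simp add: so_iff)
qed

lemma so_proj_id: "X \<in> so_pq \<Longrightarrow> so_proj X = X"
  by (rule mat_eqI) (simp add: so_proj_apply so_transpose_apply linear_neg[OF linear_Jv])

lemma op_trace_mat: "op_trace F = (\<Sum>i\<in>UNIV. \<Sum>j\<in>UNIV. F (axis i (axis j 1)) $ i $ j)"
  for F :: "real^'a^'b \<Rightarrow> real^'a^'b"
proof -
  let ?E = "\<lambda>(i, j). axis i (axis j 1) :: real^'a^'b"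
  have B: "(Basis :: (real^'a^'b) set) = ?E ` (UNIV \<times> UNIV)"
    by (auto simp: Basis_vec_def)
  have inj: "inj_on ?E (UNIV \<times> UNIV)"
    by (auto simp: inj_on_def axis_eq_axis)
  show ?thesis
    unfolding op_trace_def B sum.reindex[OF inj] sum.cartesian_product
    by (simp add: case_prod_beta inner_axis o_def)
qed

lemma op_trace_commute:
  fixes A B :: "'v::euclidean_space \<Rightarrow> 'v"
  assumes "linear A" "linear B" shows "op_trace (\<lambda>x. A (B x)) = op_trace (\<lambda>x. B (A x))"
proof -
  have *: "op_trace (\<lambda>x. A (B x)) = (\<Sum>b\<in>Basis. \<Sum>c\<in>Basis. (B b \<bullet> c) * (A c \<bullet> b))"
    if "linear A" for A B :: "'v \<Rightarrow> 'v"
  proof -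
    have "A (B b) = (\<Sum>c\<in>Basis. (B b \<bullet> c) *\<^sub>R A c)" for b
      by (subst euclidean_representation[of "B b", symmetric])
         (simp add: linear_sum[OF that] linear_scale[OF that])
    then show ?thesis by (simp add: op_trace_def inner_sum_left)
  qed
  show ?thesis unfolding *[OF assms(1)] *[OF assms(2)]
    by (subst sum.swap) (simp add: mult.commute)
qed

lemma op_trace_add: "op_trace (\<lambda>x. F x + G x) = op_trace F + op_trace G"
  and op_trace_diff: "op_trace (\<lambda>x. F x - G x) = op_trace F - op_trace G"
  and op_trace_scale: "op_trace (\<lambda>x. c *\<^sub>R F x) = c * op_trace F"
  by (simp_all add: op_trace_def inner_add_left inner_diff_left sum.distrib sum_subtractf
      sum_distrib_left)

lemma axis_axis_nth: "axis i (axis j 1) $ k $ l = (if k = i then if l = j then 1 else 0 else (0::real))"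
  by (simp add: axis_def)

lemma mult_unit_left: "(A ** (axis i (axis j 1) :: real^'a^'b)) $ k $ l = (if l = j then A $ k $ i else 0)"
  by (cases "l = j") (simp_all add: matrix_matrix_mult_def axis_axis_nth mult_delta_right)

lemma transpose_unit: "transpose (axis i (axis j 1) :: real^'a^'b) = axis j (axis i 1)"
  by (auto simp: vec_eq_iff transpose_def axis_axis_nth)

lemma mult_unit: "(A ** axis i (axis j 1) ** B) $ k $ l = A $ k $ i * B $ j $ l" for A B :: "real^'a^'a"
  by (simp add: matrix_matrix_mult_def[of "A ** axis i (axis j 1)"] mult_unit_left mult_delta_left)

lemma op_trace_mult: "op_trace (\<lambda>Z. A ** Z ** B) = trace A * trace B" for A B :: "real^'a^'a"
  by (simp add: op_trace_mat trace_def sum_product mult_unit)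

lemma op_trace_mult_transpose: "op_trace (\<lambda>Z. A ** transpose Z ** B) = A \<bullet> B"
  for A B :: "real^'a^'a"
  by (simp add: op_trace_mat inner_vec_def transpose_unit mult_unit)

lemma trace_inner: "trace (X ** Y) = X \<bullet> transpose Y" for X Y :: "real^'a^'a"
  by (simp add: trace_def inner_vec_def matrix_matrix_mult_def transpose_def)

lemma matrix_Jv_Jv: "matrix Jv ** matrix Jv = mat 1"
  by (rule mat_eqI) (simp flip: matrix_vector_mul_assoc)

lemma so_conj_Jv: "X \<in> so_pq \<Longrightarrow> matrix Jv ** X ** matrix Jv = - transpose X"
  by (rule mat_eqI) (simp add: so_transpose_apply mat_distrib flip: matrix_vector_mul_assoc)

lemma trace_so: assumes "X \<in> (so_pq :: 'n::finite lmat set)" shows "trace X = 0"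
proof -
  have "trace (- transpose X) = trace X"
    unfolding so_conj_Jv[OF assms, symmetric]
    using trace_mul_sym[of "matrix Jv" "X ** matrix Jv"]
    by (simp add: matrix_mul_assoc[symmetric] matrix_Jv_Jv) 
  moreover have "trace (- transpose X) = - trace X"
    by (simp add: trace_def transpose_def sum_negf)
  ultimately show ?thesis by simp
qed

text \<open>On so(N) the Killing form is N - 2 times the trace form; here N = n + 1. Composed with
  \<open>so_proj\<close> the operator is a combination of maps Z -> A Z B and Z -> A Z^T B, whose
  traces are tr A tr B and the Frobenius product of A and B. The terms X Z Y and Y Z X drop out
  because elements of \<open>so_pq\<close> have trace zero.\<close>

lemma killing_form:
  fixes X Y :: "'n::finite lmat"
  assumes "X \<in> so_pq" "Y \<in> so_pq"
  shows "op_trace (\<lambda>Z. br X (br Y (so_proj Z))) = (real CARD('n) - 1) * (X \<bullet> transpose Y)"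
proof -
  let ?J = "matrix Jv :: 'n lmat"
  have ad: "br X (br Y Z) = X ** Y ** Z ** mat 1 - X ** Z ** Y - Y ** Z ** X + mat 1 ** Z ** (Y ** X)" for Z
    by (rule mat_eqI) (simp add: br_apply mat_distrib flip: matrix_vector_mul_assoc)
  have e: "br X (br Y (so_proj Z)) =
    (1/2) *\<^sub>R ((X ** Y) ** Z ** mat 1 - X ** Z ** Y - Y ** Z ** X + mat 1 ** Z ** (Y ** X)
      - ((X ** Y ** ?J) ** transpose Z ** ?J - (X ** ?J) ** transpose Z ** (?J ** Y)
       - (Y ** ?J) ** transpose Z ** (?J ** X) + ?J ** transpose Z ** (?J ** Y ** X)))" for Z
    by (rule mat_eqI)
       (simp add: br_apply so_proj_apply mat_distrib linear_diff[OF linear_Jv] flip: matrix_vector_mul_assoc,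
        simp add: algebra_simps)
  have t1: "trace (Y ** X) = trace (X ** Y)" by (rule trace_mul_sym)
  have i1: "(X ** Y ** ?J) \<bullet> ?J = trace (X ** Y)"
    by (simp add: inner_matrix_mult_right[of "X ** Y"] matrix_Jv_Jv trace_inner[of "X**Y" "mat 1", simplified])
  have i2: "?J \<bullet> (?J ** Y ** X) = trace (X ** Y)"
    using inner_matrix_mult_left[of "?J" "Y ** X" "?J"] trace_inner[of "Y**X" "mat 1"] t1
    by (simp add: matrix_mul_assoc matrix_Jv_Jv inner_commute)
  have i3: "(A ** ?J) \<bullet> (?J ** B) = - trace (A ** B)" if "A \<in> so_pq" for A B
  proof -
    have "(A ** ?J) \<bullet> (?J ** B) = (?J ** A ** ?J) \<bullet> B"
      using inner_matrix_mult_left[of ?J "A ** ?J" B] by (simp add: matrix_mul_assoc)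
    also have "\<dots> = - trace (A ** B)"
      using inner_transpose_transpose[of A "transpose B"] by (simp add: so_conj_Jv[OF that] trace_inner)
    finally show ?thesis .
  qed
  have "trace (mat 1 :: 'n lmat) = real CARD('n) + 1"
    by (simp add: trace_I)
  then show ?thesis
    unfolding e op_trace_scale op_trace_diff op_trace_add op_trace_mult op_trace_mult_transpose
      i1 i2 i3[OF assms(1)] i3[OF assms(2)] t1 trace_so[OF assms(1)]
    by (simp add: trace_inner algebra_simps)
qed

text \<open>Automorphisms preserve the Killing form, which is a multiple of the trace form.\<close>

locale so_auto =
  fixes T T' :: "'n::finite lmat \<Rightarrow> 'n lmat"
  assumes linear_T: "linear T" and linear_T': "linear T'"
    and T_so: "X \<in> so_pq \<Longrightarrow> T X \<in> so_pq" and T'_so: "X \<in> so_pq \<Longrightarrow> T' X \<in> so_pq"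
    and T'_T: "X \<in> so_pq \<Longrightarrow> T' (T X) = X" and T_T': "X \<in> so_pq \<Longrightarrow> T (T' X) = X"
    and T_br: "X \<in> so_pq \<Longrightarrow> Y \<in> so_pq \<Longrightarrow> T (br X Y) = br (T X) (T Y)"
begin

lemma T'_br: "X \<in> so_pq \<Longrightarrow> Y \<in> so_pq \<Longrightarrow> T' (br X Y) = br (T' X) (T' Y)"
  by (metis T'_T T_T' T'_so T_br br_in_so)

text \<open>\<open>A\<close> extends \<open>T\<close> by the identity on the kernel of
  \<open>so_proj\<close>, so the operators for \<open>T X\<close>, \<open>T Y\<close> and for
  \<open>X\<close>, \<open>Y\<close> are conjugate on the space of all matrices and have equal
  traces. The factor n - 1 of the Killing form can be cancelled because n \<ge> 2.\<close>

lemma trace_form_invariant: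
  assumes n: "CARD('n) \<ge> 2" and X: "X \<in> so_pq" and Y: "Y \<in> so_pq"
  shows "T X \<bullet> transpose (T Y) = X \<bullet> transpose Y"
proof -
  define A where "A Z = T (so_proj Z) + (Z - so_proj Z)" for Z
  define A' where "A' Z = T' (so_proj Z) + (Z - so_proj Z)" for Z
  have lin: "linear A" "linear A'"
    unfolding A_def A'_def by (intro linear_compose_add linear_compose_sub linear_id
      linear_compose[OF linear_so_proj linear_T, unfolded o_def] linear_so_proj
      linear_compose[OF linear_so_proj linear_T', unfolded o_def] linear_ident)+
  have pA': "so_proj (A' Z) = T' (so_proj Z)" for Z
    by (simp add: A'_def linear_add[OF linear_so_proj] linear_diff[OF linear_so_proj] so_proj_id
        so_proj_in_so T'_so)
  have pA: "so_proj (A Z) = T (so_proj Z)" for Z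
    by (simp add: A_def linear_add[OF linear_so_proj] linear_diff[OF linear_so_proj] so_proj_id
        so_proj_in_so T_so)
  have A'A: "A' (A Z) = Z" for Z
    unfolding A'_def pA by (simp add: A_def T'_T so_proj_in_so)
  define F where "F Z = br X (br Y (so_proj Z))" for Z
  have "linear F" unfolding F_def
    using linear_compose[OF linear_so_proj linear_compose[OF linear_br linear_br]]
    by (simp add: o_def)
  have Fso: "F Z \<in> so_pq" for Z by (simp add: F_def br_in_so X Y so_proj_in_so)
  have "br (T X) (br (T Y) (so_proj Z)) = A (F (A' Z))" for Z
  proof -
    have "A (F (A' Z)) = T (F (A' Z))"
      by (simp add: A_def so_proj_id[OF Fso])
    also have "\<dots> = br (T X) (br (T Y) (so_proj Z))"
      by (simp add: F_def pA' T_br br_in_so X Y so_proj_in_so T'_so T_T')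
    finally show ?thesis by simp
  qed
  then have "op_trace (\<lambda>Z. br (T X) (br (T Y) (so_proj Z))) = op_trace (\<lambda>Z. F (A' (A Z)))"
    using op_trace_commute[OF lin(1) linear_compose[OF lin(2) \<open>linear F\<close>]] by (simp add: o_def)
  then have "(real CARD('n) - 1) * (T X \<bullet> transpose (T Y)) = (real CARD('n) - 1) * (X \<bullet> transpose Y)"
    using killing_form[OF T_so[OF X] T_so[OF Y]] killing_form[OF X Y] by (simp add: A'A F_def)
  then show ?thesis using n by simp
qed

end

section \<open>Null frames and the associated grading\<close>

text \<open>The value -2 is that of the pair \<open>e0 + \<omega>\<close>,
  \<open>e0 - \<omega>\<close>. The condition \<open>pos\<close> carries the Lorentz signature: on
  the orthogonal complement of a null vector the form is semidefinite, with only that line as its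
  kernel.\<close>

locale null_frame =
  fixes l l' :: "'n::finite lvec"
  assumes ll: "eta l l = 0" and l'l': "eta l' l' = 0" and ll': "eta l l' = - 2"
    and pos: "eta x l = 0 \<Longrightarrow> eta x x > 0 \<or> (\<exists>c. x = c *\<^sub>R l)"
begin

text \<open>The data of a grading. With the factor -1/2 the boost has eigenvalues 1, -1, 0 on
  \<open>l\<close>, \<open>l'\<close>, \<open>E\<close>. The elements \<open>wedge l x\<close> and
  \<open>wedge l' x\<close> with \<open>x\<close> in \<open>E\<close> are its root spaces of weight
  1 and -1, and \<open>boost\<close> and \<open>rotations\<close> span its centralizer.
  \<open>pr\<close> projects onto \<open>E\<close> along the plane of \<open>l\<close> and
  \<open>l'\<close>.\<close>

definition "E = {x. eta x l = 0 \<and> eta x l' = 0}"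
definition "boost = (- 1/2) *\<^sub>R wedge l l'"
definition "rotations = {M \<in> so_pq. M *v l = 0 \<and> M *v l' = 0}"
definition "pr x = x + (eta x l' / 2) *\<^sub>R l + (eta x l / 2) *\<^sub>R l'"

lemma l'l: "eta l' l = - 2" by (simp add: eta_sym ll')

lemma subspace_E: "subspace E"
  by (auto simp: subspace_def E_def eta_bilin)

lemma ED: "x \<in> E \<Longrightarrow> eta x l = 0" "x \<in> E \<Longrightarrow> eta x l' = 0" "x \<in> E \<Longrightarrow> eta l x = 0"
    "x \<in> E \<Longrightarrow> eta l' x = 0"
  by (auto simp: E_def eta_sym)

lemma pr_E [simp]: "pr x \<in> E"
  by (simp add: pr_def E_def eta_bilin ll l'l' ll' l'l)

lemma pr_id: "x \<in> E \<Longrightarrow> pr x = x"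
  by (simp add: pr_def E_def)

lemma linear_pr: "linear pr"
  by (rule linearI) (simp_all add: pr_def eta_bilin algebra_simps add_divide_distrib)

lemma E_pos: assumes "x \<in> E" "x \<noteq> 0" shows "eta x x > 0"
  using pos[of x] assms by (auto simp: E_def eta_bilin ll')

lemma boost_so [simp]: "boost \<in> so_pq"
  by (simp add: boost_def so_scale so_neg)

lemma boost_apply: "boost *v l = l" "boost *v l' = - l'" "x \<in> E \<Longrightarrow> boost *v x = 0"
  by (simp_all add: boost_def mat_distrib wedge_apply ll l'l' ll' l'l ED)

lemma rotationsD:
  assumes "M \<in> rotations" shows "M \<in> so_pq" "M *v l = 0" "M *v l' = 0" "M *v x \<in> E"
  using assms by (auto simp: rotations_def E_def soD eta_bilin)

lemma subspace_rotations: "subspace rotations"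
  by (auto simp: subspace_def rotations_def mat_distrib so_add so_scale so_0)

lemma wedge_E:
  assumes "x \<in> E" "y \<in> E" shows "wedge x y \<in> rotations"
  using assms by (simp add: rotations_def wedge_apply ED)

text \<open>Antisymmetry leaves \<open>X *v l\<close> without component along \<open>l'\<close> and
  \<open>X *v l'\<close> without component along \<open>l\<close>. So the two images determine
  \<alpha>, \<open>x\<close> and \<open>y\<close>, and the remainder kills both null
  vectors.\<close>

lemma decompose:
  assumes X: "X \<in> so_pq"
  obtains \<alpha> x y M where "x \<in> E" "y \<in> E" "M \<in> rotations"
    "X = \<alpha> *\<^sub>R boost + wedge l x + wedge l' y + M"
proof -
  define \<alpha> where "\<alpha> = - eta (X *v l) l' / 2"
  define x where "x = (1/2) *\<^sub>R pr (X *v l')"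
  define y where "y = (1/2) *\<^sub>R pr (X *v l)"
  have E: "x \<in> E" "y \<in> E"
    by (simp_all add: x_def y_def subspace_scale[OF subspace_E])
  define M where "M = X - \<alpha> *\<^sub>R boost - wedge l x - wedge l' y"
  have 1: "eta (X *v l) l = 0" "eta (X *v l') l' = 0"
    using soD[OF X, of l l] soD[OF X, of l' l'] by (simp_all add: eta_sym)
  have 2: "eta (X *v l') l = 2 * \<alpha>"
    using soD[OF X, of l l'] by (simp add: \<alpha>_def eta_sym)
  have Xl: "X *v l = 2 *\<^sub>R y + \<alpha> *\<^sub>R l"
    by (simp add: y_def pr_def 1 \<alpha>_def)
  have Xl': "X *v l' = 2 *\<^sub>R x - \<alpha> *\<^sub>R l'"
    by (simp add: x_def pr_def 1 2)
  have "M *v l = 0" "M *v l' = 0"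
    by (simp_all add: M_def mat_distrib boost_apply wedge_apply ED[OF E(1)] ED[OF E(2)] ll l'l' ll' l'l Xl Xl')
  then have "M \<in> rotations"
    by (simp add: rotations_def M_def X so_diff so_scale)
  then show thesis
    by (intro that[OF E, of M \<alpha>]) (simp_all add: M_def)
qed

lemma br_boost_l: "x \<in> E \<Longrightarrow> br boost (wedge l x) = wedge l x"
  and br_boost_l': "x \<in> E \<Longrightarrow> br boost (wedge l' x) = - wedge l' x"
  and br_boost_rot: "M \<in> rotations \<Longrightarrow> br boost M = 0"
proof -
  show "x \<in> E \<Longrightarrow> br boost (wedge l x) = wedge l x" "x \<in> E \<Longrightarrow> br boost (wedge l' x) = - wedge l' x"
    using wedge_bilin(5)[of "-1" l' x] by (simp_all add: br_wedge boost_apply wedge_bilin)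
  assume M: "M \<in> rotations"
  have "br M (wedge l l') = 0"
    by (simp add: br_wedge rotationsD[OF M] wedge_bilin)
  then have "br M boost = 0" by (simp add: boost_def br_bilin)
  then show "br boost M = 0" using br_swap[of boost M] by simp
qed

lemma br_rot: "M \<in> rotations \<Longrightarrow> br M (wedge l x) = wedge l (M *v x)"
  "M \<in> rotations \<Longrightarrow> br M (wedge l' x) = wedge l' (M *v x)"
  by (simp_all add: br_wedge rotationsD wedge_bilin)

lemma br_l_l':
  assumes "x \<in> E" "y \<in> E"
  shows "br (wedge l x) (wedge l' y) = 2 *\<^sub>R wedge x y + (2 * eta x y) *\<^sub>R boost"
  using wedge_swap[of l' l]
  by (simp add: br_wedge wedge_apply ED assms ll' wedge_bilin boost_def)

lemma mat_sum: "(\<Sum>b\<in>A. F b) *v z = (\<Sum>b\<in>A. F b *v z)" for F :: "'b \<Rightarrow> real^'c^'d"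
  by (induction A rule: infinite_finite_induct) (simp_all add: mat_distrib)

text \<open>With respect to \<open>eta\<close> the vectors \<open>Jv b\<close> are dual to the
  standard basis. The formula writes a rotation as a sum of wedges of vectors of \<open>E\<close>
  without choosing a basis of \<open>E\<close>, so linear statements on rotations need only be
  checked on such wedges.\<close>

lemma rotation_expand:
  assumes M: "M \<in> rotations"
  shows "M = (1/2) *\<^sub>R (\<Sum>b\<in>Basis. wedge (M *v b) (pr (Jv b)))"
proof (rule mat_eqI)
  fix z
  note so = rotationsD(1)[OF M]
  have basis: "(\<Sum>b\<in>Basis. (b \<bullet> z) *\<^sub>R b) = z" for z :: "'n lvec"
    using euclidean_representation[of z] by (simp add: inner_commute)
  have lM: "linear ((*v) M)" by (rule matrix_vector_mul_linear)
  have s1: "(\<Sum>b\<in>Basis. (b \<bullet> y) *\<^sub>R (M *v b)) = M *v y" for y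
    using linear_sum[OF lM, of "\<lambda>b. (b \<bullet> y) *\<^sub>R b" Basis] by (simp add: mat_distrib basis)
  have "(\<Sum>b\<in>Basis. wedge (M *v b) (pr (Jv b)) *v z) =
    (\<Sum>b\<in>Basis. eta (pr (Jv b)) z *\<^sub>R (M *v b)) + (\<Sum>b\<in>Basis. (b \<bullet> Jv (M *v z)) *\<^sub>R pr (Jv b))"
  proof -
    have "eta (M *v b) z = - (b \<bullet> Jv (M *v z))" for b
      using soD[OF so, of b z] by (simp add: pq_inner_Jv)
    then show ?thesis by (simp add: wedge_apply sum.distrib)
  qed
  also have "(\<Sum>b\<in>Basis. (b \<bullet> Jv (M *v z)) *\<^sub>R pr (Jv b)) = pr (Jv (Jv (M *v z)))"
    by (subst (2) basis[of "Jv (M *v z)", symmetric])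
       (simp add: linear_sum[OF linear_pr] linear_sum[OF linear_Jv] linear_scale[OF linear_Jv]
         linear_scale[OF linear_pr])
  also have "\<dots> = M *v z"
    using rotationsD(2,3)[OF M] soD[OF so, of z l] soD[OF so, of z l']
    by (simp add: pr_def eta_bilin)
  also have "(\<Sum>b\<in>Basis. eta (pr (Jv b)) z *\<^sub>R (M *v b)) = M *v pr z"
  proof -
    have "eta (pr (Jv b)) z = b \<bullet> pr z" for b
      by (simp add: pr_def eta_bilin inner_add_right eta_sym[of z]) (simp add: pq_inner_Jv Jv_inner mult.commute)
    then show ?thesis by (simp add: s1)
  qed
  also have "M *v pr z = M *v z"
    by (simp add: pr_def mat_distrib rotationsD[OF M])
  finally show "M *v z = (1/2) *\<^sub>R (\<Sum>b\<in>Basis. wedge (M *v b) (pr (Jv b))) *v z"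
    unfolding mat_distrib mat_sum by (simp flip: scaleR_2)
qed

end

section \<open>Invariant Lorentz forms on \<open>so(1,n) / h\<close>\<close>

text \<open>The form is defined on all matrices, but only its values on \<open>so_pq\<close> matter.
  The assumption \<open>lorentz\<close> is what is retained of the signature, and
  \<open>proper\<close> says that G/H has positive dimension.\<close>

locale lorentz_form =
  fixes b :: "'n::finite lmat \<Rightarrow> 'n lmat \<Rightarrow> real" and h :: "'n lmat set"
  assumes bilin: "bilinear b" and b_sym: "b X Y = b Y X"
    and h_def: "h = {X \<in> so_pq. \<forall>Y\<in>so_pq. b X Y = 0}"
    and h_inv: "X \<in> h \<Longrightarrow> Y \<in> so_pq \<Longrightarrow> Z \<in> so_pq \<Longrightarrow> b (br X Y) Z = - b Y (br X Z)"
    and lorentz: "X \<in> so_pq \<Longrightarrow> Y \<in> so_pq \<Longrightarrow> b X X = 0 \<Longrightarrow> b Y Y = 0 \<Longrightarrow> b X Y = 0 \<Longrightarrow>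
      \<exists>s t. (s \<noteq> 0 \<or> t \<noteq> 0) \<and> s *\<^sub>R X + t *\<^sub>R Y \<in> h"
    and proper: "h \<noteq> so_pq"
begin

lemmas b_bilin = bilinear_ladd[OF bilin] bilinear_radd[OF bilin] bilinear_lmul[OF bilin]
  bilinear_rmul[OF bilin] bilinear_lneg[OF bilin] bilinear_rneg[OF bilin] bilinear_lzero[OF bilin]
  bilinear_rzero[OF bilin] bilinear_lsub[OF bilin] bilinear_rsub[OF bilin]

lemma hD: "X \<in> h \<Longrightarrow> X \<in> so_pq" "X \<in> h \<Longrightarrow> Y \<in> so_pq \<Longrightarrow> b X Y = 0" "X \<in> h \<Longrightarrow> Y \<in> so_pq \<Longrightarrow> b Y X = 0"
  by (auto simp: h_def b_sym[of Y X])

lemma subspace_h: "subspace h"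
  by (auto simp: subspace_def h_def so_0 so_add so_scale b_bilin)

lemma h_br: assumes "X \<in> h" "Y \<in> h" shows "br X Y \<in> h"
  using h_inv[OF assms(1)] assms by (auto simp: h_def br_in_so)

end

text \<open>\<open>L1\<close>, \<open>L2\<close> and \<open>L3\<close> together express that the
  horospherical subalgebra of \<open>l\<close> is orthogonal to the whole parabolic subalgebra: to
  itself, to the boost and to the rotations.\<close>

locale framed_form = lorentz_form b h + null_frame l l'
  for b :: "'n::finite lmat \<Rightarrow> 'n lmat \<Rightarrow> real" and h and l l' :: "'n lvec" +
  assumes n2: "CARD('n) \<ge> 2"
    and L1: "x \<in> E \<Longrightarrow> y \<in> E \<Longrightarrow> b (wedge l x) (wedge l y) = 0"
    and L2: "x \<in> E \<Longrightarrow> b (wedge l x) boost = 0"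
    and L3: "x \<in> E \<Longrightarrow> M \<in> rotations \<Longrightarrow> b (wedge l x) M = 0"
begin

lemma br_l_g0:
  assumes "x \<in> E" "M \<in> rotations"
  shows "br (wedge l x) (\<gamma> *\<^sub>R boost + M) = - wedge l (M *v x + \<gamma> *\<^sub>R x)"
  using br_rot(1)[OF assms(2), of x] br_boost_l[OF assms(1)] br_swap[of "wedge l x" M] br_swap[of "wedge l x" boost]
  by (simp add: br_bilin wedge_bilin)

lemma E_M: "x \<in> E \<Longrightarrow> M \<in> rotations \<Longrightarrow> M *v x + \<gamma> *\<^sub>R x \<in> E"
  by (simp add: rotationsD(4) subspace_E subspace_add subspace_scale)

lemma br_l_l'_g0:
  assumes "x \<in> E" "y \<in> E"
  shows "br (wedge l x) (wedge l' y) = (2 * eta x y) *\<^sub>R boost + 2 *\<^sub>R wedge x y"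
    "2 *\<^sub>R wedge x y \<in> rotations"
  using assms by (simp_all add: br_l_l' wedge_E subspace_scale[OF subspace_rotations])

lemma b_expand_zero:
  assumes "X \<in> so_pq" "b Y boost = 0" "\<And>x. x \<in> E \<Longrightarrow> b Y (wedge l x) = 0"
    "\<And>x. x \<in> E \<Longrightarrow> b Y (wedge l' x) = 0" "\<And>M. M \<in> rotations \<Longrightarrow> b Y M = 0"
  shows "b Y X = 0"
proof -
  obtain \<alpha> x y M where "x \<in> E" "y \<in> E" "M \<in> rotations"
    "X = \<alpha> *\<^sub>R boost + wedge l x + wedge l' y + M"
    using decompose[OF assms(1)] .
  then show ?thesis using assms(2-) by (simp add: b_bilin)
qed

text \<open>Invariance under \<open>boost\<close> multiplies the product of two weight vectors by
  the sum of their weights and gives zero. So only opposite weights can pair.\<close>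

lemma boost_weights:
  assumes a: "boost \<in> h"
  shows "x \<in> E \<Longrightarrow> y \<in> E \<Longrightarrow> b (wedge l' x) (wedge l' y) = 0"
    "M \<in> rotations \<Longrightarrow> x \<in> E \<Longrightarrow> b M (wedge l' x) = 0"
    "M \<in> rotations \<Longrightarrow> x \<in> E \<Longrightarrow> b M (wedge l x) = 0"
  using h_inv[OF a, of "wedge l' x" "wedge l' y"] h_inv[OF a, of M "wedge l' x"]
    h_inv[OF a, of M "wedge l x"]
  by (simp_all add: br_boost_l br_boost_l' br_boost_rot b_bilin rotationsD(1))

lemma rotation_b_zero:
  assumes "M \<in> rotations" "\<And>x y. x \<in> E \<Longrightarrow> y \<in> E \<Longrightarrow> b Y (wedge x y) = 0" shows "b Y M = 0"
  by (subst rotation_expand[OF assms(1)])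
     (simp add: b_bilin linear_sum[OF bilin[unfolded bilinear_def, THEN conjunct1, rule_format]]
       assms rotationsD)

lemma ex_outside_span:
  assumes "card A \<le> CARD('n)" "finite A" shows "\<exists>z :: 'n lvec. z \<notin> span A"
proof (rule ccontr)
  assume "\<not> ?thesis"
  then have "span A = UNIV" by auto
  then have "dim (UNIV :: 'n lvec set) \<le> card A"
    using dim_le_card[of UNIV A] assms by blast
  then show False using assms by simp
qed

lemma E_nontrivial: "\<exists>x\<in>E. x \<noteq> 0"
proof -
  have "card {l, l'} \<le> CARD('n)" using n2 card_2_iff' by (auto simp: card_insert_if)
  then obtain z where z: "z \<notin> span {l, l'}" using ex_outside_span[of "{l, l'}"] by auto
  have "pr z \<noteq> 0"
  proof
    assume "pr z = 0"
    moreover have "z = pr z - (eta z l' / 2) *\<^sub>R l - (eta z l / 2) *\<^sub>R l'"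
      by (simp add: pr_def)
    ultimately have "z = - (eta z l' / 2) *\<^sub>R l - (eta z l / 2) *\<^sub>R l'"
      by simp
    also have "\<dots> \<in> span {l, l'}"
      by (intro span_diff span_scale span_base) auto
    finally show False using z by simp
  qed
  then show ?thesis using pr_E by blast
qed

text \<open>Let n, g_0 and n^- be the parts of weight 1, 0 and -1. If n lies in the radical, then
  [n, n^-] is orthogonal to g_0, because [n, g_0] lies in n. As [n, n^-] contains the boost and the
  wedges of vectors of \<open>E\<close>, the form vanishes on g_0, and the boost turns out to be in
  \<open>h\<close>. The weights then kill all remaining products, against
  \<open>proper\<close>.\<close>

lemma not_all_horospherical: "\<exists>x\<in>E. wedge l x \<notin> h"
proof (rule ccontr)
  assume "\<not> ?thesis"
  then have N: "\<And>x. x \<in> E \<Longrightarrow> wedge l x \<in> h" by auto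
  obtain e where e: "e \<in> E" "e \<noteq> 0" using E_nontrivial by auto
  have g0: "b ((2 * eta x y) *\<^sub>R boost + 2 *\<^sub>R wedge x y) (\<gamma> *\<^sub>R boost + M) = 0"
    if "x \<in> E" "y \<in> E" "M \<in> rotations" for x y \<gamma> M
  proof -
    have "b (br (wedge l x) (wedge l' y)) (\<gamma> *\<^sub>R boost + M) =
      - b (wedge l' y) (br (wedge l x) (\<gamma> *\<^sub>R boost + M))"
      using that N by (intro h_inv) (simp_all add: so_add so_scale rotationsD(1))
    also have "\<dots> = 0"
      using that N hD(3) E_M unfolding br_l_g0[OF that(1,3)] by (simp add: b_bilin)
    finally show ?thesis using that by (simp add: br_l_l'_g0)
  qed
  have a_g0: "b boost (\<gamma> *\<^sub>R boost + M) = 0" if "M \<in> rotations" for \<gamma> M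
    using g0[OF e(1) e(1) that, of \<gamma>] E_pos[OF e] by (simp add: b_bilin(3) wedge_bilin)
  have a_a: "b boost boost = 0"
    using a_g0[of 0 1] by (simp add: subspace_0[OF subspace_rotations])
  have a_M: "b boost M = 0" if "M \<in> rotations" for M
    using a_g0[of M 0] that by simp
  have W: "b (wedge x y) M = 0" if "x \<in> E" "y \<in> E" "M \<in> rotations" for x y M
    using g0[OF that, of 0] a_M[OF that(3)] by (simp add: b_bilin)
  have M_M: "b M M' = 0" if "M \<in> rotations" "M' \<in> rotations" for M M'
    unfolding b_sym[of M M'] using that(2)
    by (intro rotation_b_zero[OF that(1)]) (subst b_sym, rule W)
  have a_l': "b boost (wedge l' x) = 0" if x: "x \<in> E" for x
  proof (cases "x = 0")
    case False
    \<comment> \<open>By symmetry of \<open>b\<close> both sides are the same number up to sign,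
      hence zero, and the bracket is a positive multiple of \<open>boost\<close>.\<close>
    have "b (br (wedge l x) (wedge l' x)) (wedge l' x) = - b (wedge l' x) (br (wedge l x) (wedge l' x))"
      using N[OF x] by (intro h_inv) auto
    then show ?thesis
      using E_pos[OF x False] by (simp add: br_l_l'_g0 x wedge_bilin b_bilin b_sym)
  qed (simp add: wedge_bilin b_bilin)
  have "b boost X = 0" if "X \<in> so_pq" for X
    using a_l' a_M L2 a_a subspace_0[OF subspace_rotations] 
    by (intro b_expand_zero[OF that]) (auto simp: b_sym[of boost "wedge l _"])
  then have a: "boost \<in> h" by (simp add: h_def)
  have zero: "b X Y = 0" if X: "X \<in> so_pq" and Y: "Y \<in> so_pq" for X Y
  proof (rule b_expand_zero[OF Y])
    show "b X boost = 0" by (rule hD(3)[OF a X])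
    show "b X (wedge l x) = 0" if "x \<in> E" for x using hD(3)[OF N[OF that] X] .
    show "b X (wedge l' x) = 0" if x: "x \<in> E" for x
    proof -
      have "b (wedge l' x) X = 0"
      proof (rule b_expand_zero[OF X])
        show "b (wedge l' x) M = 0" if "M \<in> rotations" for M
          unfolding b_sym[of "wedge l' x" M] by (rule boost_weights(2)[OF a that x])
      qed (use hD(3)[OF a] hD(3)[OF N] boost_weights(1)[OF a x] in simp_all)
      then show ?thesis by (simp add: b_sym[of X])
    qed
    show "b X M = 0" if M: "M \<in> rotations" for M
    proof -
      have "b M X = 0"
      proof (rule b_expand_zero[OF X])
        show "b M boost = 0" by (rule hD(3)[OF a rotationsD(1)[OF M]])
        show "b M (wedge l x) = 0" if "x \<in> E" for x by (rule hD(3)[OF N[OF that] rotationsD(1)[OF M]])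
        show "b M (wedge l' x) = 0" if "x \<in> E" for x by (rule boost_weights(2)[OF a M that])
        show "b M M' = 0" if "M' \<in> rotations" for M' by (rule M_M[OF M that])
      qed
      then show ?thesis by (simp add: b_sym[of X])
    qed
  qed
  then show False using proper by (auto simp: h_def)
qed

text \<open>Since the horospherical algebra is isotropic, any two of its elements are dependent
  modulo \<open>h\<close>, and it is not contained in \<open>h\<close>. The elements in
  \<open>h\<close> therefore form a hyperplane, and \<open>u\<close> is its unit normal in
  \<open>E\<close>, on which \<open>eta\<close> is positive definite.\<close>

lemma horospherical_hyperplane:
  obtains u where "u \<in> E" "eta u u = 1" "\<And>x. x \<in> E \<Longrightarrow> wedge l x \<in> h \<longleftrightarrow> eta x u = 0"
proof -
  obtain u0 where u0: "u0 \<in> E" "wedge l u0 \<notin> h" using not_all_horospherical by auto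
  define E0 where "E0 = {x\<in>E. wedge l x \<in> h}"
  have sE0: "subspace E0"
    using subspace_E subspace_h by (auto simp: subspace_def E0_def wedge_bilin)
  have comb: "\<exists>t. x - t *\<^sub>R u0 \<in> E0" if x: "x \<in> E" for x
  proof -
    obtain s t where st: "s \<noteq> 0 \<or> t \<noteq> 0" "s *\<^sub>R wedge l x + t *\<^sub>R wedge l u0 \<in> h"
      using lorentz[of "wedge l x" "wedge l u0"] L1 x u0 by auto
    have "s \<noteq> 0"
    proof
      assume "s = 0"
      then have "(1/t) *\<^sub>R (t *\<^sub>R wedge l u0) \<in> h" using st subspace_scale[OF subspace_h] by fastforce
      then show False using st \<open>s = 0\<close> u0 by simp
    qed
    then have "(1/s) *\<^sub>R (s *\<^sub>R wedge l x + t *\<^sub>R wedge l u0) \<in> h"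
      using st subspace_scale[OF subspace_h] by blast
    then have "wedge l (x - (- t / s) *\<^sub>R u0) \<in> h"
      using \<open>s \<noteq> 0\<close> by (simp add: wedge_bilin scaleR_add_right)
    then show ?thesis
      using x u0 subspace_E by (auto simp: E0_def intro!: exI[of _ "- t / s"] subspace_diff subspace_scale subspace_add)
  qed
  have uniq: "s = t" if "x - s *\<^sub>R u0 \<in> E0" "x - t *\<^sub>R u0 \<in> E0" for x s t
  proof (rule ccontr)
    assume "s \<noteq> t"
    have "(t - s) *\<^sub>R u0 \<in> E0"
      using subspace_diff[OF sE0 that] by (simp add: algebra_simps)
    then have "(1 / (t - s)) *\<^sub>R ((t - s) *\<^sub>R u0) \<in> E0"
      using subspace_scale[OF sE0] by blast
    then show False using \<open>s \<noteq> t\<close> u0 by (simp add: E0_def)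
  qed
  \<comment> \<open>The coefficient of \<open>u0\<close> modulo the hyperplane \<open>E0\<close>. It
    is unique, which makes this choice linear.\<close>
  define f where "f x = (SOME t. pr x - t *\<^sub>R u0 \<in> E0)" for x
  have f: "pr x - f x *\<^sub>R u0 \<in> E0" for x
    unfolding f_def using someI_ex[OF comb[OF pr_E]] .
  have "linear f"
  proof (rule linearI)
    show "f (x + y) = f x + f y" for x y
      using subspace_add[OF sE0 f[of x] f[of y]]
      by (intro uniq[OF f]) (simp add: linear_add[OF linear_pr] algebra_simps)
    show "f (r *\<^sub>R x) = r *\<^sub>R f x" for r x
      using subspace_scale[OF sE0 f[of x], of r]
      by (intro uniq[OF f]) (simp add: linear_scale[OF linear_pr] algebra_simps)
  qed
  define g where "g = (\<Sum>c\<in>Basis. f c *\<^sub>R c)"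
  have fg: "f x = x \<bullet> g" for x
  proof -
    have "f x = f (\<Sum>c\<in>Basis. (x \<bullet> c) *\<^sub>R c)" by (simp add: euclidean_representation)
    also have "\<dots> = x \<bullet> g"
      by (simp only: linear_sum[OF \<open>linear f\<close>] linear_scale[OF \<open>linear f\<close>])
         (simp add: g_def inner_sum_right mult.commute)
    finally show ?thesis .
  qed
  \<comment> \<open>\<open>g\<close> represents \<open>f\<close> for the Euclidean product;
    \<open>Jv\<close> converts it to \<open>eta\<close>, and \<open>pr\<close> moves it into
    \<open>E\<close> without changing its products with vectors of \<open>E\<close>.\<close>
  define u1 where "u1 = pr (Jv g)"
  have eta_u1: "eta x u1 = f x" if "x \<in> E" for x
    using that by (simp add: u1_def pr_def eta_bilin ED fg) (simp add: pq_inner_Jv)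
  have "f u0 = 1"
    by (rule uniq[OF f]) (simp add: pr_id u0 subspace_0[OF sE0])
  then have "u1 \<noteq> 0" using eta_u1[OF u0(1)] by (auto simp: eta_bilin)
  have u1E: "u1 \<in> E" by (simp add: u1_def)
  have p: "eta u1 u1 > 0" by (rule E_pos[OF u1E \<open>u1 \<noteq> 0\<close>])
  define u where "u = (1 / sqrt (eta u1 u1)) *\<^sub>R u1"
  have "wedge l x \<in> h \<longleftrightarrow> eta x u = 0" if x: "x \<in> E" for x
  proof -
    have "wedge l x \<in> h \<longleftrightarrow> x - 0 *\<^sub>R u0 \<in> E0" using x by (simp add: E0_def)
    also have "\<dots> \<longleftrightarrow> f x = 0" using uniq[of x] f[of x] by (auto simp: pr_id x)
    finally show ?thesis using p by (simp add: u_def eta_bilin eta_u1[OF x])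
  qed
  moreover have "u \<in> E" "eta u u = 1"
    using p by (simp_all add: u_def u1E subspace_scale[OF subspace_E] eta_bilin)
  ultimately show thesis using that by blast
qed

end

section \<open>Determination of \<open>h\<close> from the horospherical hyperplane\<close>

context framed_form
begin

lemma br_l_g0_mod:
  assumes u: "u \<in> E" "eta u u = 1" "\<And>x. x \<in> E \<Longrightarrow> wedge l x \<in> h \<longleftrightarrow> eta x u = 0"
    and "x \<in> E" "Y \<in> so_pq"
  shows "b (wedge l x) Y = eta x u * b (wedge l u) Y"
proof -
  have "wedge l (x - eta x u *\<^sub>R u) \<in> h"
    using assms by (subst u(3)) (simp_all add: subspace_E subspace_diff subspace_scale eta_bilin)
  from hD(2)[OF this assms(5)] show ?thesis by (simp add: wedge_bilin b_bilin)
qed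

text \<open>Invariance moves \<open>wedge l y\<close>, an element of \<open>h\<close>, to the other
  argument, where the boost only rescales it; hence \<gamma> drops out. From this identity come the
  pairing of the two root spaces, the isotropy of the boost and the action of rotations on
  \<open>u\<close>.\<close>

lemma b_br_l_l'_g0:
  assumes u: "u \<in> E" "eta u u = 1" "\<And>x. x \<in> E \<Longrightarrow> wedge l x \<in> h \<longleftrightarrow> eta x u = 0"
    and y: "y \<in> E" "eta y u = 0" and v: "v \<in> E" and M: "M \<in> rotations"
  shows "b (br (wedge l y) (wedge l' v)) (\<gamma> *\<^sub>R boost + M) = b (wedge l u) (wedge l' v) * eta (M *v y) u"
proof -
  have "b (br (wedge l y) (wedge l' v)) (\<gamma> *\<^sub>R boost + M)
      = - b (wedge l' v) (br (wedge l y) (\<gamma> *\<^sub>R boost + M))"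
    using y u(3) by (intro h_inv) (simp_all add: so_add so_scale rotationsD(1)[OF M])
  also have "\<dots> = b (wedge l (M *v y + \<gamma> *\<^sub>R y)) (wedge l' v)"
    by (simp add: br_l_g0 y M b_bilin b_sym)
  also have "\<dots> = eta (M *v y + \<gamma> *\<^sub>R y) u * b (wedge l u) (wedge l' v)"
    by (rule br_l_g0_mod[OF u E_M[OF y(1) M]]) simp_all
  finally show ?thesis by (simp add: eta_bilin y)
qed

text \<open>For \<open>y\<close> orthogonal to \<open>u\<close>, evaluate \<open>b\<close> on the
  brackets of \<open>wedge l y\<close> with \<open>wedge l' v\<close> and with
  \<open>wedge l' v'\<close>. The result is a multiple of \<phi>(v) eta(v', u), and symmetry of
  \<open>b\<close> forces \<phi> to be proportional to the product with \<open>u\<close>. If no such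
  \<open>y\<close> exists, \<open>E\<close> is a line. The factor is nonzero because otherwise
  \<open>wedge l u\<close> would be in the radical.\<close>

lemma functional:
  assumes u: "u \<in> E" "eta u u = 1" "\<And>x. x \<in> E \<Longrightarrow> wedge l x \<in> h \<longleftrightarrow> eta x u = 0"
  obtains lam where "lam \<noteq> 0" "\<And>v. v \<in> E \<Longrightarrow> b (wedge l u) (wedge l' v) = lam * eta v u"
proof -
  define \<phi> where "\<phi> v = b (wedge l u) (wedge l' v)" for v
  have \<phi>: "\<phi> v = \<phi> u * eta v u" if v: "v \<in> E" for v
  proof (cases "\<exists>y\<in>E. y \<noteq> 0 \<and> eta y u = 0")
    case True
    then obtain y where y: "y \<in> E" "y \<noteq> 0" "eta y u = 0" by auto
    have *: "b (br (wedge l y) (wedge l' v)) (br (wedge l y) (wedge l' v')) = - 2 * \<phi> v * eta y y * eta v' u"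
      if "v \<in> E" "v' \<in> E" for v v'
      unfolding br_l_l'_g0(1)[OF y(1) that(2)]
      by (subst b_br_l_l'_g0[OF u y(1,3) that(1) br_l_l'_g0(2)[OF y(1) that(2)]])
         (simp_all add: \<phi>_def mat_distrib wedge_apply eta_bilin y)
    from *[OF v u(1)] *[OF u(1) v] b_sym[of "br (wedge l y) (wedge l' v)"] E_pos[OF y(1,2)] u(2)
    show ?thesis by simp
  next
    case False
    have "v - eta v u *\<^sub>R u \<in> E" "eta (v - eta v u *\<^sub>R u) u = 0"
      using u v by (simp_all add: subspace_E subspace_diff subspace_scale eta_bilin)
    with False have "v = eta v u *\<^sub>R u" by auto
    then have "\<phi> v = \<phi> (eta v u *\<^sub>R u)" by simp
    also have "\<dots> = \<phi> u * eta v u" by (simp add: \<phi>_def wedge_bilin b_bilin)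
    finally show ?thesis .
  qed
  have "\<phi> u \<noteq> 0"
  proof
    assume "\<phi> u = 0"
    then have "b (wedge l u) X = 0" if "X \<in> so_pq" for X
      using \<phi> L1 L2 L3 u(1) by (intro b_expand_zero[OF that]) (auto simp: \<phi>_def)
    then have "wedge l u \<in> h" by (simp add: h_def)
    then show False using u by simp
  qed
  then show thesis using that \<phi> unfolding \<phi>_def by blast
qed

text \<open>If \<open>E\<close> contains a nonzero \<open>y\<close> orthogonal to \<open>u\<close>,
  the boost is a multiple of the bracket of \<open>wedge l y\<close> and \<open>wedge l' y\<close>
  and hence isotropic. It is also orthogonal to the isotropic \<open>wedge l u\<close>, so the two
  are dependent modulo \<open>h\<close>, and \<open>wedge l u\<close> is not in \<open>h\<close>.
  Otherwise \<open>E\<close> is spanned by \<open>u\<close> and the algebra is three-dimensional. An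
  element of \<open>h\<close> then has no component along \<open>wedge l' u\<close>, since this
  component is detected by pairing with \<open>wedge l u\<close>.\<close>

lemma boost_translate:
  assumes u: "u \<in> E" "eta u u = 1" "\<And>x. x \<in> E \<Longrightarrow> wedge l x \<in> h \<longleftrightarrow> eta x u = 0"
  shows "(\<exists>\<tau>. boost + \<tau> *\<^sub>R wedge l u \<in> h) \<or> (CARD('n) = 2 \<and> h = {0})"
proof -
  obtain lam where lam: "lam \<noteq> 0" "\<And>v. v \<in> E \<Longrightarrow> b (wedge l u) (wedge l' v) = lam * eta v u"
    using functional[OF u] by blast
  have Nu: "wedge l u \<notin> h" using u by simp
  show ?thesis
  proof (cases "\<exists>y\<in>E. y \<noteq> 0 \<and> eta y u = 0")
    case True
    then obtain y where y: "y \<in> E" "y \<noteq> 0" "eta y u = 0" by auto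
    have Z: "br (wedge l y) (wedge l' y) = (2 * eta y y) *\<^sub>R boost"
      by (simp add: br_l_l'_g0 y wedge_bilin)
    have p: "eta y y > 0" by (rule E_pos[OF y(1,2)])
    have "b (br (wedge l y) (wedge l' y)) (1 *\<^sub>R boost + 0) = 0"
      by (subst b_br_l_l'_g0[OF u y(1,3,1)]) (simp_all add: lam y subspace_0[OF subspace_rotations])
    then have "b boost boost = 0" using p by (simp add: Z b_bilin)
    then obtain s t where st: "s \<noteq> 0 \<or> t \<noteq> 0" "s *\<^sub>R boost + t *\<^sub>R wedge l u \<in> h"
      using lorentz[of boost "wedge l u"] L1[OF u(1) u(1)] L2[OF u(1)]
      by (auto simp: b_sym[of boost "wedge l u"])
    have "s \<noteq> 0"
    proof
      assume "s = 0"
      then have "(1/t) *\<^sub>R (t *\<^sub>R wedge l u) \<in> h" using st subspace_scale[OF subspace_h] by fastforce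
      then show False using st \<open>s = 0\<close> Nu by simp
    qed
    have "(1/s) *\<^sub>R (s *\<^sub>R boost + t *\<^sub>R wedge l u) \<in> h"
      using st subspace_scale[OF subspace_h] by blast
    then have "boost + (t / s) *\<^sub>R wedge l u \<in> h"
      using \<open>s \<noteq> 0\<close> by (simp add: scaleR_add_right)
    then show ?thesis by blast
  next
    case False
    have Eu: "x = eta x u *\<^sub>R u" if "x \<in> E" for x
    proof -
      have "x - eta x u *\<^sub>R u \<in> E" "eta (x - eta x u *\<^sub>R u) u = 0"
        using u that by (simp_all add: subspace_E subspace_diff subspace_scale eta_bilin)
      with False show ?thesis by auto
    qed
    have card: "CARD('n) = 2"
    proof (rule ccontr)
      assume "CARD('n) \<noteq> 2"
      then have "card {l, l', u} \<le> CARD('n)" using n2 by (auto simp: card_insert_if)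
      then obtain z where z: "z \<notin> span {l, l', u}" using ex_outside_span[of "{l, l', u}"] by auto
      have "z = pr z - (eta z l' / 2) *\<^sub>R l - (eta z l / 2) *\<^sub>R l'"
        by (simp add: pr_def)
      then have "z = eta (pr z) u *\<^sub>R u - (eta z l' / 2) *\<^sub>R l - (eta z l / 2) *\<^sub>R l'"
        using Eu[OF pr_E[of z]] by simp
      also have "\<dots> \<in> span {l, l', u}"
        by (intro span_diff span_scale span_base) auto
      finally show False using z by simp
    qed
    have M0: "M = 0" if M: "M \<in> rotations" for M
    proof -
      have "eta (M *v u) u = 0"
        using soD[OF rotationsD(1)[OF M], of u u] by (simp add: eta_sym)
      then have Mu: "M *v u = 0" using Eu[OF rotationsD(4)[OF M, of u]] by simp
      show ?thesis
      proof (rule mat_eqI)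
        fix z
        have "M *v z = M *v (pr z - (eta z l' / 2) *\<^sub>R l - (eta z l / 2) *\<^sub>R l')"
          by (simp add: pr_def)
        also have "\<dots> = M *v pr z" by (simp add: mat_distrib rotationsD[OF M])
        also have "\<dots> = M *v (eta (pr z) u *\<^sub>R u)" using Eu[OF pr_E[of z]] by simp
        finally show "M *v z = 0 *v z" by (simp add: mat_distrib Mu)
      qed
    qed
    show ?thesis
    proof (cases "h = {0}")
      case False
      then obtain X where X: "X \<in> h" "X \<noteq> 0" using subspace_0[OF subspace_h] by auto
      obtain \<alpha> x y M where d: "x \<in> E" "y \<in> E" "M \<in> rotations"
          "X = \<alpha> *\<^sub>R boost + wedge l x + wedge l' y + M"
        using decompose[OF hD(1)[OF X(1)]] .
      have "b (wedge l u) X = lam * eta y u"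
        using d L1 L2 L3 u lam by (simp add: b_bilin)
      then have "eta y u = 0" using hD(3)[OF X(1)] lam by simp
      then have "y = 0" using Eu[OF d(2)] by simp
      define \<xi> where "\<xi> = eta x u"
      have x: "x = \<xi> *\<^sub>R u" using Eu[OF d(1)] by (simp add: \<xi>_def)
      have Xe: "X = \<alpha> *\<^sub>R boost + \<xi> *\<^sub>R wedge l u"
        unfolding d(4) M0[OF d(3)] \<open>y = 0\<close> x by (simp add: wedge_bilin)
      have "\<alpha> \<noteq> 0"
      proof
        assume "\<alpha> = 0"
        then have "\<xi> *\<^sub>R wedge l u \<in> h" "\<xi> \<noteq> 0" using X Xe by auto
        then have "(1/\<xi>) *\<^sub>R (\<xi> *\<^sub>R wedge l u) \<in> h" using subspace_scale[OF subspace_h] by blast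
        then show False using Nu \<open>\<xi> \<noteq> 0\<close> by simp
      qed
      have "(1/\<alpha>) *\<^sub>R X \<in> h" using subspace_scale[OF subspace_h X(1)] .
      then have "boost + (\<xi> / \<alpha>) *\<^sub>R wedge l u \<in> h"
        using \<open>\<alpha> \<noteq> 0\<close> by (simp add: Xe scaleR_add_right)
      then show ?thesis by blast
    qed (use card in simp)
  qed
qed

text \<open>As only opposite weights pair, \<open>wedge l' y\<close> lies in \<open>h\<close>
  whenever \<open>y\<close> is orthogonal to \<open>u\<close>. Brackets with the elements
  \<open>wedge l y\<close> add the wedges of two such vectors, and together with the boost these
  span the annihilator of \<open>u\<close>. Conversely, pairing an element of \<open>h\<close> with
  \<open>wedge l u\<close> and \<open>wedge l' u\<close> shows that its root components are
  orthogonal to \<open>u\<close>.\<close>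

lemma annihilator_if_boost:
  assumes u: "u \<in> E" "eta u u = 1" "\<And>x. x \<in> E \<Longrightarrow> wedge l x \<in> h \<longleftrightarrow> eta x u = 0"
    and a: "boost \<in> h"
  shows "h = {X \<in> so_pq. X *v u = 0}"
proof -
  obtain lam where lam: "lam \<noteq> 0" "\<And>v. v \<in> E \<Longrightarrow> b (wedge l u) (wedge l' v) = lam * eta v u"
    using functional[OF u] by blast
  note weights = boost_weights[OF a]
  have l'_h: "wedge l' y \<in> h" if y: "y \<in> E" "eta y u = 0" for y
  proof -
    have "b (wedge l' y) X = 0" if X: "X \<in> so_pq" for X
    proof (rule b_expand_zero[OF X])
      show "b (wedge l' y) boost = 0" by (rule hD(3)[OF a]) simp
      show "b (wedge l' y) (wedge l x) = 0" if "x \<in> E" for x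
        unfolding b_sym[of "wedge l' y" "wedge l x"] using br_l_g0_mod[OF u that, of "wedge l' y"] lam y by simp
      show "b (wedge l' y) (wedge l' x) = 0" if "x \<in> E" for x by (rule weights(1)[OF y(1) that])
      show "b (wedge l' y) M = 0" if "M \<in> rotations" for M
        unfolding b_sym[of "wedge l' y" M] by (rule weights(2)[OF that y(1)])
    qed
    then show ?thesis by (simp add: h_def)
  qed
  have W_h: "wedge y v \<in> h" if "y \<in> E" "eta y u = 0" "v \<in> E" "eta v u = 0" for y v
  proof -
    have "br (wedge l y) (wedge l' v) \<in> h"
      using that u(3) l'_h by (intro h_br) auto
    then have "(1/2) *\<^sub>R (br (wedge l y) (wedge l' v) - (2 * eta y v) *\<^sub>R boost) \<in> h"
      using a by (intro subspace_scale subspace_diff subspace_h)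
    then show ?thesis by (simp add: br_l_l'_g0 that)
  qed
  have rot_h: "M \<in> h" if M: "M \<in> rotations" "M *v u = 0" for M
  proof -
    have e: "eta (M *v z) u = 0" for z using soD[OF rotationsD(1)[OF M(1)], of z u] M(2)
      by (simp add: eta_bilin)
    \<comment> \<open>The part of \<open>pr (Jv c)\<close> orthogonal to \<open>u\<close>. The
      omitted parts add up to the wedge of \<open>M *v u\<close> and \<open>u\<close>, which is
      zero.\<close>
    define p where "p c = pr (Jv c) - (c \<bullet> u) *\<^sub>R u" for c
    have ep: "eta (p c) u = 0" for c
      using u by (simp add: p_def pr_def eta_bilin ED) (simp add: pq_inner_Jv Jv_inner)
    have Ep: "p c \<in> E" for c
      using u by (simp add: p_def subspace_E subspace_diff subspace_scale)
    have "(\<Sum>c\<in>Basis. wedge (M *v c) ((c \<bullet> u) *\<^sub>R u)) = wedge (M *v (\<Sum>c\<in>Basis. (u \<bullet> c) *\<^sub>R c)) u"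
      by (simp add: linear_sum[OF matrix_vector_mul_linear] linear_sum[OF linear_wedge1] wedge_bilin
          mat_distrib inner_commute)
    also have "\<dots> = 0" using M by (simp add: euclidean_representation wedge_bilin)
    finally have "(\<Sum>c\<in>Basis. wedge (M *v c) (pr (Jv c))) = (\<Sum>c\<in>Basis. wedge (M *v c) (p c))"
      by (simp add: p_def wedge_bilin(4) sum_subtractf)
    moreover have "wedge (M *v c) (p c) \<in> h" for c
      using e ep Ep rotationsD(4)[OF M(1)] by (intro W_h)
    ultimately have "(1/2) *\<^sub>R (\<Sum>c\<in>Basis. wedge (M *v c) (pr (Jv c))) \<in> h"
      by (auto intro!: subspace_scale subspace_sum subspace_h)
    then show ?thesis using rotation_expand[OF M(1)] by simp
  qed
  have au: "boost *v u = 0" by (rule boost_apply(3)[OF u(1)])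
  show ?thesis
  proof (intro equalityI subsetI CollectI conjI; (elim CollectE conjE)?)
    fix X assume X: "X \<in> h"
    show so: "X \<in> so_pq" by (rule hD(1)[OF X])
    obtain \<alpha> x y M where d: "x \<in> E" "y \<in> E" "M \<in> rotations"
        "X = \<alpha> *\<^sub>R boost + wedge l x + wedge l' y + M"
      using decompose[OF so] .
    have "b (wedge l u) X = lam * eta y u"
      using d L1 L2 L3 u lam by (simp add: b_bilin)
    then have yu: "eta y u = 0" using hD(3)[OF X] lam by simp
    have "b (wedge l' u) X = b (wedge l x) (wedge l' u)"
      using d u weights(1)[OF u(1) d(2)] weights(2)[OF d(3) u(1)] hD(3)[OF a]
      by (simp add: b_bilin b_sym[of "wedge l' u" "wedge l x"] b_sym[of "wedge l' u" M])
    then have xu: "eta x u = 0"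
      using hD(3)[OF X] lam br_l_g0_mod[OF u d(1), of "wedge l' u"] u by simp
    have "X - \<alpha> *\<^sub>R boost - wedge l x - wedge l' y \<in> h"
      using X a d xu yu u(3) l'_h by (intro subspace_diff subspace_scale subspace_h) auto
    then have Mh: "M \<in> h" by (simp add: d(4))
    \<comment> \<open>For \<open>M\<close> in \<open>h\<close> the bracket identity with this vector
      in place of \<open>y\<close>, and with \<open>v = u\<close>, gives
      \<open>eta (M *v z) u = 0\<close>. Antisymmetry of \<open>M\<close> turns this into
      \<open>eta z z = 0\<close>, and \<open>eta\<close> is definite on \<open>E\<close>.\<close>
    define z where "z = M *v u"
    have zE: "z \<in> E" using rotationsD(4)[OF d(3)] by (simp add: z_def)
    have zu: "eta z u = 0" using soD[OF rotationsD(1)[OF d(3)], of u u] by (simp add: z_def eta_sym)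
    have "lam * eta (M *v z) u = 0"
      using b_br_l_l'_g0[OF u zE zu u(1) d(3), of 0] hD(3)[OF Mh] lam u by (simp add: br_in_so)
    then have "eta z z = 0"
      using soD[OF rotationsD(1)[OF d(3)], of z u] lam by (simp add: z_def)
    then have "M *v u = 0" using E_pos[OF zE] by (force simp: z_def)
    then show "X *v u = 0"
      using xu yu u d by (simp add: mat_distrib au wedge_apply ED)
  next
    fix X :: "'n lmat" assume so: "X \<in> so_pq" and Xu: "X *v u = 0"
    obtain \<alpha> x y M where d: "x \<in> E" "y \<in> E" "M \<in> rotations"
        "X = \<alpha> *\<^sub>R boost + wedge l x + wedge l' y + M"
      using decompose[OF so] .
    have s: "eta x u *\<^sub>R l + eta y u *\<^sub>R l' + M *v u = 0"
      using Xu u d by (simp add: mat_distrib au wedge_apply ED)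
    have "eta (eta x u *\<^sub>R l + eta y u *\<^sub>R l' + M *v u) l' = - 2 * eta x u"
      "eta (eta x u *\<^sub>R l + eta y u *\<^sub>R l' + M *v u) l = - 2 * eta y u"
      using ED[OF rotationsD(4)[OF d(3)]] by (simp_all add: eta_bilin ll l'l' ll' l'l)
    then have xy: "eta x u = 0" "eta y u = 0" unfolding s by (simp_all add: eta_bilin)
    then have "M *v u = 0" using s by simp
    then show "X \<in> h"
      using xy d a u(3) l'_h rot_h unfolding d(4) by (intro subspace_add subspace_scale subspace_h) auto
  qed
qed

text \<open>The unipotent isometry that fixes \<open>l\<close>, sends \<open>u\<close> to
  \<open>u - \<tau> *\<^sub>R l\<close> and \<open>l'\<close> to \<open>m\<close> carries the boost
  to the given element of \<open>h\<close>. Changing the second null vector thus reduces to the case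
  of a boost in \<open>h\<close>. The conditions on \<open>b\<close> survive because the
  horospherical and the parabolic subalgebra depend on \<open>l\<close> alone.\<close>

lemma reframe:
  assumes u: "u \<in> E" "eta u u = 1" "\<And>x. x \<in> E \<Longrightarrow> wedge l x \<in> h \<longleftrightarrow> eta x u = 0"
    and a: "boost + \<tau> *\<^sub>R wedge l u \<in> h"
  shows "h = {X \<in> so_pq. X *v (u - \<tau> *\<^sub>R l) = 0}"
proof -
  define m where "m = l' - (2 * \<tau>) *\<^sub>R u + (\<tau> * \<tau>) *\<^sub>R l"
  interpret F: null_frame l m
    by unfold_locales
       (use pos in \<open>auto simp: m_def eta_bilin ll l'l' ll' l'l ED[OF u(1)] u(2) algebra_simps\<close>)
  have wl: "wedge l x = wedge l (pr x)" if "x \<in> F.E" for x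
    using that by (simp add: F.ED pr_def wedge_bilin)
  have Fb: "F.boost = boost + \<tau> *\<^sub>R wedge l u"
    unfolding F.boost_def boost_def by (simp add: m_def wedge_bilin algebra_simps)
  have boost_zero: "b (wedge l x) F.boost = 0" if "x \<in> E" for x
    using that L1[OF that u(1)] L2[OF that] by (simp add: Fb b_bilin)
  have rot_zero: "b (wedge l x) M = 0" if x: "x \<in> E" and M: "M \<in> F.rotations" for x M
  proof -
    obtain \<alpha> z y M0 where d: "z \<in> E" "y \<in> E" "M0 \<in> rotations"
        "M = \<alpha> *\<^sub>R boost + wedge l z + wedge l' y + M0"
      using decompose[OF F.rotationsD(1)[OF M]] .
    have "M *v l = \<alpha> *\<^sub>R l + 2 *\<^sub>R y"
      using d by (simp add: mat_distrib boost_apply wedge_apply ED ll l'l rotationsD)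
    then have "\<alpha> *\<^sub>R l + 2 *\<^sub>R y = 0" using F.rotationsD(2)[OF M] by simp
    moreover have "eta (\<alpha> *\<^sub>R l + 2 *\<^sub>R y) l' = - 2 * \<alpha>"
      using d by (simp add: eta_bilin ED ll')
    ultimately have "y = 0" by (auto simp: eta_bilin)
    then show ?thesis
      unfolding d(4) using L1[OF x d(1)] L2[OF x] L3[OF x d(3)] by (simp add: b_bilin wedge_bilin)
  qed
  interpret FF: framed_form b h l m
    by unfold_locales (use n2 L1 in \<open>auto simp: wl boost_zero rot_zero\<close>)
  define w where "w = u - \<tau> *\<^sub>R l"
  have w: "w \<in> F.E" "eta w w = 1"
    using u unfolding F.E_def by (simp_all add: w_def m_def eta_bilin ED ll l'l' ll' l'l)
  have "wedge l x \<in> h \<longleftrightarrow> eta x w = 0" if x: "x \<in> F.E" for x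
  proof -
    have "wedge l x \<in> h \<longleftrightarrow> eta (pr x) u = 0" unfolding wl[OF x] by (rule u(3)) simp
    also have "eta (pr x) u = eta x w"
      using F.ED[OF x] ED[OF u(1)] by (simp add: pr_def w_def eta_bilin)
    finally show ?thesis .
  qed
  from FF.annihilator_if_boost[OF w this] a show ?thesis by (simp add: Fb w_def)
qed

theorem h_classification:
  "(\<exists>w. eta w w > 0 \<and> h = {X \<in> so_pq. X *v w = 0}) \<or> (CARD('n) = 2 \<and> h = {0})"
proof -
  obtain u where u: "u \<in> E" "eta u u = 1" "\<And>x. x \<in> E \<Longrightarrow> wedge l x \<in> h \<longleftrightarrow> eta x u = 0"
    using horospherical_hyperplane by blast
  have "eta (u - \<tau> *\<^sub>R l) (u - \<tau> *\<^sub>R l) > 0" for \<tau>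
    using u by (simp add: eta_bilin ED ll)
  then show ?thesis using boost_translate[OF u] reframe[OF u] by blast
qed

end

section \<open>Singular vectors of automorphisms\<close>

lemma quadratic_nonneg_imp_linear_zero:
  fixes a c :: real
  assumes "\<And>t. 2 * t * a + t\<^sup>2 * c \<ge> 0" shows "a = 0"
proof (rule ccontr)
  assume "a \<noteq> 0"
  define d where "d = \<bar>c\<bar> + 1"
  have d: "d > 0" "c < 2 * d" by (auto simp: d_def)
  have "2 * (- a / d) * a + (- a / d)\<^sup>2 * c = (a\<^sup>2 / d\<^sup>2) * (c - 2 * d)"
    using d by (simp add: field_simps power2_eq_square)
  also have "\<dots> < 0" using \<open>a \<noteq> 0\<close> d by (intro mult_pos_neg) auto
  finally show False using assms[of "- a / d"] by simp
qed

text \<open>\<open>X\<close> maximizes the norm of \<open>T Y\<close> over the unit sphere of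
  \<open>S\<close>. The last conclusion is the first-order condition at the maximum:
  \<open>X\<close> is an eigenvector of T^* T, in a weak form that avoids the adjoint of a
  restricted map.\<close>

lemma singular_vector:
  fixes T :: "'a::euclidean_space \<Rightarrow> 'b::euclidean_space"
  assumes S: "subspace S" "Y0 \<in> S" "Y0 \<noteq> 0" and T: "linear T"
  obtains X \<sigma> where "X \<in> S" "norm X = 1" "\<sigma> = norm (T X)" "\<And>Y. Y \<in> S \<Longrightarrow> norm (T Y) \<le> \<sigma> * norm Y"
    "\<And>Y. Y \<in> S \<Longrightarrow> T X \<bullet> T Y = \<sigma>\<^sup>2 * (X \<bullet> Y)"
proof -
  let ?K = "sphere 0 1 \<inter> S"
  have "compact ?K" by (intro compact_Int_closed compact_sphere closed_subspace S)
  moreover have "(1 / norm Y0) *\<^sub>R Y0 \<in> ?K" using S by (auto simp: subspace_scale)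
  moreover have "continuous_on ?K (\<lambda>X. norm (T X))"
    by (intro continuous_intros linear_continuous_on linear_conv_bounded_linear[THEN iffD1] T)
  ultimately obtain X where X: "X \<in> ?K" "\<And>Y. Y \<in> ?K \<Longrightarrow> norm (T Y) \<le> norm (T X)"
    using continuous_attains_sup[of ?K "\<lambda>X. norm (T X)"] by blast
  define \<sigma> where "\<sigma> = norm (T X)"
  have le: "norm (T Y) \<le> \<sigma> * norm Y" if "Y \<in> S" for Y
  proof (cases "Y = 0")
    case False
    have "norm (T ((1 / norm Y) *\<^sub>R Y)) \<le> \<sigma>"
      unfolding \<sigma>_def using that S False by (intro X) (auto simp: subspace_scale)
    then show ?thesis using False by (simp add: linear_scale[OF T] field_simps)
  qed (simp add: linear_0[OF T])
  have "T X \<bullet> T Y = \<sigma>\<^sup>2 * (X \<bullet> Y)" if "Y \<in> S" for Y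
  proof -
    have "2 * t * (\<sigma>\<^sup>2 * (X \<bullet> Y) - T X \<bullet> T Y) + t\<^sup>2 * (\<sigma>\<^sup>2 * (norm Y)\<^sup>2 - (norm (T Y))\<^sup>2) \<ge> 0" for t
    proof -
      have "X + t *\<^sub>R Y \<in> S" using X that S by (simp add: subspace_add subspace_scale)
      then have "(norm (T (X + t *\<^sub>R Y)))\<^sup>2 \<le> (\<sigma> * norm (X + t *\<^sub>R Y))\<^sup>2"
        using le by (intro power_mono) auto
      moreover have "(norm (X + t *\<^sub>R Y))\<^sup>2 = 1 + 2 * t * (X \<bullet> Y) + t\<^sup>2 * (norm Y)\<^sup>2"
        using X by (simp add: power2_norm_eq_inner norm_eq_1 inner_add_left inner_add_right inner_commute)
           (simp add: algebra_simps power2_eq_square)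
      moreover have "(norm (T (X + t *\<^sub>R Y)))\<^sup>2 = \<sigma>\<^sup>2 + 2 * t * (T X \<bullet> T Y) + t\<^sup>2 * (norm (T Y))\<^sup>2"
        unfolding \<sigma>_def
        by (simp add: power2_norm_eq_inner linear_add[OF T] linear_scale[OF T] inner_add_left inner_add_right inner_commute)
           (simp add: algebra_simps power2_eq_square)
      ultimately show ?thesis by (simp add: power_mult_distrib algebra_simps)
    qed
    from quadratic_nonneg_imp_linear_zero[OF this] show ?thesis by simp
  qed
  then show thesis using that[of X \<sigma>] X le by (auto simp: \<sigma>_def)
qed

section \<open>Frames adapted to the Cartan involution\<close>

lemma null_frame_omega:
  assumes "\<omega> \<bullet> e0 = 0" "\<omega> \<bullet> \<omega> = 1"
  shows "null_frame (e0 + \<omega>) (e0 - \<omega>)"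
proof
  have 1: "eta e0 e0 = - 1" "eta e0 \<omega> = 0" "eta \<omega> e0 = 0" "eta \<omega> \<omega> = 1"
    using assms by (simp_all add: pq_inner_Jv Jv_def inner_diff_right inner_commute)
  show "eta (e0 + \<omega>) (e0 + \<omega>) = 0" "eta (e0 - \<omega>) (e0 - \<omega>) = 0" "eta (e0 + \<omega>) (e0 - \<omega>) = - 2"
    by (simp_all add: eta_bilin 1)
  fix x assume "eta x (e0 + \<omega>) = 0"
  then have s: "x \<bullet> \<omega> = x \<bullet> e0"
    using assms by (simp add: pq_inner_Jv Jv_def inner_diff_right inner_add_right inner_add_left)
  \<comment> \<open>Subtracting the multiple of the null vector that accounts for the time
    coordinate leaves a purely spatial vector with the same \<open>eta\<close>-square.\<close>
  define y where "y = x - (x \<bullet> e0) *\<^sub>R (e0 + \<omega>)"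
  have "eta x x = y \<bullet> y"
    using assms s by (simp add: y_def pq_inner_Jv Jv_def inner_diff_right inner_diff_left
        inner_add_right inner_add_left inner_commute algebra_simps)
  then show "eta x x > 0 \<or> (\<exists>c. x = c *\<^sub>R (e0 + \<omega>))"
    by (cases "y = 0") (auto simp: y_def)
qed

lemma add_self_scaleR: "x + x = 2 *\<^sub>R x" "- x - x = (- 2) *\<^sub>R x" for x :: "'a::real_vector"
  using scaleR_2[of x] by (simp_all add: scaleR_2)

lemma wedge_omega: "(- 1/2) *\<^sub>R wedge (e0 + \<omega>) (e0 - \<omega>) = wedge e0 \<omega>"
proof -
  have "wedge (e0 + \<omega>) (e0 - \<omega>) = - wedge e0 \<omega> - wedge e0 \<omega>"
    using wedge_swap[of \<omega> e0] by (simp only: wedge_bilin) simp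
  then show ?thesis unfolding add_self_scaleR by simp
qed

text \<open>A symmetric element anticommutes with \<open>Jv\<close>. It therefore exchanges the time
  axis and its complement and is determined by its value at \<open>e0\<close>: it generates a
  boost.\<close>

lemma symmetric_so:
  assumes S: "S \<in> so_pq" "transpose S = S"
  shows "S = wedge e0 (S *v e0)" "(S *v e0) \<bullet> e0 = 0"
proof -
  have J: "S *v z = - Jv (S *v Jv z)" for z using so_transpose_apply[OF S(1), of z] S(2) by simp
  show h: "(S *v e0) \<bullet> e0 = 0"
    using soD[OF S(1), of e0 e0] by (simp add: eta_sym) (simp add: pq_inner_Jv Jv_def inner_commute algebra_simps)
  have sp: "S *v z = (z \<bullet> (S *v e0)) *\<^sub>R e0" if "z \<bullet> e0 = 0" for z
  proof -
    have "S *v z = - Jv (S *v z)" using J[of z] that by (simp add: Jv_def)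
    then have "S *v z + S *v z = (2 * ((S *v z) \<bullet> e0)) *\<^sub>R e0"
      by (simp add: Jv_def eq_diff_eq)
    then have "(1/2) *\<^sub>R (S *v z + S *v z) = (1/2) *\<^sub>R ((2 * ((S *v z) \<bullet> e0)) *\<^sub>R e0)"
      by (rule arg_cong)
    then have "S *v z = ((S *v z) \<bullet> e0) *\<^sub>R e0" by simp
    also have "(S *v z) \<bullet> e0 = z \<bullet> (S *v e0)"
      using inner_transpose[of S z e0] S(2) by simp
    finally show ?thesis .
  qed
  show "S = wedge e0 (S *v e0)"
  proof (rule mat_eqI)
    fix z
    have "S *v z = (z \<bullet> e0) *\<^sub>R (S *v e0) + S *v (z - (z \<bullet> e0) *\<^sub>R e0)"
      by (simp add: mat_distrib)
    also have "S *v (z - (z \<bullet> e0) *\<^sub>R e0) = (z \<bullet> (S *v e0)) *\<^sub>R e0"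
      using h inner_commute[of e0 "S *v e0"] by (subst sp) (simp_all add: inner_diff_left)
    finally show "S *v z = wedge e0 (S *v e0) *v z"
      using h by (simp add: wedge_apply pq_inner_Jv Jv_def inner_diff_right inner_commute)
  qed
qed

lemma transpose_frame:
  fixes \<omega> :: "'n::finite lvec"
  assumes \<omega>: "\<omega> \<bullet> e0 = 0" "\<omega> \<bullet> \<omega> = 1"
  shows "x \<in> null_frame.E (e0 + \<omega>) (e0 - \<omega>) \<Longrightarrow> transpose (wedge (e0 + \<omega>) x) = wedge (e0 - \<omega>) x"
    "M \<in> null_frame.rotations (e0 + \<omega>) (e0 - \<omega>) \<Longrightarrow> transpose M = - M"
    "x \<in> null_frame.E (e0 + \<omega>) (e0 - \<omega>) \<Longrightarrow> x \<bullet> e0 = 0"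
proof -
  interpret null_frame "e0 + \<omega>" "e0 - \<omega>" by (rule null_frame_omega[OF \<omega>])
  have e: "x \<bullet> e0 = 0" if "x \<in> E" for x
    using that unfolding E_def by (simp add: eta_bilin) (simp add: pq_inner_Jv Jv_def inner_diff_right)
  show "x \<in> E \<Longrightarrow> x \<bullet> e0 = 0" by (rule e)
  show "transpose (wedge (e0 + \<omega>) x) = wedge (e0 - \<omega>) x" if "x \<in> E"
  proof -
    have "Jv (e0 + \<omega>) = - (e0 - \<omega>)" "Jv x = x"
      using e[OF that] \<omega> scaleR_2[of "e0 :: 'n lvec"] by (simp_all add: Jv_def inner_add_left)
    then show ?thesis
      using wedge_bilin(5)[of "-1" "e0 - \<omega>" x] by (simp add: transpose_wedge)
  qed
  show "transpose M = - M" if M: "M \<in> rotations"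
  proof (rule mat_eqI)
    fix z
    have "M *v (e0 + \<omega>) + M *v (e0 - \<omega>) = M *v e0 + M *v e0" by (simp only: mat_distrib) simp
    then have "2 *\<^sub>R (M *v e0) = 0"
      unfolding add_self_scaleR using rotationsD(2,3)[OF M] by simp
    then have "M *v e0 = 0" by simp
    then have "M *v Jv z = M *v z" by (simp add: Jv_def mat_distrib)
    moreover have "Jv (M *v z) = M *v z" using e[OF rotationsD(4)[OF M]] by (simp add: Jv_def)
    ultimately show "transpose M *v z = (- M) *v z"
      by (simp add: so_transpose_apply[OF rotationsD(1)[OF M]] mat_distrib)
  qed
qed

text \<open>The operator \<open>gram\<close> is \<open>T\<^sup>* T\<close>; it is again an automorphism because the adjoint of \<open>T\<close> is its inverse
  conjugated by the Cartan involution \<open>X \<mapsto> - transpose X\<close>.\<close>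

context so_auto
begin

definition "gram X = transpose (T' (transpose (T X)))"

lemma gram_so: "X \<in> so_pq \<Longrightarrow> gram X \<in> so_pq"
  by (simp add: gram_def so_transpose T_so T'_so)

lemma linear_gram: "linear gram"
  by (rule linearI)
     (simp_all add: gram_def linear_add[OF linear_T] linear_add[OF linear_T'] linear_scale[OF linear_T]
       linear_scale[OF linear_T'])

lemma gram_br: "X \<in> so_pq \<Longrightarrow> Y \<in> so_pq \<Longrightarrow> gram (br X Y) = br (gram X) (gram Y)"
  by (simp add: gram_def T_br transpose_br T'_br so_transpose T_so linear_neg[OF linear_T'])

text \<open>Conjugation by transposition inverts \<open>gram\<close>. So its eigenvalues come in
  pairs c, 1/c, belonging to \<open>X\<close> and \<open>transpose X\<close>.\<close>

lemma gram_transpose: "X \<in> so_pq \<Longrightarrow> gram (transpose (gram X)) = transpose X"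
  by (simp add: gram_def T_T' T'_T so_transpose T_so T'_so)

lemma gram_inner:
  assumes "CARD('n) \<ge> 2" "X \<in> so_pq" "Y \<in> so_pq"
  shows "gram X \<bullet> Y = T X \<bullet> T Y"
proof -
  have "T (T' (transpose (T X))) \<bullet> transpose (T Y) = T' (transpose (T X)) \<bullet> transpose Y"
    by (rule trace_form_invariant) (use assms in \<open>simp_all add: T_so T'_so so_transpose\<close>)
  then have "transpose (T X) \<bullet> transpose (T Y) = transpose (T' (transpose (T X))) \<bullet> transpose (transpose Y)"
    by (simp add: T_T' assms T_so so_transpose inner_transpose_transpose[of _ "transpose Y"] del: transpose_transpose)
  then show ?thesis by (simp add: inner_transpose_transpose gram_def)
qed

lemma gram_eigen_transpose:
  assumes "X \<in> so_pq" "gram X = c *\<^sub>R X" "c \<noteq> 0"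
  shows "gram (transpose X) = (1 / c) *\<^sub>R transpose X"
proof -
  have "c *\<^sub>R gram (transpose X) = transpose X"
    using gram_transpose[OF assms(1)] by (simp add: assms(2) linear_scale[OF linear_gram])
  then show ?thesis using assms(3) by (metis divide_inverse_commute mult_1 scaleR_right_imp_eq scaleR_scaleR right_inverse scaleR_one mult.right_neutral divide_inverse)
qed

end

text \<open>A nonzero \<open>X\<close> in \<open>so(1,n)\<close> that commutes with its transpose has \<open>(ad X)\<^sup>3 \<noteq> 0\<close>; so it cannot be an
  eigenvector of \<open>gram\<close> for an eigenvalue of maximal size.\<close>

lemma center_so_trivial:
  assumes "CARD('n) \<ge> 2" and X: "X \<in> (so_pq :: 'n::finite lmat set)" and "\<And>Y. Y \<in> so_pq \<Longrightarrow> br X Y = 0"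
  shows "X = 0"
proof -
  have "op_trace (\<lambda>Z. br X (br (transpose X) (so_proj Z))) = 0"
    using assms(3) by (simp add: op_trace_def br_in_so so_proj_in_so so_transpose X)
  then have "X \<bullet> X = 0"
    using killing_form[OF X so_transpose[OF X]] assms(1) by simp
  then show ?thesis by simp
qed

text \<open>\<open>br X\<close> is normal, so the norm of its cube on \<open>so_pq\<close> is the
  cube of its norm \<nu>, attained at the same unit vector. \<nu> is positive since the center is
  trivial.\<close>

lemma ad_normal_cube:
  fixes X :: "'n::finite lmat"
  assumes n: "CARD('n) \<ge> 2" and X: "X \<in> so_pq" "X \<noteq> 0" and comm: "br X (transpose X) = 0"
  obtains Y \<nu> where "Y \<in> so_pq" "norm Y = 1" "\<nu> > 0" "norm (br X (br X (br X Y))) = \<nu> ^ 3"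
    "\<And>Z. Z \<in> so_pq \<Longrightarrow> norm (br X (br X (br X Z))) \<le> \<nu> ^ 3 * norm Z"
proof -
  obtain Y \<nu> where Y: "Y \<in> so_pq" "norm Y = 1" "\<nu> = norm (br X Y)"
    "\<And>Z. Z \<in> so_pq \<Longrightarrow> norm (br X Z) \<le> \<nu> * norm Z"
    "\<And>Z. Z \<in> so_pq \<Longrightarrow> br X Y \<bullet> br X Z = \<nu>\<^sup>2 * (Y \<bullet> Z)"
    using singular_vector[OF so_subspace X linear_br] by metis
  note Xt = so_transpose[OF X(1)]
  have so: "br X Z \<in> so_pq" "br (transpose X) Z \<in> so_pq" if "Z \<in> so_pq" for Z
    using br_in_so X Xt that by auto
  have eig: "br (transpose X) (br X Y) = \<nu>\<^sup>2 *\<^sub>R Y"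
  proof -
    let ?D = "br (transpose X) (br X Y) - \<nu>\<^sup>2 *\<^sub>R Y"
    have D: "?D \<in> so_pq" by (intro so_diff so_scale so Y)
    have "?D \<bullet> ?D = 0"
      using Y(5)[OF D] inner_br[of "transpose X" "br X Y" ?D] by (simp add: inner_diff_left)
    then show ?thesis by simp
  qed
  have commute: "br (transpose X) (br X Z) = br X (br (transpose X) Z)" for Z
    using br_jacobi[of X "transpose X" Z] by (simp add: comm br_bilin)
  have norm_eq: "norm (br X Z) = norm (br (transpose X) Z)" for Z
  proof -
    have "br X Z \<bullet> br X Z = br (transpose X) Z \<bullet> br (transpose X) Z"
      using inner_br[of X Z "br X Z"] inner_br[of "transpose X" Z "br (transpose X) Z"] commute[of Z] by simp
    then show ?thesis by (simp add: norm_eq_sqrt_inner)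
  qed
  have n2: "norm (br X (br X Y)) = \<nu>\<^sup>2"
    using norm_eq[of "br X Y"] eig Y(2) by simp
  have "norm (br X (br X (br X Y))) = norm (br X (br (transpose X) (br X Y)))"
    using norm_eq[of "br X (br X Y)"] commute[of "br X Y"] by simp
  also have "\<dots> = \<nu> ^ 3" using Y(3) by (simp add: eig br_bilin power2_eq_square power3_eq_cube)
  finally have n3: "norm (br X (br X (br X Y))) = \<nu> ^ 3" .
  have nu0: "\<nu> \<ge> 0" using Y(3) by simp
  have "\<nu> \<noteq> 0"
  proof
    assume "\<nu> = 0"
    then have "br X Z = 0" if "Z \<in> so_pq" for Z using Y(4)[OF that] by simp
    then show False using center_so_trivial[OF n X(1)] X(2) by blast
  qed
  moreover have "norm (br X (br X (br X Z))) \<le> \<nu> ^ 3 * norm Z" if Z: "Z \<in> so_pq" for Z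
  proof -
    have "norm (br X (br X (br X Z))) \<le> \<nu> * (\<nu> * (\<nu> * norm Z))"
      using nu0 Y(4) so(1) Z by (meson mult_left_mono order_trans)
    then show ?thesis by (simp add: power3_eq_cube mult.assoc)
  qed
  ultimately show thesis using that[OF Y(1,2) _ n3] nu0 by simp
qed

section \<open>The largest singular value and the contracted frame\<close>

context so_auto
begin

text \<open>\<open>br X\<close> raises eigenvalues of \<open>gram\<close> by the factor
  \<open>\<sigma>\<^sup>2\<close>, and all of them lie between \<open>1 / \<sigma>\<^sup>2\<close>
  and \<open>\<sigma>\<^sup>2\<close>. Two applications may lead from the smallest to the largest, a
  third must give zero; this excludes a normal \<open>br X\<close>.\<close>

lemma max_eigenvector_not_normal:
  assumes n: "CARD('n) \<ge> 2" and X: "X \<in> so_pq" "X \<noteq> 0" "gram X = \<sigma>\<^sup>2 *\<^sub>R X" and \<sigma>: "\<sigma> > 1"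
    and max: "\<And>Y. Y \<in> so_pq \<Longrightarrow> norm (T Y) \<le> \<sigma> * norm Y"
  shows "br X (transpose X) \<noteq> 0"
proof
  assume "br X (transpose X) = 0"
  then obtain Y \<nu> where Y: "Y \<in> so_pq" "norm Y = 1" "\<nu> > 0" "norm (br X (br X (br X Y))) = \<nu> ^ 3"
    "\<And>Z. Z \<in> so_pq \<Longrightarrow> norm (br X (br X (br X Z))) \<le> \<nu> ^ 3 * norm Z"
    using ad_normal_cube[OF n X(1,2)] by metis
  have gram_le: "norm (gram Z) \<le> \<sigma>\<^sup>2 * norm Z" if Z: "Z \<in> so_pq" for Z
  proof -
    have "norm (gram Z) * norm (gram Z) = T Z \<bullet> T (gram Z)"
      using gram_inner[OF n Z gram_so[OF Z]]
      by (simp add: power2_norm_eq_inner flip: power2_eq_square)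
    also have "\<dots> \<le> (\<sigma> * norm Z) * (\<sigma> * norm (gram Z))"
      using max[OF Z] max[OF gram_so[OF Z]] \<sigma>
      by (intro order_trans[OF norm_cauchy_schwarz] mult_mono) auto
    finally show ?thesis using \<sigma> by (cases "gram Z = 0") (auto simp: power2_eq_square algebra_simps)
  qed
  \<comment> \<open>The preimage of \<open>Y\<close> under \<open>gram\<close>. Its norm is at most
    \<open>\<sigma>\<^sup>2\<close> because the inverse of \<open>gram\<close> is its conjugate by
    transposition.\<close>
  define W where "W = transpose (gram (transpose Y))"
  have W: "W \<in> so_pq" by (simp add: W_def so_transpose gram_so Y)
  have gW: "gram W = Y"
    using gram_transpose[OF so_transpose[OF Y(1)]] by (simp add: W_def)
  have nW: "norm W \<le> \<sigma>\<^sup>2"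
  proof -
    have tn: "norm (transpose A) = norm A" for A :: "'n lmat"
      by (simp add: norm_eq_sqrt_inner inner_transpose_transpose)
    show ?thesis using gram_le[OF so_transpose[OF Y(1)]] Y(2) by (simp add: W_def tn)
  qed
  have step: "gram (br X Z) = \<sigma>\<^sup>2 *\<^sub>R br X (gram Z)" if "Z \<in> so_pq" for Z
    using gram_br[OF X(1) that] X(3) by (simp add: br_bilin)
  have "gram (br X (br X (br X W))) = \<sigma> ^ 6 *\<^sub>R br X (br X (br X Y))"
    using W X(1) by (simp add: step br_in_so br_bilin gW)
  then have "\<sigma> ^ 6 * \<nu> ^ 3 = norm (gram (br X (br X (br X W))))"
    using Y(4) \<sigma> by simp
  also have "\<dots> \<le> \<sigma>\<^sup>2 * (\<nu> ^ 3 * norm W)"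
    using W X(1) Y(3) by (intro order_trans[OF gram_le] mult_left_mono Y(5)) (simp_all add: br_in_so)
  also have "\<dots> \<le> \<sigma>\<^sup>2 * (\<nu> ^ 3 * \<sigma>\<^sup>2)"
    using nW Y(3) by (intro mult_left_mono) auto
  finally have "\<sigma> ^ 4 * (\<sigma>\<^sup>2 * \<nu> ^ 3) \<le> \<sigma> ^ 4 * \<nu> ^ 3" by (simp add: power_numeral_reduce algebra_simps)
  then have "\<sigma>\<^sup>2 \<le> 1" using \<sigma> Y(3) by (simp add: mult_le_cancel_left mult_le_cancel_right)
  then show False using \<sigma> by (simp add: power2_eq_square) (meson less_le_not_le mult_less_cancel_left1 not_less order.trans zero_less_one less_1_mult)
qed

end

text \<open>What is kept of the Cartan decomposition. Root space, boost and rotations are treated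
  separately because each is approximated in its own way when the frame varies.\<close>

definition contracts_frame :: "('n::finite lmat \<Rightarrow> 'n lmat) \<Rightarrow> real \<Rightarrow> 'n lvec \<Rightarrow> bool" where
  "contracts_frame T K \<omega> \<longleftrightarrow>
     (\<forall>x\<in>null_frame.E (e0 + \<omega>) (e0 - \<omega>).
        K * norm (T (wedge (e0 + \<omega>) x)) \<le> norm (wedge (e0 + \<omega>) x)) \<and>
     norm (T (wedge e0 \<omega>)) \<le> norm (wedge e0 \<omega>) \<and>
     (\<forall>M\<in>null_frame.rotations (e0 + \<omega>) (e0 - \<omega>). norm (T M) \<le> norm M)"

context so_auto
begin

lemma self_neg_zero: "x = - x \<Longrightarrow> x = 0" for x :: "'z::real_vector"
  using scaleR_2[of x] by (metis add.right_inverse scaleR_eq_0_iff zero_neq_numeral)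

lemma gram_fix_norm:
  assumes n: "CARD('n) \<ge> 2" "X \<in> so_pq" "gram X = X" shows "norm (T X) = norm X"
  using gram_inner[OF n(1,2,2)] n(3) by (simp add: norm_eq_sqrt_inner)

text \<open>\<open>gram\<close> commutes with the bracket by the boost and so preserves its
  centralizer; being symmetric, it also preserves the orthogonal complement of the boost in it, the
  rotations. There transposition is -1, so \<open>gram\<close> is an involution. It is also
  positive: a vector \<open>Z\<close> with \<open>gram Z = - Z\<close> would satisfy
  \<open>T Z \<bullet> T Z = - (Z \<bullet> Z)\<close>.\<close>

lemma gram_rotation:
  assumes n: "CARD('n) \<ge> 2" and \<omega>: "\<omega> \<bullet> e0 = 0" "\<omega> \<bullet> \<omega> = 1"
    and boost: "gram (wedge e0 \<omega>) = wedge e0 \<omega>"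
    and M: "M \<in> null_frame.rotations (e0 + \<omega>) (e0 - \<omega>)"
  shows "gram M = M"
proof -
  interpret F: null_frame "e0 + \<omega>" "e0 - \<omega>" by (rule null_frame_omega[OF \<omega>])
  have bF: "F.boost = wedge e0 \<omega>" unfolding F.boost_def by (rule wedge_omega)
  note Mso = F.rotationsD(1)[OF M]
  note tr = transpose_frame[OF \<omega>]
  have ortho: "M \<bullet> F.boost = 0" if "M \<in> F.rotations" for M
  proof -
    have "M \<bullet> F.boost = transpose M \<bullet> transpose F.boost" by (simp add: inner_transpose_transpose)
    also have "transpose F.boost = F.boost"
      using \<omega> wedge_bilin(5)[of "-1" e0 \<omega>] by (simp add: bF transpose_wedge Jv_def) (simp flip: add_self_scaleR)
    finally show ?thesis using tr(2)[OF that] by simp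
  qed
  have boost0: "F.boost \<noteq> 0"
  proof
    assume "F.boost = 0"
    then have "e0 + \<omega> = 0" using F.boost_apply(1) by simp
    then have "(e0 + \<omega>) \<bullet> e0 = 0" by simp
    then show False using \<omega> by (simp add: inner_add_left)
  qed
  have "br F.boost (gram M) = gram (br F.boost M)"
    using gram_br[OF F.boost_so Mso] boost bF by simp
  then have comm: "br F.boost (gram M) = 0" by (simp add: F.br_boost_rot[OF M] linear_0[OF linear_gram])
  obtain \<alpha> x y M' where d: "x \<in> F.E" "y \<in> F.E" "M' \<in> F.rotations"
    "gram M = \<alpha> *\<^sub>R F.boost + wedge (e0 + \<omega>) x + wedge (e0 - \<omega>) y + M'"
    using F.decompose[OF gram_so[OF Mso]] .
  have "wedge (e0 + \<omega>) x = wedge (e0 - \<omega>) y"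
    using comm unfolding d(4) by (simp add: br_bilin F.br_boost_l F.br_boost_l' F.br_boost_rot d)
  moreover from this have "wedge (e0 + \<omega>) x = - wedge (e0 - \<omega>) y"
    using F.br_boost_l[OF d(1)] F.br_boost_l'[OF d(2)] by simp
  ultimately have "wedge (e0 + \<omega>) x = 0" "wedge (e0 - \<omega>) y = 0"
    using self_neg_zero[of "wedge (e0 - \<omega>) y"] by simp_all
  then have g: "gram M = \<alpha> *\<^sub>R F.boost + M'" using d(4) by simp
  have "gram M \<bullet> F.boost = M \<bullet> gram F.boost"
    using gram_inner[OF n Mso F.boost_so] gram_inner[OF n F.boost_so Mso] by (simp add: inner_commute)
  then have "\<alpha> * (F.boost \<bullet> F.boost) = 0"
    using boost bF ortho[OF M] ortho[OF d(3)] by (simp add: g inner_add_left)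
  then have g': "gram M = M'" using g boost0 by simp
  have gg: "gram (gram M) = M"
    using gram_transpose[OF Mso] tr(2)[OF M] tr(2)[OF d(3)] by (simp add: g' linear_neg[OF linear_gram])
  define Z where "Z = gram M - M"
  have Zso: "Z \<in> so_pq" by (simp add: Z_def so_diff gram_so Mso)
  have "gram Z = - Z" by (simp add: Z_def linear_diff[OF linear_gram] gg)
  then have "- (Z \<bullet> Z) = T Z \<bullet> T Z" using gram_inner[OF n Zso Zso] by simp
  then have "Z \<bullet> Z = 0" by (metis inner_ge_zero neg_0_le_iff_le order_antisym)
  then show ?thesis by (simp add: Z_def)
qed

text \<open>The eigenvalue spreads from one vector over its root space: \<open>gram\<close> commutes
  with the bracket by the rotation \<open>wedge z y\<close>, which sends \<open>y\<close> to a
  nonzero multiple of \<open>z\<close> modulo \<open>y\<close>. Transposition leads to the opposite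
  root space with the inverse eigenvalue, so \<open>T\<close> shrinks the latter exactly by
  \<sigma>.\<close>

lemma contracts_frameI:
  assumes n: "CARD('n) \<ge> 2" and \<omega>: "\<omega> \<bullet> e0 = 0" "\<omega> \<bullet> \<omega> = 1"
    and boost: "gram (wedge e0 \<omega>) = wedge e0 \<omega>" and \<sigma>: "\<sigma> > 0"
    and y: "y \<in> null_frame.E (e0 + \<omega>) (e0 - \<omega>)" "y \<noteq> 0"
      "gram (wedge (e0 - \<omega>) y) = \<sigma>\<^sup>2 *\<^sub>R wedge (e0 - \<omega>) y"
  shows "contracts_frame T \<sigma> \<omega>"
proof -
  interpret F: null_frame "e0 + \<omega>" "e0 - \<omega>" by (rule null_frame_omega[OF \<omega>])
  note tr = transpose_frame[OF \<omega>]
  have rot: "gram M = M" if "M \<in> F.rotations" for M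
    by (rule gram_rotation[OF n \<omega> boost that])
  have eig: "gram (wedge (e0 - \<omega>) z) = \<sigma>\<^sup>2 *\<^sub>R wedge (e0 - \<omega>) z" if z: "z \<in> F.E" for z
  proof -
    define M where "M = wedge z y"
    have M: "M \<in> F.rotations" by (simp add: M_def F.wedge_E z y)
    have p: "eta y y > 0" by (rule F.E_pos[OF y(1,2)])
    have My: "M *v y = eta y y *\<^sub>R z - eta z y *\<^sub>R y" by (simp add: M_def wedge_apply)
    have "gram (br M (wedge (e0 - \<omega>) y)) = br M (\<sigma>\<^sup>2 *\<^sub>R wedge (e0 - \<omega>) y)"
      using gram_br[OF F.rotationsD(1)[OF M] wedge_in_so] rot[OF M] y(3) by simp
    then have "gram (wedge (e0 - \<omega>) (M *v y)) = \<sigma>\<^sup>2 *\<^sub>R wedge (e0 - \<omega>) (M *v y)"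
      by (simp add: br_bilin F.br_rot(2)[OF M])
    then have "eta y y *\<^sub>R gram (wedge (e0 - \<omega>) z) = eta y y *\<^sub>R (\<sigma>\<^sup>2 *\<^sub>R wedge (e0 - \<omega>) z)"
      by (simp add: My linear_diff[OF linear_wedge2] linear_scale[OF linear_wedge2] linear_diff[OF linear_gram] linear_scale[OF linear_gram] y(3)
          scaleR_diff_right mult.commute)
    then show ?thesis using p unfolding scaleR_cancel_left by simp
  qed
  have "\<sigma> * norm (T (wedge (e0 + \<omega>) x)) = norm (wedge (e0 + \<omega>) x)" if x: "x \<in> F.E" for x
  proof -
    have "transpose (wedge (e0 - \<omega>) x) = wedge (e0 + \<omega>) x"
      using tr(1)[OF x] by (metis transpose_transpose)
    then have "gram (wedge (e0 + \<omega>) x) = (1 / \<sigma>\<^sup>2) *\<^sub>R wedge (e0 + \<omega>) x"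
      using gram_eigen_transpose[OF wedge_in_so eig[OF x]] \<sigma> by simp
    then have "\<sigma>\<^sup>2 * (norm (T (wedge (e0 + \<omega>) x)))\<^sup>2 = (norm (wedge (e0 + \<omega>) x))\<^sup>2"
      using gram_inner[OF n wedge_in_so wedge_in_so, of "e0 + \<omega>" x "e0 + \<omega>" x] \<sigma>
      by (simp add: power2_norm_eq_inner field_simps)
    then have "(\<sigma> * norm (T (wedge (e0 + \<omega>) x)))\<^sup>2 = (norm (wedge (e0 + \<omega>) x))\<^sup>2"
      by (simp add: power_mult_distrib)
    then show ?thesis using \<sigma> by (simp add: power2_eq_iff_nonneg)
  qed
  then show ?thesis
    unfolding contracts_frame_def using rot gram_fix_norm[OF n] boost F.rotationsD(1) by auto
qed

lemma contracts_frame_mono: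
  "contracts_frame T \<sigma> \<omega> \<Longrightarrow> K \<le> \<sigma> \<Longrightarrow> contracts_frame T K \<omega>"
  unfolding contracts_frame_def
  by (meson mult_right_mono norm_ge_zero order_trans)

text \<open>For a top eigenvector \<open>X\<close>, the bracket \<open>S\<close> with its transpose
  is symmetric, nonzero and fixed by \<open>gram\<close>; hence it is a multiple of a boost. The
  components of \<open>X\<close> of different weights under this boost are again eigenvectors or
  zero. That of weight 0 vanishes because \<open>gram\<close> is the identity there and \<sigma> >
  1. A nonzero root component gives the frame.\<close>

lemma exists_contracted_frame:
  assumes n: "CARD('n) \<ge> 2" and K: "K \<ge> 1" and Y0: "Y0 \<in> so_pq" "norm (T Y0) > K * norm Y0"
  shows "\<exists>\<omega>. \<omega> \<bullet> e0 = 0 \<and> \<omega> \<bullet> \<omega> = 1 \<and> contracts_frame T K \<omega>"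
proof -
  have "Y0 \<noteq> 0" using Y0 by (auto simp: linear_0[OF linear_T])
  then obtain X \<sigma> where X: "X \<in> so_pq" "norm X = 1" "\<sigma> = norm (T X)"
    and max: "\<And>Y. Y \<in> so_pq \<Longrightarrow> norm (T Y) \<le> \<sigma> * norm Y"
    and crit: "\<And>Y. Y \<in> so_pq \<Longrightarrow> T X \<bullet> T Y = \<sigma>\<^sup>2 * (X \<bullet> Y)"
    using singular_vector[OF so_subspace Y0(1) _ linear_T] by metis
  have "K * norm Y0 < \<sigma> * norm Y0" using max[OF Y0(1)] Y0(2) by linarith
  then have \<sigma>: "\<sigma> > K" using \<open>Y0 \<noteq> 0\<close> by simp
  have eig: "gram X = \<sigma>\<^sup>2 *\<^sub>R X"
  proof -
    define D where "D = gram X - \<sigma>\<^sup>2 *\<^sub>R X"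
    have D: "D \<in> so_pq" by (simp add: D_def so_diff so_scale gram_so X)
    have "D \<bullet> D = gram X \<bullet> D - \<sigma>\<^sup>2 * (X \<bullet> D)"
      by (subst D_def) (simp add: inner_diff_left)
    also have "\<dots> = 0" using crit[OF D] gram_inner[OF n X(1) D] by simp
    finally show ?thesis by (simp add: D_def)
  qed
  have X0: "X \<noteq> 0" using X(2) by auto
  define S where "S = br X (transpose X)"
  have S0: "S \<noteq> 0"
    unfolding S_def using max_eigenvector_not_normal[OF n X(1) X0 eig _ max] \<sigma> K by simp
  have Sso: "S \<in> so_pq" by (simp add: S_def br_in_so so_transpose X)
  have tS: "transpose S = S"
    using br_swap[of "transpose X" X] by (simp add: S_def transpose_br)
  have gS: "gram S = S"
    using gram_br[OF X(1) so_transpose[OF X(1)]] gram_eigen_transpose[OF X(1) eig] \<sigma> K eig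
    by (simp add: S_def br_bilin)
  define k where "k = S *v e0"
  have k: "S = wedge e0 k" "k \<bullet> e0 = 0"
    using symmetric_so[OF Sso tS] by (simp_all add: k_def)
  have k0: "k \<noteq> 0" using S0 k by (auto simp: wedge_bilin)
  define \<omega> where "\<omega> = (1 / norm k) *\<^sub>R k"
  have \<omega>: "\<omega> \<bullet> e0 = 0" "\<omega> \<bullet> \<omega> = 1"
    using k k0 by (simp_all add: \<omega>_def dot_square_norm power2_eq_square)
  have boost: "gram (wedge e0 \<omega>) = wedge e0 \<omega>"
    using gS by (simp add: \<omega>_def wedge_bilin linear_scale[OF linear_gram] k(1))
  interpret F: null_frame "e0 + \<omega>" "e0 - \<omega>" by (rule null_frame_omega[OF \<omega>])
  have bF: "F.boost = wedge e0 \<omega>" unfolding F.boost_def by (rule wedge_omega)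
  obtain \<alpha> x y M where d: "x \<in> F.E" "y \<in> F.E" "M \<in> F.rotations"
    "X = \<alpha> *\<^sub>R F.boost + wedge (e0 + \<omega>) x + wedge (e0 - \<omega>) y + M"
    using F.decompose[OF X(1)] .
  define D1 where "D1 = gram (wedge (e0 + \<omega>) x) - \<sigma>\<^sup>2 *\<^sub>R wedge (e0 + \<omega>) x"
  define D2 where "D2 = gram (wedge (e0 - \<omega>) y) - \<sigma>\<^sup>2 *\<^sub>R wedge (e0 - \<omega>) y"
  define D0 where "D0 = (\<alpha> *\<^sub>R F.boost + M) - \<sigma>\<^sup>2 *\<^sub>R (\<alpha> *\<^sub>R F.boost + M)"
  have gM: "gram M = M" by (rule gram_rotation[OF n \<omega> boost d(3)])
  have sum: "D1 + D2 + D0 = 0"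
    using eig boost unfolding d(4)
    by (simp add: D1_def D2_def D0_def linear_add[OF linear_gram] linear_scale[OF linear_gram] gM bF algebra_simps)
  have comm: "br F.boost (gram Z) = gram (br F.boost Z)" if "Z \<in> so_pq" for Z
    using gram_br[OF F.boost_so that] boost bF by simp
  \<comment> \<open>The defects have weights 1, -1 and 0 because \<open>gram\<close> commutes with
    the boost. As they add up to zero, each of them is zero.\<close>
  have b: "br F.boost D1 = D1" "br F.boost D2 = - D2" "br F.boost D0 = 0"
    by (simp_all add: D1_def D2_def D0_def br_bilin comm F.br_boost_l F.br_boost_l' F.br_boost_rot d
        linear_neg[OF linear_gram])
  have "D1 - D2 = 0" using arg_cong[OF sum, of "br F.boost"] by (simp add: br_bilin b)
  moreover have "D1 + D2 = 0" using arg_cong[OF \<open>D1 - D2 = 0\<close>, of "br F.boost"] by (simp add: br_bilin b)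
  ultimately have D2: "D2 = 0" and D1: "D1 = D2"
    using self_neg_zero[of D2] by (simp_all add: eq_neg_iff_add_eq_0)
  with sum have D: "D1 = 0" "D2 = 0" "D0 = 0" by simp_all
  have "(1 - \<sigma>\<^sup>2) *\<^sub>R (\<alpha> *\<^sub>R F.boost + M) = 0" using D(3)
    unfolding D0_def scaleR_left_diff_distrib by simp
  moreover have "1 - \<sigma>\<^sup>2 \<noteq> 0" using \<sigma> K by (smt (verit) one_less_power pos2)
  ultimately have X': "X = wedge (e0 + \<omega>) x + wedge (e0 - \<omega>) y"
    using d(4) by (metis (no_types, lifting) add.assoc add.commute add.right_neutral scaleR_eq_0_iff)
  have spos: "\<sigma> > 0" using \<sigma> K by simp
  show ?thesis
  proof (cases "y = 0")
    case False
    have "contracts_frame T \<sigma> \<omega>"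
      using D(2) by (intro contracts_frameI[OF n \<omega> boost spos d(2) False]) (simp add: D2_def)
    then show ?thesis using contracts_frame_mono \<sigma> \<omega> by (meson less_imp_le)
  next
    case True
    then have x0: "x \<noteq> 0" using X' X0 by (auto simp: wedge_bilin)
    \<comment> \<open>Reversing \<omega> exchanges the two null vectors, so that \<open>x\<close>
      now labels an element of the expanded root space.\<close>
    have \<omega>': "(- \<omega>) \<bullet> e0 = 0" "(- \<omega>) \<bullet> (- \<omega>) = 1" using \<omega> by simp_all
    interpret G: null_frame "e0 + - \<omega>" "e0 - - \<omega>" by (rule null_frame_omega[OF \<omega>'])
    have "wedge e0 (- \<omega>) = - wedge e0 \<omega>" using wedge_bilin(6)[of e0 "-1" \<omega>] by simp
    then have "gram (wedge e0 (- \<omega>)) = wedge e0 (- \<omega>)" by (simp add: linear_neg[OF linear_gram] boost)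
    moreover have "x \<in> G.E" using d(1) unfolding F.E_def G.E_def by simp
    ultimately have "contracts_frame T \<sigma> (- \<omega>)"
      using D(1) by (intro contracts_frameI[OF n \<omega>' _ spos _ x0]) (simp_all add: D1_def)
    then show ?thesis using contracts_frame_mono \<sigma> \<omega>' by (meson less_imp_le)
  qed
qed

end

lemma frame_E_iff:
  assumes "\<omega> \<bullet> e0 = 0" "\<omega> \<bullet> \<omega> = 1"
  shows "x \<in> null_frame.E (e0 + \<omega>) (e0 - \<omega>) \<longleftrightarrow> x \<bullet> e0 = 0 \<and> x \<bullet> \<omega> = 0"
proof -
  interpret null_frame "e0 + \<omega>" "e0 - \<omega>" by (rule null_frame_omega[OF assms])
  have "eta x (e0 + \<omega>) = x \<bullet> \<omega> - x \<bullet> e0" "eta x (e0 - \<omega>) = - (x \<bullet> \<omega>) - x \<bullet> e0"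
    using assms by (simp_all add: pq_inner_Jv Jv_def inner_diff_right inner_add_right inner_add_left inner_diff_left)
  then show ?thesis unfolding E_def by auto
qed

lemma limit_zero:
  fixes f g :: "nat \<Rightarrow> real"
  assumes "f \<longlonglongrightarrow> a" "g \<longlonglongrightarrow> c" "\<And>k. real (k + 1) * \<bar>f k\<bar> \<le> g k" shows "a = 0"
proof -
  have le: "\<bar>f k\<bar> \<le> g k * inverse (real (Suc k))" for k
    using assms(3)[of k] by (simp add: field_simps)
  have "(\<lambda>k. g k * inverse (real (Suc k))) \<longlonglongrightarrow> c * 0"
    by (intro tendsto_mult assms LIMSEQ_inverse_real_of_nat)
  then have "(\<lambda>k. g k * inverse (real (Suc k))) \<longlonglongrightarrow> 0" by simp
  then have "f \<longlonglongrightarrow> 0"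
    by (rule Lim_null_comparison[rotated]) (use le in simp)
  then show ?thesis using assms(1) LIMSEQ_unique by blast
qed

section \<open>Limits of contracted frames\<close>

context lorentz_form
begin

text \<open>The shape in which noncompactness of the closure of Ad H reaches the algebra:
  automorphisms of arbitrarily large norm that preserve the form.\<close>

definition unbounded_symmetries :: bool where
  "unbounded_symmetries \<longleftrightarrow> (\<forall>K. \<exists>T T'. so_auto T T' \<and>
     (\<forall>X\<in>so_pq. \<forall>Y\<in>so_pq. b (T X) (T Y) = b X Y) \<and> (\<exists>Y\<in>so_pq. norm (T Y) > K * norm Y))"

text \<open>A subsequence of the directions \<omega> converges by compactness of the sphere.
  Elements of the limiting subalgebras are approximated in the \<open>k\<close>-th frame, where
  invariance bounds the product by a constant over \<open>k + 1\<close>: one argument is contracted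
  and the other one is not expanded.\<close>

lemma exists_framed_form:
  assumes n: "CARD('n) \<ge> 2" and unb: unbounded_symmetries
  shows "\<exists>l l'. framed_form b h l l'"
proof -
  have "\<exists>\<omega>. \<exists>T. \<omega> \<bullet> e0 = 0 \<and> \<omega> \<bullet> \<omega> = 1 \<and> contracts_frame T (real (k + 1)) \<omega> \<and>
      (\<forall>X\<in>so_pq. \<forall>Y\<in>so_pq. b (T X) (T Y) = b X Y)" for k
  proof -
    obtain T T' Y where T: "so_auto T T'" "\<forall>X\<in>so_pq. \<forall>Y\<in>so_pq. b (T X) (T Y) = b X Y"
      "Y \<in> so_pq" "norm (T Y) > real (k + 1) * norm Y"
      using unb unfolding unbounded_symmetries_def by blast
    then show ?thesis using so_auto.exists_contracted_frame[OF T(1) n _ T(3,4)] by auto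
  qed
  then obtain \<omega> T where \<omega>: "\<And>k. \<omega> k \<bullet> e0 = 0" "\<And>k. \<omega> k \<bullet> \<omega> k = 1"
    and T: "\<And>k. contracts_frame (T k) (real (k + 1)) (\<omega> k)"
    and inv: "\<And>k X Y. X \<in> so_pq \<Longrightarrow> Y \<in> so_pq \<Longrightarrow> b (T k X) (T k Y) = b X Y"
    by metis
  have "\<forall>k. \<omega> k \<in> sphere 0 1" using \<omega>(2) by (simp add: norm_eq_1)
  then obtain w r where r: "strict_mono (r :: nat \<Rightarrow> nat)" and lim: "(\<omega> \<circ> r) \<longlonglongrightarrow> w"
    using compact_sphere[of "0 :: 'n lvec" 1] unfolding compact_def by meson
  define v where "v k = \<omega> (r k)" for k
  have "v = \<omega> \<circ> r" by (auto simp: v_def)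
  then have v: "v \<longlonglongrightarrow> w" using lim by simp
  have vk: "v k \<bullet> e0 = 0" "v k \<bullet> v k = 1" for k by (simp_all add: v_def \<omega>)
  have "(\<lambda>k. v k \<bullet> e0) \<longlonglongrightarrow> w \<bullet> e0" "(\<lambda>k. v k \<bullet> v k) \<longlonglongrightarrow> w \<bullet> w"
    by (intro tendsto_inner tendsto_const v)+
  then have w: "w \<bullet> e0 = 0" "w \<bullet> w = 1" by (simp_all add: vk LIMSEQ_const_iff)
  interpret F: null_frame "e0 + w" "e0 - w" by (rule null_frame_omega[OF w])
  \<comment> \<open>Projection along \<open>v k\<close> takes the space \<open>E\<close> of the
    limit frame into that of the \<open>k\<close>-th frame and tends to the identity on it.\<close>
  define p where "p k x = x - (x \<bullet> v k) *\<^sub>R v k" for k x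
  have pE: "p k x \<in> null_frame.E (e0 + v k) (e0 - v k)" if "x \<in> F.E" for k x
    using that vk unfolding frame_E_iff[OF vk] frame_E_iff[OF w]
    by (simp add: p_def inner_diff_left)
  have plim: "(\<lambda>k. p k x) \<longlonglongrightarrow> x" if "x \<in> F.E" for x
  proof -
    have "(\<lambda>k. p k x) \<longlonglongrightarrow> x - (x \<bullet> w) *\<^sub>R w"
      unfolding p_def by (intro tendsto_intros v)
    then show ?thesis using that unfolding frame_E_iff[OF w] by simp
  qed
  note wlim = bounded_bilinear.tendsto[OF bounded_bilinear_wedge]
  have bb: "bounded_bilinear b" using bilin by (simp add: bilinear_conv_bounded_bilinear)
  then obtain B where B: "\<And>X Y. \<bar>b X Y\<bar> \<le> norm X * norm Y * B" and B0: "B > 0"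
    using bounded_bilinear.pos_bounded[OF bb] by auto
  define N where "N k x = wedge (e0 + v k) (p k x)" for k x
  have Nlim: "(\<lambda>k. N k x) \<longlonglongrightarrow> wedge (e0 + w) x" if "x \<in> F.E" for x
    unfolding N_def by (intro wlim plim that tendsto_intros v)
  have contr: "real (k + 1) * norm (T (r k) (N k x)) \<le> norm (N k x)" if "x \<in> F.E" for k x
  proof -
    have "real (r k + 1) * norm (T (r k) (N k x)) \<le> norm (N k x)"
      using T[of "r k"] pE[OF that, of k] unfolding contracts_frame_def N_def v_def by blast
    moreover have "real (k + 1) * norm (T (r k) (N k x)) \<le> real (r k + 1) * norm (T (r k) (N k x))"
      using seq_suble[OF r, of k] by (intro mult_right_mono) auto
    ultimately show ?thesis by linarith
  qed
  have zero: "b (wedge (e0 + w) x) Z = 0"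
    if x: "x \<in> F.E" and Z: "\<And>k. Zs k \<in> so_pq" "Zs \<longlonglongrightarrow> Z" "\<And>k. norm (T (r k) (Zs k)) \<le> norm (Zs k)"
    for x Z Zs
  proof (rule limit_zero)
    show "(\<lambda>k. b (N k x) (Zs k)) \<longlonglongrightarrow> b (wedge (e0 + w) x) Z"
      by (intro bounded_bilinear.tendsto[OF bb] Nlim x Z)
    show "(\<lambda>k. norm (N k x) * norm (Zs k) * B) \<longlonglongrightarrow> norm (wedge (e0 + w) x) * norm Z * B"
      by (intro tendsto_intros Nlim x Z)
    fix k
    have "\<bar>b (N k x) (Zs k)\<bar> = \<bar>b (T (r k) (N k x)) (T (r k) (Zs k))\<bar>"
      using inv[of "N k x" "Zs k"] Z by (simp add: N_def)
    also have "\<dots> \<le> norm (T (r k) (N k x)) * norm (T (r k) (Zs k)) * B" by (rule B)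
    also have "\<dots> \<le> norm (T (r k) (N k x)) * norm (Zs k) * B"
      using B0 Z(3) by (intro mult_right_mono mult_left_mono) auto
    finally have "real (k + 1) * \<bar>b (N k x) (Zs k)\<bar> \<le> real (k + 1) * norm (T (r k) (N k x)) * (norm (Zs k) * B)"
      by (simp add: mult_left_mono mult.assoc)
    also have "\<dots> \<le> norm (N k x) * (norm (Zs k) * B)"
      using contr[OF x, of k] B0 by (intro mult_right_mono) auto
    finally show "real (k + 1) * \<bar>b (N k x) (Zs k)\<bar> \<le> norm (N k x) * norm (Zs k) * B"
      by (simp add: mult.assoc)
  qed
  have L1: "b (wedge (e0 + w) x) (wedge (e0 + w) y) = 0" if "x \<in> F.E" "y \<in> F.E" for x y
  proof (rule zero[OF that(1) _ Nlim[OF that(2)]])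
    fix k
    show "N k y \<in> so_pq" by (simp add: N_def)
    have "norm (T (r k) (N k y)) \<le> real (k + 1) * norm (T (r k) (N k y))" by (simp add: mult_le_cancel_right1)
    then show "norm (T (r k) (N k y)) \<le> norm (N k y)" using contr[OF that(2), of k] by linarith
  qed
  have L2: "b (wedge (e0 + w) x) F.boost = 0" if "x \<in> F.E" for x
    unfolding F.boost_def wedge_omega
  proof (rule zero[OF that])
    show "(\<lambda>k. wedge e0 (v k)) \<longlonglongrightarrow> wedge e0 w" by (intro wlim tendsto_const v)
    show "norm (T (r k) (wedge e0 (v k))) \<le> norm (wedge e0 (v k))" for k
      using T[of "r k"] by (simp add: contracts_frame_def v_def)
  qed simp
  \<comment> \<open>A wedge of two projected vectors is a rotation of the \<open>k\<close>-th frame,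
    and by \<open>rotation_expand\<close> such wedges account for all rotations of the limit
    frame.\<close>
  have W: "b (wedge (e0 + w) x) (wedge y z) = 0" if "x \<in> F.E" "y \<in> F.E" "z \<in> F.E" for x y z
  proof (rule zero[OF that(1)])
    show "(\<lambda>k. wedge (p k y) (p k z)) \<longlonglongrightarrow> wedge y z" by (intro wlim plim that)
    show "norm (T (r k) (wedge (p k y) (p k z))) \<le> norm (wedge (p k y) (p k z))" for k
      using T[of "r k"] null_frame.wedge_E[OF null_frame_omega[OF vk] pE[OF that(2)] pE[OF that(3)], of k]
      unfolding contracts_frame_def v_def by blast
  qed simp
  have L3: "b (wedge (e0 + w) x) M = 0" if "x \<in> F.E" "M \<in> F.rotations" for x M
    by (subst F.rotation_expand[OF that(2)])
       (simp add: b_bilin linear_sum[OF bilin[unfolded bilinear_def, THEN conjunct1, rule_format]]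
         W that F.rotationsD(4))
  have "framed_form b h (e0 + w) (e0 - w)"
    by unfold_locales (use n L1 L2 L3 in auto)
  then show ?thesis by blast
qed

theorem radical_classification:
  assumes "CARD('n) \<ge> 2" unbounded_symmetries
  shows "(\<exists>w. eta w w > 0 \<and> h = {X \<in> so_pq. X *v w = 0}) \<or> (CARD('n) = 2 \<and> h = {0})"
  using exists_framed_form[OF assms] framed_form.h_classification by blast

end

section \<open>Annihilators of spacelike vectors\<close>

lemma eta_preserving_det:
  assumes "\<And>x y. eta (A *v x) (A *v y) = eta x (y :: 'n::finite lvec)"
  shows "det A = 1 \<or> det A = - 1"
proof -
  let ?J = "matrix Jv :: 'n lmat"
  have "transpose A ** ?J ** A = ?J"
  proof (rule mat_eqI)
    fix z
    have "((transpose A ** ?J ** A) *v z) \<bullet> y = (?J *v z) \<bullet> y" for y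
      using assms[of y z] inner_transpose[of A "Jv (A *v z)" y]
      by (simp add: pq_inner_Jv inner_commute flip: matrix_vector_mul_assoc)
    then show "(transpose A ** ?J ** A) *v z = ?J *v z" using vector_eq_rdot by blast
  qed
  then have "det A * det ?J * det A = det ?J"
    by (metis det_mul det_transpose)
  moreover have "det ?J * det ?J = 1"
    by (metis det_mul matrix_Jv_Jv det_I)
  ultimately have "det A * det A = 1"
    by (metis mult.assoc mult.commute mult.right_neutral)
  then show ?thesis by (simp add: square_eq_1_iff)
qed

lemma det_matrix_Jv: "det (matrix Jv :: 'n::finite lmat) = - 1"
proof -
  have *: "(matrix Jv :: 'n lmat) $ i $ j = (if i = j then (case i of Inl _ \<Rightarrow> - 1 | Inr _ \<Rightarrow> 1) else 0)" for i j
  proof -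
    have "(matrix Jv :: 'n lmat) $ i $ j = Jv (axis j 1) $ i"
      by (simp add: matrix_def)
    also have "\<dots> = (if i = j then (case i of Inl _ \<Rightarrow> - 1 | Inr _ \<Rightarrow> 1) else 0)"
    proof (cases i)
      case (Inl a)
      have "a = 1" by simp
      with Inl have "i = Inl 1" by simp
      then show ?thesis by (auto simp: Jv_nth axis_def split: sum.split)
    qed (auto simp: Jv_nth axis_def split: sum.split)
    finally show ?thesis .
  qed
  have "det (matrix Jv :: 'n lmat) = (\<Prod>i\<in>UNIV. case i of Inl (_ :: 1) \<Rightarrow> - 1 | Inr (_ :: 'n) \<Rightarrow> 1)"
    by (subst det_diagonal) (simp_all add: *)
  also have "\<dots> = - 1"
  proof -
    have "(\<Prod>i\<in>UNIV. (case i of Inl (_ :: 1) \<Rightarrow> - 1 | Inr (_ :: 'n) \<Rightarrow> 1) :: real) =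
      (\<Prod>i\<in>UNIV <+> UNIV. case i of Inl (_ :: 1) \<Rightarrow> - 1 | Inr (_ :: 'n) \<Rightarrow> 1)"
      by (simp only: UNIV_Plus_UNIV)
    also have "\<dots> = - 1" by (subst prod.Plus) auto
    finally show ?thesis .
  qed
  finally show ?thesis .
qed

section \<open>Transitivity on unit spacelike vectors\<close>

definition reflect :: "'n::finite lvec \<Rightarrow> 'n lvec \<Rightarrow> 'n lvec" where
  "reflect z x = x - (2 * eta x z / eta z z) *\<^sub>R z"

lemma linear_reflect: "linear (reflect z)"
  by (rule linearI) (simp_all add: reflect_def eta_bilin add_divide_distrib algebra_simps)

lemma reflect_eta: "eta z z \<noteq> 0 \<Longrightarrow> eta (reflect z x) (reflect z y) = eta x y"
  by (simp add: reflect_def eta_bilin eta_sym[of z x] eta_sym[of z y] field_simps)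

text \<open>The reflection in \<open>w - e\<close> sends \<open>e\<close> to \<open>w\<close>. If
  \<open>w - e\<close> is null, then \<open>eta w e = 1\<close>, so \<open>w + e\<close> is not
  null, and the negative of its reflection does the same. A wrong determinant is corrected by
  \<open>Jv\<close>, which has determinant -1 and fixes \<open>e\<close>.\<close>

lemma SO_transitive:
  fixes e w :: "'n::finite lvec"
  assumes "eta e e = 1" "eta w w = 1" "Jv e = e"
  obtains A where "A \<in> carrier SO_pq" "A *v e = w"
proof -
  obtain F where F: "linear F" "\<And>x y. eta (F x) (F y) = eta x y" "F e = w"
  proof (cases "eta (w - e) (w - e) = 0")
    case False
    have 1: "eta (w - e) (w - e) = - 2 * eta e (w - e)"
      using assms by (simp add: eta_bilin eta_sym[of w e])
    have "2 * eta e (w - e) / eta (w - e) (w - e) = - 1"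
      using False unfolding 1 by simp
    then have "reflect (w - e) e = w" unfolding reflect_def by simp
    then show thesis using that[OF linear_reflect reflect_eta[OF False]] by blast
  next
    case True
    then have n: "eta (w + e) (w + e) \<noteq> 0"
      using assms by (simp add: eta_bilin eta_sym[of w e])
    have 1: "eta (w + e) (w + e) = 2 * eta e (w + e)"
      using assms by (simp add: eta_bilin eta_sym[of w e])
    have "2 * eta e (w + e) / eta (w + e) (w + e) = 1"
      using n unfolding 1 by simp
    then have "- reflect (w + e) e = w" unfolding reflect_def by simp
    then show thesis
      using linear_reflect[of "w + e"] reflect_eta[OF n]
      by (intro that[of "\<lambda>x. - reflect (w + e) x"]) (simp_all add: linear_compose_neg eta_bilin)
  qed
  define A where "A = matrix F"
  have A: "A *v x = F x" for x by (simp add: A_def F(1))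
  have pres: "eta (A *v x) (A *v y) = eta x y" for x y by (simp add: A F(2))
  have presJ: "eta ((A ** matrix Jv) *v x) ((A ** matrix Jv) *v y) = eta x y" for x y
    by (simp add: pres eta_Jv flip: matrix_vector_mul_assoc)
  show thesis
  proof (cases "det A = 1")
    case True
    then show thesis
      using that[of A] pres by (simp add: SO_pq_def pq_form_inner A F(3))
  next
    case False
    then have "det (A ** matrix Jv) = 1"
      using eta_preserving_det[OF pres] by (auto simp: det_mul det_matrix_Jv)
    moreover have "(A ** matrix Jv) *v e = w"
      by (simp add: assms(3) A F(3) flip: matrix_vector_mul_assoc)
    ultimately show thesis
      using that[of "A ** matrix Jv"] presJ by (simp add: SO_pq_def pq_form_inner)
  qed
qed

lemma SO_eta:
  fixes A :: "'n::finite lmat"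
  assumes "A \<in> carrier SO_pq" shows "eta (A *v x) (A *v y) = eta x y"
proof -
  have f: "eta (A *v z) (A *v z) = eta z z" for z
    using assms by (simp add: SO_pq_def pq_form_inner)
  show ?thesis
    using f[of "x + y"] f[of x] f[of y] by (simp add: mat_distrib eta_bilin eta_sym[of "A *v y" "A *v x"] eta_sym[of y x])
qed

lemma annihilator_conjugate:
  fixes w :: "'n::finite lvec"
  assumes "eta w w > 0"
  shows "\<exists>A\<in>carrier SO_pq. \<exists>j.
    {X \<in> so_pq. X *v w = 0} = (\<lambda>X. A ** X ** matrix_inv A) ` standard_copy j"
proof -
  \<comment> \<open>Any index will do, since the isometry group is transitive on unit spacelike
    vectors.\<close>
  fix j :: 'n
  define e :: "'n lvec" where "e = axis (Inr j) 1"
  have ee: "e \<bullet> e0 = 0" "e \<bullet> e = 1" by (simp_all add: e_def e0_def inner_axis_axis)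
  then have e: "Jv e = e" "eta e e = 1" by (simp_all add: pq_inner_Jv Jv_def)
  define c where "c = sqrt (eta w w)"
  have c: "c > 0" "c * c = eta w w" using assms by (simp_all add: c_def)
  have "eta ((1/c) *\<^sub>R w) ((1/c) *\<^sub>R w) = 1" using c(1) by (simp add: eta_bilin c(2)[symmetric])
  then obtain A where A: "A \<in> carrier SO_pq" "A *v e = (1/c) *\<^sub>R w"
    using SO_transitive[OF e(2) _ e(1)] by blast
  have "invertible A" using A(1) by (simp add: SO_pq_def invertible_det_nz)
  then have inv: "A ** matrix_inv A = mat 1" "matrix_inv A ** A = mat 1"
    using someI_ex[of "\<lambda>B. A ** B = mat 1 \<and> B ** A = mat 1"]
    unfolding invertible_def matrix_inv_def by blast+
  have inv_apply: "A *v (matrix_inv A *v x) = x" "matrix_inv A *v (A *v x) = x" for x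
    by (simp_all add: matrix_vector_mul_assoc inv)
  have inv_eta: "eta (matrix_inv A *v x) y = eta x (A *v y)" for x y
    using SO_eta[OF A(1), of "matrix_inv A *v x" y] by (simp add: inv_apply)
  have w: "w = c *\<^sub>R (A *v e)" using A(2) c by simp
  have A_eta: "eta (A *v x) y = eta x (matrix_inv A *v y)" for x y
    using SO_eta[OF A(1), of x "matrix_inv A *v y"] by (simp add: inv_apply)
  have so1: "A ** X ** matrix_inv A \<in> so_pq" if "X \<in> so_pq" for X
    unfolding so_iff by (simp add: A_eta soD[OF that] inv_eta flip: matrix_vector_mul_assoc)
  have so2: "matrix_inv A ** X ** A \<in> so_pq" if "X \<in> so_pq" for X
    unfolding so_iff by (simp add: A_eta soD[OF that] inv_eta flip: matrix_vector_mul_assoc)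
  have unconj: "A ** (matrix_inv A ** X ** A) ** matrix_inv A = X" for X
    by (rule mat_eqI) (simp add: inv_apply flip: matrix_vector_mul_assoc)
  have ann: "(A ** X ** matrix_inv A) *v w = c *\<^sub>R (A *v (X *v e))"
    "(matrix_inv A ** X ** A) *v e = (1/c) *\<^sub>R (matrix_inv A *v (X *v w))" for X
    using c by (simp_all add: w mat_distrib inv_apply flip: matrix_vector_mul_assoc)
  have "{X \<in> so_pq. X *v w = 0} = (\<lambda>X. A ** X ** matrix_inv A) ` standard_copy j"
    unfolding standard_copy_def e_def[symmetric]
  proof (intro equalityI subsetI)
    fix X assume X: "X \<in> {X \<in> so_pq. X *v w = 0}"
    then have "matrix_inv A ** X ** A \<in> {X \<in> so_pq. X *v e = 0}"
      by (simp add: so2 ann)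
    then show "X \<in> (\<lambda>X. A ** X ** matrix_inv A) ` {X \<in> so_pq. X *v e = 0}"
      by (rule image_eqI[rotated]) (rule unconj[symmetric])
  next
    fix X assume "X \<in> (\<lambda>X. A ** X ** matrix_inv A) ` {X \<in> so_pq. X *v e = 0}"
    then show "X \<in> {X \<in> so_pq. X *v w = 0}" by (auto simp: so1 ann)
  qed
  then show ?thesis using A(1) by blast
qed

section \<open>Calculus of \<open>C\<^sup>k\<close> maps\<close>

lemma frechet_derivativeI: "(f has_derivative f') (at x) \<Longrightarrow> frechet_derivative f (at x) = f'"
  by (metis frechet_derivative_at)

lemma frechet_derivative_cong_open:
  assumes "open S" "x \<in> S" "\<And>y. y \<in> S \<Longrightarrow> f y = g y"
  shows "f differentiable at x \<longleftrightarrow> g differentiable at x"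
    "frechet_derivative f (at x) = frechet_derivative g (at x)"
proof -
  have "(f has_derivative D) (at x) \<longleftrightarrow> (g has_derivative D) (at x)" for D
    using has_derivative_transform_within_open[of f D x UNIV S g]
      has_derivative_transform_within_open[of g D x UNIV S f] assms by metis
  then show "f differentiable at x \<longleftrightarrow> g differentiable at x"
    "frechet_derivative f (at x) = frechet_derivative g (at x)"
    by (auto simp: differentiable_def frechet_derivative_def)
qed

lemma Ck_on_cong:
  assumes "open S" "Ck_on k S f" "\<And>x. x \<in> S \<Longrightarrow> f x = g x"
  shows "Ck_on k S g"
  using assms(2,3)
proof (induction k arbitrary: f g)
  case 0 then show ?case using continuous_on_cong[of S S f g] by simp
next
  case (Suc k)
  show ?case unfolding Ck_on.simps
  proof (intro conjI ballI allI)
    show "g differentiable at x" if "x \<in> S" for x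
      using frechet_derivative_cong_open(1)[OF assms(1) that, of f g] Suc.prems that by auto
    show "Ck_on k S (\<lambda>x. frechet_derivative g (at x) v)" for v
      by (rule Suc.IH[of "\<lambda>x. frechet_derivative f (at x) v"])
        (use Suc.prems frechet_derivative_cong_open(2)[OF assms(1), of _ f g] in auto)
  qed
qed

lemma Ck_on_subset: "Ck_on k S f \<Longrightarrow> T \<subseteq> S \<Longrightarrow> Ck_on k T f"
  by (induction k arbitrary: f) (auto intro: continuous_on_subset)

lemma Ck_on_local:
  assumes "\<And>x. x \<in> S \<Longrightarrow> \<exists>U. open U \<and> x \<in> U \<and> Ck_on k U f"
  shows "Ck_on k S f"
  using assms
proof (induction k arbitrary: f)
  case 0
  then show ?case
    by (simp add: continuous_on_eq_continuous_within)
      (metis continuous_on_eq_continuous_at continuous_at_imp_continuous_at_within continuous_on_eq_continuous_within)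
next
  case (Suc k)
  show ?case unfolding Ck_on.simps
  proof (intro conjI ballI allI)
    show "f differentiable at x" if "x \<in> S" for x using Suc.prems[OF that] by auto
    show "Ck_on k S (\<lambda>x. frechet_derivative f (at x) v)" for v
      using Suc.prems by (intro Suc.IH) (metis Ck_on.simps(2))
  qed
qed

lemma Ck_on_SucI:
  assumes "open S" "\<And>x. x \<in> S \<Longrightarrow> (f has_derivative f' x) (at x)" "\<And>v. Ck_on k S (\<lambda>x. f' x v)"
  shows "Ck_on (Suc k) S f"
  unfolding Ck_on.simps
proof (intro conjI ballI allI)
  show "f differentiable at x" if "x \<in> S" for x using assms(2)[OF that] by (auto simp: differentiable_def)
  show "Ck_on k S (\<lambda>x. frechet_derivative f (at x) v)" for v
    by (rule Ck_on_cong[OF assms(1) assms(3)[of v]]) (simp add: frechet_derivativeI[OF assms(2)])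
qed

lemma Ck_on_has_derivative:
  "Ck_on (Suc k) S f \<Longrightarrow> x \<in> S \<Longrightarrow> (f has_derivative frechet_derivative f (at x)) (at x)"
  by (simp add: frechet_derivative_works)

lemma Ck_on_Suc: "Ck_on (Suc k) S f \<Longrightarrow> Ck_on k S f"
proof (induction k arbitrary: f)
  case 0
  then show ?case
    by (auto intro!: continuous_at_imp_continuous_on differentiable_imp_continuous_within)
next
  case (Suc k)
  then show ?case by (metis Ck_on.simps(2))
qed

lemma Ck_on_continuous: "Ck_on k S f \<Longrightarrow> continuous_on S f"
  by (induction k) (auto dest: Ck_on_Suc simp del: Ck_on.simps(2))

lemma Ck_on_const: "Ck_on k S (\<lambda>x. c)"
proof (induction k arbitrary: c)
  case (Suc k) then show ?case
    by (simp add: frechet_derivativeI[OF has_derivative_const])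
qed simp

lemma Ck_on_add:
  assumes "open S" "Ck_on k S f" "Ck_on k S g" shows "Ck_on k S (\<lambda>x. f x + g x)"
  using assms(2,3)
proof (induction k arbitrary: f g)
  case 0 then show ?case by (simp add: continuous_on_add)
next
  case (Suc k)
  show ?case
    by (rule Ck_on_SucI[OF assms(1)], rule has_derivative_add; (rule Ck_on_has_derivative[OF Suc.prems(1)]
      | rule Ck_on_has_derivative[OF Suc.prems(2)])?)
       (use Suc.prems in \<open>auto intro!: Suc.IH\<close>)
qed

lemma Ck_on_sum:
  assumes "open S" "\<And>i. i \<in> I \<Longrightarrow> Ck_on k S (f i)" shows "Ck_on k S (\<lambda>x. \<Sum>i\<in>I. f i x)"
  using assms(2) by (induction I rule: infinite_finite_induct) (auto intro: Ck_on_const Ck_on_add assms(1))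

lemma Ck_on_bilinear:
  assumes B: "bounded_bilinear B" and S: "open S" and "Ck_on k S f" "Ck_on k S g"
  shows "Ck_on k S (\<lambda>x. B (f x) (g x))"
  using assms(3,4)
proof (induction k arbitrary: f g)
  case 0 then show ?case by (simp add: bounded_bilinear.continuous_on[OF B])
next
  case (Suc k)
  show ?case
  proof (rule Ck_on_SucI[OF S])
    show "((\<lambda>x. B (f x) (g x)) has_derivative
        (\<lambda>v. B (f x) (frechet_derivative g (at x) v) + B (frechet_derivative f (at x) v) (g x))) (at x)"
      if "x \<in> S" for x
      by (rule bounded_bilinear.FDERIV[OF B Ck_on_has_derivative[OF Suc.prems(1) that]
            Ck_on_has_derivative[OF Suc.prems(2) that]])
    show "Ck_on k S (\<lambda>x. B (f x) (frechet_derivative g (at x) v) + B (frechet_derivative f (at x) v) (g x))" for v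
      using Suc.prems Ck_on_Suc[OF Suc.prems(1)] Ck_on_Suc[OF Suc.prems(2)]
      by (intro Ck_on_add S Suc.IH) auto
  qed
qed

lemma Ck_on_linear_comp:
  assumes L: "bounded_linear L" and S: "open S" and "Ck_on k S f"
  shows "Ck_on k S (\<lambda>x. L (f x))"
  using assms(3)
proof (induction k arbitrary: f)
  case 0 then show ?case by (simp add: bounded_linear.continuous_on[OF L])
next
  case (Suc k)
  show ?case
    by (rule Ck_on_SucI[OF S bounded_linear.has_derivative[OF L Ck_on_has_derivative[OF Suc.prems]]])
       (use Suc in auto)
qed

lemma Ck_on_ident: "open S \<Longrightarrow> Ck_on k S (\<lambda>x. x)"
proof (induction k)
  case (Suc k)
  show ?case by (rule Ck_on_SucI[OF Suc.prems has_derivative_ident Ck_on_const])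
qed simp

lemma Ck_on_Pair:
  assumes "open S" "Ck_on k S f" "Ck_on k S g" shows "Ck_on k S (\<lambda>x. (f x, g x))"
proof -
  have "Ck_on k S (\<lambda>x. (f x, 0) + (0, g x))"
    by (intro Ck_on_add assms Ck_on_linear_comp[of "\<lambda>x. (x, 0)"] Ck_on_linear_comp[of "\<lambda>x. (0, x)"]
        bounded_linear_Pair bounded_linear_ident bounded_linear_zero)
  then show ?thesis by simp
qed

lemma Ck_on_compose:
  fixes f :: "'a::euclidean_space \<Rightarrow> 'b::euclidean_space" and g :: "'b \<Rightarrow> 'c::real_normed_vector"
  assumes S: "open S" and "Ck_on k S f" "Ck_on k T g" "f ` S \<subseteq> T"
  shows "Ck_on k S (\<lambda>x. g (f x))"
  using assms(2-)
proof (induction k arbitrary: g)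
  case 0 then show ?case by (auto intro: continuous_on_compose2)
next
  case (Suc k)
  have g: "(g has_derivative frechet_derivative g (at (f x))) (at (f x))" if "x \<in> S" for x
    using Ck_on_has_derivative[OF Suc.prems(2), of "f x"] Suc.prems(3) that by auto
  show ?case
  proof (rule Ck_on_SucI[OF S])
    show "((\<lambda>x. g (f x)) has_derivative
        (\<lambda>v. frechet_derivative g (at (f x)) (frechet_derivative f (at x) v))) (at x)" if "x \<in> S" for x
      by (rule has_derivative_compose[OF Ck_on_has_derivative[OF Suc.prems(1) that] g[OF that]])
    fix v
    have f': "Ck_on k S (\<lambda>x. frechet_derivative f (at x) v)" using Suc.prems(1) by simp
    \<comment> \<open>In the derivative of the composite both the linear map and its argument depend
      on \<open>x\<close>. The expansion in a basis separates them into products to which the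
      induction hypothesis applies.\<close>
    have "Ck_on k S (\<lambda>x. \<Sum>b\<in>Basis. (frechet_derivative f (at x) v \<bullet> b) *\<^sub>R frechet_derivative g (at (f x)) b)"
    proof (intro Ck_on_sum[OF S] Ck_on_bilinear[OF bounded_bilinear_scaleR S])
      fix b :: 'b
      show "Ck_on k S (\<lambda>x. frechet_derivative f (at x) v \<bullet> b)"
        by (rule Ck_on_linear_comp[OF bounded_linear_inner_left S f'])
      show "Ck_on k S (\<lambda>x. frechet_derivative g (at (f x)) b)"
        using Suc.prems Ck_on_Suc[OF Suc.prems(1)] by (intro Suc.IH) auto
    qed
    then show "Ck_on k S (\<lambda>x. frechet_derivative g (at (f x)) (frechet_derivative f (at x) v))"
    proof (rule Ck_on_cong[OF S])
      fix x assume "x \<in> S"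
      then have lin: "linear (frechet_derivative g (at (f x)))" using g has_derivative_linear by blast
      show "(\<Sum>b\<in>Basis. (frechet_derivative f (at x) v \<bullet> b) *\<^sub>R frechet_derivative g (at (f x)) b) =
          frechet_derivative g (at (f x)) (frechet_derivative f (at x) v)"
        by (subst (2) euclidean_representation[symmetric])
           (simp add: linear_sum[OF lin] linear_scale[OF lin])
    qed
  qed
qed

lemma smooth_onD: "smooth_on S f \<Longrightarrow> Ck_on k S f" by (simp add: smooth_on_def)

lemma smooth_on_subset: "smooth_on S f \<Longrightarrow> T \<subseteq> S \<Longrightarrow> smooth_on T f"
  by (auto simp: smooth_on_def intro: Ck_on_subset)

lemma smooth_on_cong: "open S \<Longrightarrow> smooth_on S f \<Longrightarrow> (\<And>x. x \<in> S \<Longrightarrow> f x = g x) \<Longrightarrow> smooth_on S g"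
  by (auto simp: smooth_on_def intro: Ck_on_cong)

lemma smooth_on_local: "(\<And>x. x \<in> S \<Longrightarrow> \<exists>U. open U \<and> x \<in> U \<and> smooth_on U f) \<Longrightarrow> smooth_on S f"
  unfolding smooth_on_def using Ck_on_local[of S _ f] by meson

lemma smooth_on_compose:
  fixes f :: "'a::euclidean_space \<Rightarrow> 'b::euclidean_space" and g :: "'b \<Rightarrow> 'c::real_normed_vector"
  shows "open S \<Longrightarrow> smooth_on S f \<Longrightarrow> smooth_on T g \<Longrightarrow> f ` S \<subseteq> T \<Longrightarrow> smooth_on S (\<lambda>x. g (f x))"
  unfolding smooth_on_def by (blast intro: Ck_on_compose)

lemma smooth_on_Pair: "open S \<Longrightarrow> smooth_on S f \<Longrightarrow> smooth_on S g \<Longrightarrow> smooth_on S (\<lambda>x. (f x, g x))"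
  by (simp add: smooth_on_def Ck_on_Pair)

lemma smooth_on_const: "smooth_on S (\<lambda>x. c)"
  by (simp add: smooth_on_def Ck_on_const)

lemma smooth_on_ident: "open S \<Longrightarrow> smooth_on S (\<lambda>x. x)"
  by (simp add: smooth_on_def Ck_on_ident)

lemma smooth_on_linear_comp:
  "bounded_linear L \<Longrightarrow> open S \<Longrightarrow> smooth_on S f \<Longrightarrow> smooth_on S (\<lambda>x. L (f x))"
  by (simp add: smooth_on_def Ck_on_linear_comp)

lemma smooth_on_linear: "bounded_linear L \<Longrightarrow> open S \<Longrightarrow> smooth_on S L"
  by (rule smooth_on_linear_comp[OF _ _ smooth_on_ident])

lemma smooth_on_has_derivative:
  "smooth_on S f \<Longrightarrow> x \<in> S \<Longrightarrow> (f has_derivative frechet_derivative f (at x)) (at x)"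
  using Ck_on_has_derivative[of 0] smooth_onD by blast

lemma smooth_on_frechet: "smooth_on S f \<Longrightarrow> smooth_on S (\<lambda>x. frechet_derivative f (at x) v)"
  unfolding smooth_on_def by (metis Ck_on.simps(2))

lemma smooth_on_continuous: "smooth_on S f \<Longrightarrow> continuous_on S f"
  using Ck_on_continuous smooth_onD by blast

section \<open>Symmetry of the second derivative\<close>

text \<open>The mean value theorem twice: in direction \<open>v\<close> for the increment of \<phi>
  along \<open>w\<close>, and in direction \<open>w\<close> for the derivative of \<phi> in
  direction \<open>v\<close>.\<close>

lemma second_difference:
  fixes \<phi> :: "'a::real_normed_vector \<Rightarrow> real"
  assumes t: "t > 0" and S: "\<And>a b. 0 \<le> a \<Longrightarrow> a \<le> t \<Longrightarrow> 0 \<le> b \<Longrightarrow> b \<le> t \<Longrightarrow> x + a *\<^sub>R v + b *\<^sub>R w \<in> S"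
    and d1: "\<And>y. y \<in> S \<Longrightarrow> (\<phi> has_derivative \<phi>' y) (at y)"
    and d2: "\<And>y. y \<in> S \<Longrightarrow> ((\<lambda>y. \<phi>' y v) has_derivative A y) (at y)"
  shows "\<exists>a b. 0 \<le> a \<and> a \<le> t \<and> 0 \<le> b \<and> b \<le> t \<and>
    \<phi> (x + t *\<^sub>R v + t *\<^sub>R w) - \<phi> (x + t *\<^sub>R v) - \<phi> (x + t *\<^sub>R w) + \<phi> x = t * (t * A (x + a *\<^sub>R v + b *\<^sub>R w) w)"
proof -
  have dv: "((\<lambda>a. \<phi> (x + a *\<^sub>R v + b *\<^sub>R w)) has_real_derivative \<phi>' (x + a *\<^sub>R v + b *\<^sub>R w) v) (at a)"
    if "0 \<le> a" "a \<le> t" "0 \<le> b" "b \<le> t" for a b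
  proof -
    have "((\<lambda>a. \<phi> (x + a *\<^sub>R v + b *\<^sub>R w)) has_derivative (\<lambda>s. \<phi>' (x + a *\<^sub>R v + b *\<^sub>R w) (s *\<^sub>R v))) (at a)"
      by (rule has_derivative_compose[where f = "\<lambda>a. x + a *\<^sub>R v + b *\<^sub>R w", OF _ d1[OF S[OF that]]])
         (auto intro!: derivative_eq_intros)
    then show ?thesis
      by (simp add: has_field_derivative_def linear_scale[OF has_derivative_linear[OF d1[OF S[OF that]]]]
          mult_commute_abs)
  qed
  have "\<exists>a. 0 < a \<and> a < t \<and> (\<phi> (x + t *\<^sub>R v + t *\<^sub>R w) - \<phi> (x + t *\<^sub>R v + 0 *\<^sub>R w)) -
      (\<phi> (x + 0 *\<^sub>R v + t *\<^sub>R w) - \<phi> (x + 0 *\<^sub>R v + 0 *\<^sub>R w))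
      = (t - 0) * (\<phi>' (x + a *\<^sub>R v + t *\<^sub>R w) v - \<phi>' (x + a *\<^sub>R v + 0 *\<^sub>R w) v)"
    by (rule MVT2[OF t]) (intro DERIV_diff dv; use t in simp)
  then obtain a where a: "0 < a" "a < t" and ea: "\<phi> (x + t *\<^sub>R v + t *\<^sub>R w) - \<phi> (x + t *\<^sub>R v) - \<phi> (x + t *\<^sub>R w) + \<phi> x
      = t * (\<phi>' (x + a *\<^sub>R v + t *\<^sub>R w) v - \<phi>' (x + a *\<^sub>R v + 0 *\<^sub>R w) v)"
    by (auto simp: algebra_simps)
  have dw: "((\<lambda>b. \<phi>' (x + a *\<^sub>R v + b *\<^sub>R w) v) has_real_derivative A (x + a *\<^sub>R v + b *\<^sub>R w) w) (at b)"
    if "0 \<le> b" "b \<le> t" for b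
  proof -
    have s: "x + a *\<^sub>R v + b *\<^sub>R w \<in> S" using S that a by simp
    have "((\<lambda>b. \<phi>' (x + a *\<^sub>R v + b *\<^sub>R w) v) has_derivative (\<lambda>s. A (x + a *\<^sub>R v + b *\<^sub>R w) (s *\<^sub>R w))) (at b)"
      by (rule has_derivative_compose[where f = "\<lambda>b. x + a *\<^sub>R v + b *\<^sub>R w", OF _ d2[OF s]])
         (auto intro!: derivative_eq_intros)
    then show ?thesis
      by (simp add: has_field_derivative_def linear_scale[OF has_derivative_linear[OF d2[OF s]]] mult_commute_abs)
  qed
  have "\<exists>b. 0 < b \<and> b < t \<and> \<phi>' (x + a *\<^sub>R v + t *\<^sub>R w) v - \<phi>' (x + a *\<^sub>R v + 0 *\<^sub>R w) v = (t - 0) * A (x + a *\<^sub>R v + b *\<^sub>R w) w"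
    by (rule MVT2[OF t]) (rule dw; simp)
  then obtain b where "0 < b" "b < t"
    "\<phi>' (x + a *\<^sub>R v + t *\<^sub>R w) v - \<phi>' (x + a *\<^sub>R v + 0 *\<^sub>R w) v = t * A (x + a *\<^sub>R v + b *\<^sub>R w) w"
    by auto
  then show ?thesis using a ea by (intro exI[of _ a] exI[of _ b]) simp
qed

text \<open>The second difference over the parallelogram of \<open>t *\<^sub>R v\<close> and
  \<open>t *\<^sub>R w\<close> is symmetric in \<open>v\<close> and \<open>w\<close>, and it is
  \<open>t * t\<close> times either mixed derivative at some point of the parallelogram. By
  continuity distinct values at \<open>x\<close> would stay distinct at these points.\<close>

lemma symmetric_second_derivative_real:
  fixes \<phi> :: "'a::real_normed_vector \<Rightarrow> real"
  assumes S: "open S" "x \<in> S"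
    and d1: "\<And>y. y \<in> S \<Longrightarrow> (\<phi> has_derivative \<phi>' y) (at y)"
    and dv: "\<And>y. y \<in> S \<Longrightarrow> ((\<lambda>y. \<phi>' y v) has_derivative A y) (at y)"
    and dw: "\<And>y. y \<in> S \<Longrightarrow> ((\<lambda>y. \<phi>' y w) has_derivative B y) (at y)"
    and cA: "continuous_on S (\<lambda>y. A y w)" and cB: "continuous_on S (\<lambda>y. B y v)"
  shows "A x w = B x v"
proof (rule ccontr)
  assume ne: "A x w \<noteq> B x v"
  define \<epsilon> where "\<epsilon> = \<bar>A x w - B x v\<bar> / 2"
  have \<epsilon>: "\<epsilon> > 0" using ne by (simp add: \<epsilon>_def)
  have "isCont (\<lambda>y. A y w) x" "isCont (\<lambda>y. B y v) x"
    using cA cB S continuous_on_eq_continuous_at by blast+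
  then obtain d1' d2 where d: "d1' > 0" "\<And>y. dist y x < d1' \<Longrightarrow> \<bar>A y w - A x w\<bar> < \<epsilon>"
    "d2 > 0" "\<And>y. dist y x < d2 \<Longrightarrow> \<bar>B y v - B x v\<bar> < \<epsilon>"
    unfolding continuous_at_eps_delta dist_real_def using \<epsilon> by metis
  obtain r where r: "r > 0" "ball x r \<subseteq> S" using S open_contains_ball by blast
  \<comment> \<open>Small enough for the parallelogram to stay in all three balls; the summand 1
    keeps the denominator positive when \<open>v\<close> and \<open>w\<close> vanish.\<close>
  define t where "t = min r (min d1' d2) / (2 * (norm v + norm w + 1))"
  have pos: "norm v + norm w + 1 > 0" using norm_ge_zero[of v] norm_ge_zero[of w] by linarith
  have t: "t > 0" using r d pos by (simp add: t_def)
  have near: "dist (x + a *\<^sub>R v + b *\<^sub>R w) x < min r (min d1' d2)"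
    if "0 \<le> a" "a \<le> t" "0 \<le> b" "b \<le> t" for a b
  proof -
    have "dist (x + a *\<^sub>R v + b *\<^sub>R w) x = norm (a *\<^sub>R v + b *\<^sub>R w)" by (simp add: dist_norm)
    also have "\<dots> \<le> a * norm v + b * norm w" using that norm_triangle_ineq[of "a *\<^sub>R v" "b *\<^sub>R w"] by simp
    also have "\<dots> \<le> t * norm v + t * norm w" using that by (intro add_mono mult_right_mono) auto
    also have "\<dots> = t * (norm v + norm w)" by (simp add: algebra_simps)
    also have "\<dots> < t * (2 * (norm v + norm w + 1))" using t pos by (intro mult_strict_left_mono) auto
    also have "\<dots> = min r (min d1' d2)" using pos by (simp add: t_def)
    finally show ?thesis .
  qed
  have near': "dist (x + a *\<^sub>R w + b *\<^sub>R v) x < min r (min d1' d2)"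
    if "0 \<le> a" "a \<le> t" "0 \<le> b" "b \<le> t" for a b
    using near[OF that(3,4,1,2)] by (simp add: algebra_simps)
  have inS: "x + a *\<^sub>R v + b *\<^sub>R w \<in> S" if "0 \<le> a" "a \<le> t" "0 \<le> b" "b \<le> t" for a b
    using near[OF that] r by (auto simp: subset_eq dist_commute)
  have inS': "x + a *\<^sub>R w + b *\<^sub>R v \<in> S" if "0 \<le> a" "a \<le> t" "0 \<le> b" "b \<le> t" for a b
    using near'[OF that] r by (auto simp: subset_eq dist_commute)
  obtain a b where ab: "0 \<le> a" "a \<le> t" "0 \<le> b" "b \<le> t"
    "\<phi> (x + t *\<^sub>R v + t *\<^sub>R w) - \<phi> (x + t *\<^sub>R v) - \<phi> (x + t *\<^sub>R w) + \<phi> x = t * (t * A (x + a *\<^sub>R v + b *\<^sub>R w) w)"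
    using second_difference[OF t inS d1 dv] by blast
  obtain a' b' where ab': "0 \<le> a'" "a' \<le> t" "0 \<le> b'" "b' \<le> t"
    "\<phi> (x + t *\<^sub>R w + t *\<^sub>R v) - \<phi> (x + t *\<^sub>R w) - \<phi> (x + t *\<^sub>R v) + \<phi> x = t * (t * B (x + a' *\<^sub>R w + b' *\<^sub>R v) v)"
    using second_difference[OF t inS' d1 dw] by blast
  have "A (x + a *\<^sub>R v + b *\<^sub>R w) w = B (x + a' *\<^sub>R w + b' *\<^sub>R v) v"
    using ab(5) ab'(5) t by (simp add: algebra_simps)
  moreover have "\<bar>A (x + a *\<^sub>R v + b *\<^sub>R w) w - A x w\<bar> < \<epsilon>" using near[OF ab(1-4)] by (intro d) simp
  moreover have "\<bar>B (x + a' *\<^sub>R w + b' *\<^sub>R v) v - B x v\<bar> < \<epsilon>" using near'[OF ab'(1-4)] by (intro d) simp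
  ultimately show False unfolding \<epsilon>_def by (simp add: abs_if field_simps split: if_splits)
qed

lemma symmetric_second_derivative:
  fixes f :: "'a::euclidean_space \<Rightarrow> 'b::euclidean_space"
  assumes S: "open S" "x \<in> S" and f: "smooth_on S f"
  shows "frechet_derivative (\<lambda>y. frechet_derivative f (at y) v) (at x) w =
    frechet_derivative (\<lambda>y. frechet_derivative f (at y) w) (at x) v"
proof (rule euclidean_eqI)
  fix b :: 'b assume "b \<in> Basis"
  let ?D = "\<lambda>y. frechet_derivative f (at y)"
  let ?DD = "\<lambda>v y. frechet_derivative (\<lambda>y. ?D y v) (at y)"
  show "?DD v x w \<bullet> b = ?DD w x v \<bullet> b"
  proof (rule symmetric_second_derivative_real[OF S, where \<phi> = "\<lambda>y. f y \<bullet> b" and \<phi>' = "\<lambda>y v. ?D y v \<bullet> b"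
        and A = "\<lambda>y w. ?DD v y w \<bullet> b" and B = "\<lambda>y v. ?DD w y v \<bullet> b"])
    show "((\<lambda>y. f y \<bullet> b) has_derivative (\<lambda>v. ?D y v \<bullet> b)) (at y)" if "y \<in> S" for y
      by (intro has_derivative_inner_left smooth_on_has_derivative[OF f that])
    show "((\<lambda>y. ?D y v \<bullet> b) has_derivative (\<lambda>w. ?DD v y w \<bullet> b)) (at y)" if "y \<in> S" for y v
      by (intro has_derivative_inner_left smooth_on_has_derivative[OF smooth_on_frechet[OF f] that])
    then show "((\<lambda>y. ?D y w \<bullet> b) has_derivative (\<lambda>v. ?DD w y v \<bullet> b)) (at y)" if "y \<in> S" for y
      using that by blast
    show "continuous_on S (\<lambda>y. ?DD v y w \<bullet> b)" for v w
      by (intro continuous_on_inner continuous_on_const smooth_on_continuous smooth_on_frechet f)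
    then show "continuous_on S (\<lambda>y. ?DD w y v \<bullet> b)" .
  qed
qed

section \<open>Smooth maps in charts\<close>

text \<open>The part of the axioms of a smooth manifold that is needed to change charts, in a form that is
  easily inherited by products.\<close>

locale charted =
  fixes M :: "('a, 'e::euclidean_space) manifold"
  assumes chart_dom_open: "c \<in> atlas M \<Longrightarrow> openin (mtop M) (fst c)"
    and chart_inj: "c \<in> atlas M \<Longrightarrow> inj_on (snd c) (fst c)"
    and chart_open_map: "c \<in> atlas M \<Longrightarrow> openin (mtop M) U \<Longrightarrow> U \<subseteq> fst c \<Longrightarrow> open (snd c ` U)"
    and chart_cont: "c \<in> atlas M \<Longrightarrow> open V \<Longrightarrow> openin (mtop M) {p \<in> fst c. snd c p \<in> V}"
    and charts_smooth: "c \<in> atlas M \<Longrightarrow> d \<in> atlas M \<Longrightarrow>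
      smooth_on (snd c ` (fst c \<inter> fst d)) (snd d \<circ> chart_inv c)"
    and covered: "topspace (mtop M) \<subseteq> (\<Union>c\<in>atlas M. fst c)"
begin

lemma charts_atD: "c \<in> charts_at M p \<Longrightarrow> c \<in> atlas M" "c \<in> charts_at M p \<Longrightarrow> p \<in> fst c"
  by (auto simp: charts_at_def)

lemma chart_inv_chart: "c \<in> atlas M \<Longrightarrow> p \<in> fst c \<Longrightarrow> chart_inv c (snd c p) = p"
  unfolding chart_inv_def by (rule inv_into_f_f[OF chart_inj])

lemma chart_chart_inv: "x \<in> snd c ` fst c \<Longrightarrow> snd c (chart_inv c x) = x"
  "x \<in> snd c ` fst c \<Longrightarrow> chart_inv c x \<in> fst c"
  unfolding chart_inv_def by (auto intro: f_inv_into_f inv_into_into)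

lemma chart_dom_sub: "c \<in> atlas M \<Longrightarrow> fst c \<subseteq> topspace (mtop M)"
  using chart_dom_open openin_subset by blast

lemma ex_chart: "p \<in> topspace (mtop M) \<Longrightarrow> \<exists>c. c \<in> charts_at M p"
  using covered unfolding charts_at_def by blast

lemma open_chart_image: "c \<in> atlas M \<Longrightarrow> open (snd c ` fst c)"
  by (rule chart_open_map[OF _ chart_dom_open]) auto

lemma open_chart_preimage:
  assumes "c \<in> atlas M" "openin (mtop M) U" shows "open {x \<in> snd c ` fst c. chart_inv c x \<in> U}"
proof -
  have "{x \<in> snd c ` fst c. chart_inv c x \<in> U} = snd c ` (fst c \<inter> U)"
    using assms by (auto simp: chart_inv_chart)
  then show ?thesis
    using chart_open_map[OF assms(1), of "fst c \<inter> U"] chart_dom_open[OF assms(1)] assms(2) by auto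
qed

end

sublocale smooth_manifold \<subseteq> charted
proof
  fix c assume c: "c \<in> atlas M"
  have top: "topspace (subtopology (mtop M) (fst c)) = fst c"
    using chart_open[OF c] openin_subset by fastforce
  show "openin (mtop M) (fst c)" by (rule chart_open[OF c])
  show "inj_on (snd c) (fst c)"
    using homeomorphic_imp_injective_map[OF chart_homeomorphic[OF c]] top by simp
  show "open (snd c ` U)" if "openin (mtop M) U" "U \<subseteq> fst c" for U
  proof -
    have "openin (subtopology (mtop M) (fst c)) U"
      using that by (simp add: openin_open_subtopology chart_open c)
    then have "openin (top_of_set (snd c ` fst c)) (snd c ` U)"
      using homeomorphic_imp_open_map[OF chart_homeomorphic[OF c]] by (simp add: open_map_def)
    then show ?thesis using chart_image_open[OF c] openin_open_eq by blast
  qed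
  show "openin (mtop M) {p \<in> fst c. snd c p \<in> V}" if "open V" for V
  proof -
    have "openin (top_of_set (snd c ` fst c)) (snd c ` fst c \<inter> V)"
      using that by (simp add: openin_open_Int)
    then have "openin (subtopology (mtop M) (fst c)) {p \<in> fst c. snd c p \<in> snd c ` fst c \<inter> V}"
      using openin_continuous_map_preimage[OF homeomorphic_imp_continuous_map[OF chart_homeomorphic[OF c]]] top
      by fastforce
    moreover have "{p \<in> fst c. snd c p \<in> snd c ` fst c \<inter> V} = {p \<in> fst c. snd c p \<in> V}" by auto
    ultimately show ?thesis by (simp add: openin_open_subtopology chart_open c)
  qed
  show "smooth_on (snd c ` (fst c \<inter> fst d)) (snd d \<circ> chart_inv c)" if "d \<in> atlas M" for d
    by (rule charts_compatible[OF c that])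
qed (simp add: charts_cover)

definition smooth_at :: "('a, 'e::euclidean_space) manifold \<Rightarrow> ('b, 'f::euclidean_space) manifold
    \<Rightarrow> ('a \<Rightarrow> 'b) \<Rightarrow> 'a \<Rightarrow> bool" where
  "smooth_at M N f p \<longleftrightarrow> (\<exists>c\<in>charts_at M p. \<exists>d\<in>charts_at N (f p). \<exists>U. openin (mtop M) U \<and> p \<in> U \<and>
     U \<subseteq> fst c \<and> f ` U \<subseteq> fst d \<and> smooth_on (snd c ` U) (snd d \<circ> f \<circ> chart_inv c))"

lemma smooth_map_at:
  assumes "charted M" "charted N" "smooth_map M N f" "p \<in> topspace (mtop M)"
  shows "smooth_at M N f p"
proof -
  interpret M: charted M by fact
  interpret N: charted N by fact
  obtain c d where cd: "c \<in> charts_at M p" "d \<in> charts_at N (f p)"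
    "smooth_on (snd c ` (fst c \<inter> f -` fst d)) (snd d \<circ> f \<circ> chart_inv c)"
    using assms(3,4) unfolding smooth_map_def by blast
  have "openin (mtop M) (fst c \<inter> {q \<in> topspace (mtop M). f q \<in> fst d})"
    using assms(3) M.chart_dom_open[OF M.charts_atD(1)[OF cd(1)]]
      N.chart_dom_open[OF N.charts_atD(1)[OF cd(2)]]
    by (auto simp: smooth_map_def intro!: openin_Int openin_continuous_map_preimage)
  moreover have "fst c \<inter> {q \<in> topspace (mtop M). f q \<in> fst d} = fst c \<inter> f -` fst d"
    using M.chart_dom_sub[OF M.charts_atD(1)[OF cd(1)]] by auto
  ultimately show ?thesis
    unfolding smooth_at_def using cd M.charts_atD N.charts_atD
    by (intro bexI[OF _ cd(1)] bexI[OF _ cd(2)] exI[of _ "fst c \<inter> f -` fst d"]) auto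
qed

lemma smooth_at_rep:
  assumes "charted M" "charted N" and f: "smooth_at M N f p"
    and c: "c \<in> charts_at M p" and d: "d \<in> charts_at N (f p)"
    and cont: "continuous_map (mtop M) (mtop N) f"
  obtains U where "openin (mtop M) U" "p \<in> U" "U \<subseteq> fst c" "f ` U \<subseteq> fst d"
    "smooth_on (snd c ` U) (snd d \<circ> f \<circ> chart_inv c)"
proof -
  interpret M: charted M by fact
  interpret N: charted N by fact
  note cA = M.charts_atD[OF c] and dA = N.charts_atD[OF d]
  obtain c' d' U where c': "c' \<in> charts_at M p" and d': "d' \<in> charts_at N (f p)"
    and U: "openin (mtop M) U" "p \<in> U" "U \<subseteq> fst c'" "f ` U \<subseteq> fst d'"
      "smooth_on (snd c' ` U) (snd d' \<circ> f \<circ> chart_inv c')"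
    using f unfolding smooth_at_def by blast
  note c'A = M.charts_atD[OF c'] and d'A = N.charts_atD[OF d']
  define W where "W = fst c \<inter> U \<inter> {q \<in> topspace (mtop M). f q \<in> fst d}"
  have W: "openin (mtop M) W"
    unfolding W_def
    by (intro openin_Int U openin_continuous_map_preimage[OF cont] M.chart_dom_open N.chart_dom_open cA dA)
  have pW: "p \<in> W" using U cA dA M.chart_dom_sub[OF cA(1)] by (auto simp: W_def)
  have sub: "W \<subseteq> fst c" "W \<subseteq> U" "W \<subseteq> fst c'" "f ` W \<subseteq> fst d" "f ` W \<subseteq> fst d'" using U by (auto simp: W_def)
  have oW: "open (snd c ` W)" by (rule M.chart_open_map[OF cA(1) W sub(1)])
  have oW': "open (snd c' ` W)" by (rule M.chart_open_map[OF c'A(1) W sub(3)])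
  have s1: "smooth_on (snd c ` W) (snd c' \<circ> chart_inv c)"
    by (rule smooth_on_subset[OF M.charts_smooth[OF cA(1) c'A(1)]]) (use sub in auto)
  have s2: "smooth_on (snd c' ` W) (snd d' \<circ> f \<circ> chart_inv c')"
    by (rule smooth_on_subset[OF U(5)]) (use sub in auto)
  have s3: "smooth_on (snd d' ` (fst d' \<inter> fst d)) (snd d \<circ> chart_inv d')"
    by (rule N.charts_smooth[OF d'A(1) dA(1)])
  have inv: "chart_inv c (snd c q) = q" "chart_inv c' (snd c' q) = q" "chart_inv d' (snd d' (f q)) = f q"
    if "q \<in> W" for q
    using that sub M.chart_inv_chart[OF cA(1)] M.chart_inv_chart[OF c'A(1)] N.chart_inv_chart[OF d'A(1)] by auto
  have "smooth_on (snd c ` W) (\<lambda>x. (snd d' \<circ> f \<circ> chart_inv c') ((snd c' \<circ> chart_inv c) x))"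
    by (rule smooth_on_compose[OF oW s1 s2]) (auto simp: inv)
  then have "smooth_on (snd c ` W)
    (\<lambda>x. (snd d \<circ> chart_inv d') ((snd d' \<circ> f \<circ> chart_inv c') ((snd c' \<circ> chart_inv c) x)))"
    by (rule smooth_on_compose[OF oW _ s3])
       (auto simp: inv intro!: imageI subsetD[OF sub(4)] subsetD[OF sub(5)])
  then have "smooth_on (snd c ` W) (snd d \<circ> f \<circ> chart_inv c)"
    by (rule smooth_on_cong[OF oW]) (auto simp: inv)
  then show thesis using that W pW sub by blast
qed

text \<open>By definition a smooth map is smooth in some pair of charts around each point.
  Compatibility of charts transfers this to an arbitrary pair.\<close>

lemma smooth_rep:
  assumes M: "charted M" and N: "charted N" and f: "smooth_map M N f"
    and c: "c \<in> atlas M" and d: "d \<in> atlas N"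
  shows "open (snd c ` (fst c \<inter> f -` fst d))" "smooth_on (snd c ` (fst c \<inter> f -` fst d)) (snd d \<circ> f \<circ> chart_inv c)"
proof -
  interpret M: charted M by fact
  interpret N: charted N by fact
  have cont: "continuous_map (mtop M) (mtop N) f" using f by (simp add: smooth_map_def)
  have eq: "fst c \<inter> f -` fst d = fst c \<inter> {q \<in> topspace (mtop M). f q \<in> fst d}"
    using M.chart_dom_sub[OF c] by auto
  show "open (snd c ` (fst c \<inter> f -` fst d))" unfolding eq
    by (intro M.chart_open_map[OF c] openin_Int openin_continuous_map_preimage[OF cont] M.chart_dom_open
        N.chart_dom_open c d) auto
  show "smooth_on (snd c ` (fst c \<inter> f -` fst d)) (snd d \<circ> f \<circ> chart_inv c)"
  proof (rule smooth_on_local)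
    fix x assume "x \<in> snd c ` (fst c \<inter> f -` fst d)"
    then obtain p where p: "p \<in> fst c" "f p \<in> fst d" "x = snd c p" by auto
    then have "c \<in> charts_at M p" "d \<in> charts_at N (f p)" using c d by (auto simp: charts_at_def)
    moreover have "smooth_at M N f p"
      using smooth_map_at[OF M N f] p M.chart_dom_sub[OF c] by auto
    ultimately obtain U where "openin (mtop M) U" "p \<in> U" "U \<subseteq> fst c" "f ` U \<subseteq> fst d"
      "smooth_on (snd c ` U) (snd d \<circ> f \<circ> chart_inv c)"
      using smooth_at_rep[OF M N _ _ _ cont] by blast
    then show "\<exists>U. open U \<and> x \<in> U \<and> smooth_on U (snd d \<circ> f \<circ> chart_inv c)"
      using M.chart_open_map[OF c] p by blast
  qed
qed

lemma smooth_mapI: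
  assumes M: "charted M" and N: "charted N" and cont: "continuous_map (mtop M) (mtop N) f"
    and f: "\<And>p. p \<in> topspace (mtop M) \<Longrightarrow> smooth_at M N f p"
  shows "smooth_map M N f"
  unfolding smooth_map_def
proof (intro conjI ballI cont)
  interpret M: charted M by fact
  interpret N: charted N by fact
  fix p assume p: "p \<in> topspace (mtop M)"
  obtain c where c: "c \<in> charts_at M p" using M.ex_chart[OF p] by auto
  obtain d where d: "d \<in> charts_at N (f p)"
    using N.ex_chart[of "f p"] cont p by (auto simp: continuous_map_def)
  show "\<exists>c\<in>charts_at M p. \<exists>d\<in>charts_at N (f p). smooth_on (snd c ` (fst c \<inter> f -` fst d)) (snd d \<circ> f \<circ> chart_inv c)"
  proof (intro bexI[OF _ c] bexI[OF _ d] smooth_on_local)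
    note cA = M.charts_atD[OF c] and dA = N.charts_atD[OF d]
    fix x assume "x \<in> snd c ` (fst c \<inter> f -` fst d)"
    then obtain q where q: "q \<in> fst c" "f q \<in> fst d" "x = snd c q" by auto
    then have "c \<in> charts_at M q" "d \<in> charts_at N (f q)" using cA dA by (auto simp: charts_at_def)
    moreover have "smooth_at M N f q"
      using f q M.chart_dom_sub[OF cA(1)] by auto
    ultimately obtain U where "openin (mtop M) U" "q \<in> U" "U \<subseteq> fst c" "f ` U \<subseteq> fst d"
      "smooth_on (snd c ` U) (snd d \<circ> f \<circ> chart_inv c)"
      using smooth_at_rep[OF M N _ _ _ cont] by blast
    then show "\<exists>U. open U \<and> x \<in> U \<and> smooth_on U (snd d \<circ> f \<circ> chart_inv c)"
      using M.chart_open_map[OF cA(1)] q by blast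
  qed
qed

lemma smooth_map_compose:
  assumes M: "charted M" and N: "charted N" and K: "charted K"
    and f: "smooth_map M N f" and g: "smooth_map N K g"
  shows "smooth_map M K (g \<circ> f)"
proof (rule smooth_mapI[OF M K])
  interpret M: charted M by fact
  interpret N: charted N by fact
  interpret K: charted K by fact
  have cf: "continuous_map (mtop M) (mtop N) f" and cg: "continuous_map (mtop N) (mtop K) g"
    using f g by (auto simp: smooth_map_def)
  show "continuous_map (mtop M) (mtop K) (g \<circ> f)" by (rule continuous_map_compose[OF cf cg])
  fix p assume p: "p \<in> topspace (mtop M)"
  have fp: "f p \<in> topspace (mtop N)" "g (f p) \<in> topspace (mtop K)"
    using p cf cg by (auto simp: continuous_map_def)
  obtain c d e where c: "c \<in> charts_at M p" and d: "d \<in> charts_at N (f p)" and e: "e \<in> charts_at K (g (f p))"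
    using M.ex_chart[OF p] N.ex_chart[OF fp(1)] K.ex_chart[OF fp(2)] by blast
  note cA = M.charts_atD[OF c] and dA = N.charts_atD[OF d] and eA = K.charts_atD[OF e]
  define W where "W = fst c \<inter> {q \<in> topspace (mtop M). f q \<in> fst d} \<inter> {q \<in> topspace (mtop M). (g \<circ> f) q \<in> fst e}"
  have W: "openin (mtop M) W" unfolding W_def
    by (intro openin_Int openin_continuous_map_preimage[OF cf]
        openin_continuous_map_preimage[OF continuous_map_compose[OF cf cg]]
        M.chart_dom_open N.chart_dom_open K.chart_dom_open cA dA eA)
  have oW: "open (snd c ` W)" by (rule M.chart_open_map[OF cA(1) W]) (auto simp: W_def)
  have s1: "smooth_on (snd c ` W) (snd d \<circ> f \<circ> chart_inv c)"
    by (rule smooth_on_subset[OF smooth_rep(2)[OF M N f cA(1) dA(1)]]) (auto simp: W_def)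
  have inv: "chart_inv c (snd c q) = q" "chart_inv d (snd d (f q)) = f q" if "q \<in> W" for q
    using that M.chart_inv_chart[OF cA(1)] N.chart_inv_chart[OF dA(1)] by (auto simp: W_def)
  have "smooth_on (snd c ` W) (\<lambda>x. (snd e \<circ> g \<circ> chart_inv d) ((snd d \<circ> f \<circ> chart_inv c) x))"
    by (rule smooth_on_compose[OF oW s1 smooth_rep(2)[OF N K g dA(1) eA(1)]])
       (auto simp: inv, auto simp: W_def)
  then have "smooth_on (snd c ` W) (snd e \<circ> (g \<circ> f) \<circ> chart_inv c)"
    by (rule smooth_on_cong[OF oW]) (auto simp: inv)
  moreover have "p \<in> W" using p cA dA eA by (auto simp: W_def)
  ultimately show "smooth_at M K (g \<circ> f) p"
    unfolding smooth_at_def using c d e W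
    by (intro bexI[OF _ c] bexI[of _ e] exI[of _ W]) (auto simp: W_def)
qed

definition prod_chart :: "('a, 'e) chart \<Rightarrow> ('b, 'f) chart \<Rightarrow> ('a \<times> 'b, 'e \<times> 'f) chart" where
  "prod_chart c d = (fst c \<times> fst d, map_prod (snd c) (snd d))"

lemma atlas_prod: "atlas (prod_manifold M N) = {prod_chart c d |c d. c \<in> atlas M \<and> d \<in> atlas N}"
  unfolding prod_manifold_def prod_chart_def by force

lemma mtop_prod: "mtop (prod_manifold M N) = prod_topology (mtop M) (mtop N)"
  by (simp add: prod_manifold_def)

lemma prod_chart_simps [simp]: "fst (prod_chart c d) = fst c \<times> fst d"
  "snd (prod_chart c d) (p, q) = (snd c p, snd d q)"
  by (auto simp: prod_chart_def)

lemma prod_chart_inv: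
  assumes "charted M" "charted N" "c \<in> atlas M" "d \<in> atlas N" "x \<in> snd c ` fst c" "y \<in> snd d ` fst d"
  shows "chart_inv (prod_chart c d) (x, y) = (chart_inv c x, chart_inv d y)"
proof -
  interpret M: charted M by fact
  interpret N: charted N by fact
  have "inj_on (snd (prod_chart c d)) (fst (prod_chart c d))"
    using M.chart_inj[OF assms(3)] N.chart_inj[OF assms(4)] by (auto simp: inj_on_def)
  moreover obtain p q where pq: "p \<in> fst c" "q \<in> fst d" "x = snd c p" "y = snd d q"
    using assms(5,6) by auto
  ultimately have "inv_into (fst (prod_chart c d)) (snd (prod_chart c d)) (snd (prod_chart c d) (p, q)) = (p, q)"
    by (intro inv_into_f_f) auto
  then show ?thesis
    using pq M.chart_inv_chart[OF assms(3)] N.chart_inv_chart[OF assms(4)]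
    by (simp add: chart_inv_def[of "prod_chart c d"])
qed

lemma charted_prod:
  assumes M: "charted M" and N: "charted N" shows "charted (prod_manifold M N)"
proof
  interpret M: charted M by fact
  interpret N: charted N by fact
  fix c assume "c \<in> atlas (prod_manifold M N)"
  then obtain c1 c2 where c: "c = prod_chart c1 c2" "c1 \<in> atlas M" "c2 \<in> atlas N"
    by (auto simp: atlas_prod)
  show "openin (mtop (prod_manifold M N)) (fst c)"
    using c M.chart_dom_open N.chart_dom_open by (simp add: mtop_prod openin_prod_Times_iff)
  show "inj_on (snd c) (fst c)"
    using M.chart_inj[OF c(2)] N.chart_inj[OF c(3)] by (auto simp: inj_on_def c)
  show "open (snd c ` U)" if U: "openin (mtop (prod_manifold M N)) U" "U \<subseteq> fst c" for U
  proof (subst open_subopen, intro ballI)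
    fix z assume "z \<in> snd c ` U"
    then obtain p q where pq: "(p, q) \<in> U" "z = (snd c1 p, snd c2 q)" using c by auto
    have "\<exists>A B. openin (mtop M) A \<and> openin (mtop N) B \<and> p \<in> A \<and> q \<in> B \<and> A \<times> B \<subseteq> U"
      using U(1) pq(1) unfolding mtop_prod openin_prod_topology_alt by simp
    then obtain A B where AB: "openin (mtop M) A" "openin (mtop N) B" "p \<in> A" "q \<in> B" "A \<times> B \<subseteq> U"
      by blast
    then have "A \<subseteq> fst c1" "B \<subseteq> fst c2" using U(2) c by auto
    then have o: "open (snd c1 ` A \<times> snd c2 ` B)"
      using M.chart_open_map N.chart_open_map AB c by (simp add: open_Times)
    have "snd c1 ` A \<times> snd c2 ` B \<subseteq> snd c ` U" using AB c by force
    then show "\<exists>T. open T \<and> z \<in> T \<and> T \<subseteq> snd c ` U" using o pq AB by blast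
  qed
  show "openin (mtop (prod_manifold M N)) {p \<in> fst c. snd c p \<in> V}" if V: "open V" for V
    unfolding mtop_prod openin_prod_topology_alt
  proof (intro allI impI)
    fix p q assume pq: "(p, q) \<in> {p \<in> fst c. snd c p \<in> V}"
    then have "(snd c1 p, snd c2 q) \<in> V" by (simp add: c)
    then obtain A B where AB: "open A" "open B" "snd c1 p \<in> A" "snd c2 q \<in> B" "A \<times> B \<subseteq> V"
      using open_prod_elim[OF V] by (metis mem_Sigma_iff)
    then show "\<exists>U W. openin (mtop M) U \<and> openin (mtop N) W \<and> p \<in> U \<and> q \<in> W \<and> U \<times> W \<subseteq> {p \<in> fst c. snd c p \<in> V}"
      using M.chart_cont[OF c(2) AB(1)] N.chart_cont[OF c(3) AB(2)] pq c by (intro exI conjI) auto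
  qed
  fix d assume "d \<in> atlas (prod_manifold M N)"
  then obtain d1 d2 where d: "d = prod_chart d1 d2" "d1 \<in> atlas M" "d2 \<in> atlas N"
    by (auto simp: atlas_prod)
  let ?A = "snd c1 ` (fst c1 \<inter> fst d1)" and ?B = "snd c2 ` (fst c2 \<inter> fst d2)"
  have dom: "snd c ` (fst c \<inter> fst d) = ?A \<times> ?B" using c d by force
  have oA: "open ?A" by (intro M.chart_open_map c openin_Int M.chart_dom_open d) auto
  have oB: "open ?B" by (intro N.chart_open_map c openin_Int N.chart_dom_open d) auto
  have o: "open (?A \<times> ?B)" by (rule open_Times[OF oA oB])
  have "smooth_on (?A \<times> ?B) (\<lambda>z. ((snd d1 \<circ> chart_inv c1) (fst z), (snd d2 \<circ> chart_inv c2) (snd z)))"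
    by (intro smooth_on_Pair o
        smooth_on_compose[OF o smooth_on_linear[OF bounded_linear_fst o] M.charts_smooth[OF c(2) d(2)]]
        smooth_on_compose[OF o smooth_on_linear[OF bounded_linear_snd o] N.charts_smooth[OF c(3) d(3)]]) auto
  then show "smooth_on (snd c ` (fst c \<inter> fst d)) (snd d \<circ> chart_inv c)"
    unfolding dom
    by (rule smooth_on_cong[OF o]) (use c d in \<open>auto simp: prod_chart_inv[OF M N c(2,3)]\<close>)
next
  interpret M: charted M by fact
  interpret N: charted N by fact
  show "topspace (mtop (prod_manifold M N)) \<subseteq> (\<Union>c\<in>atlas (prod_manifold M N). fst c)"
  proof
    fix z assume "z \<in> topspace (mtop (prod_manifold M N))"
    then have z: "fst z \<in> topspace (mtop M)" "snd z \<in> topspace (mtop N)" by (auto simp: mtop_prod)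
    obtain c d where "c \<in> charts_at M (fst z)" "d \<in> charts_at N (snd z)"
      using M.ex_chart[OF z(1)] N.ex_chart[OF z(2)] by blast
    then have "prod_chart c d \<in> atlas (prod_manifold M N)" "z \<in> fst (prod_chart c d)"
      unfolding atlas_prod charts_at_def mem_Times_iff prod_chart_simps(1) by blast+
    then show "z \<in> (\<Union>c\<in>atlas (prod_manifold M N). fst c)" by blast
  qed
qed

lemma chart_inv_id: "chart_inv (UNIV, id) = id"
  by (simp add: chart_inv_def)

lemma euclidean_manifold_simps: "mtop euclidean_manifold = euclidean" "atlas euclidean_manifold = {(UNIV, id)}"
  by (simp_all add: euclidean_manifold_def)

lemma charted_euclidean: "charted (euclidean_manifold :: ('e::euclidean_space, 'e) manifold)"
proof -
  have "smooth_on UNIV (id :: 'e \<Rightarrow> 'e)"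
    using smooth_on_ident[of "UNIV :: 'e set"] by (simp add: id_def)
  then show ?thesis
    by unfold_locales (auto simp: euclidean_manifold_simps chart_inv_id)
qed

section \<open>Lie groups in a chart around the identity\<close>

lemma tangent_map_has_derivative:
  assumes M: "charted M" and N: "charted N" and f: "smooth_map M N f"
    and c: "c \<in> charts_at M p" and d: "d \<in> charts_at N (f p)"
  shows "((snd d \<circ> f \<circ> chart_inv c) has_derivative tangent_map c d f p) (at (snd c p))"
  unfolding tangent_map_def
  by (rule smooth_on_has_derivative[OF smooth_rep(2)[OF M N f]])
     (use charted.charts_atD[OF M c] charted.charts_atD[OF N d] in auto)

lemma prod_chart_atlas: "c \<in> atlas M \<Longrightarrow> d \<in> atlas N \<Longrightarrow> prod_chart c d \<in> atlas (prod_manifold M N)"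
  unfolding atlas_prod by blast

text \<open>A product rule for a family of linear maps known to be differentiable only when
  evaluated at fixed vectors; a basis reduces it to finitely many such vectors.\<close>

lemma has_derivative_family_apply:
  fixes F :: "'a::real_normed_vector \<Rightarrow> 'b::euclidean_space \<Rightarrow> 'c::real_normed_vector"
  assumes S: "open S" "x0 \<in> S" and lin: "\<And>x. x \<in> S \<Longrightarrow> linear (F x)"
    and F: "\<And>v. ((\<lambda>x. F x v) has_derivative F' v) (at x0)" and w: "(w has_derivative w') (at x0)"
  shows "((\<lambda>x. F x (w x)) has_derivative (\<lambda>y. F' (w x0) y + F x0 (w' y))) (at x0)"
proof -
  have expand: "F x v = (\<Sum>b\<in>Basis. (v \<bullet> b) *\<^sub>R F x b)" if "x \<in> S" for x v
    by (subst euclidean_representation[of v, symmetric])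
       (simp add: linear_sum[OF lin[OF that]] linear_scale[OF lin[OF that]])
  have "((\<lambda>x. \<Sum>b\<in>Basis. (w x \<bullet> b) *\<^sub>R F x b) has_derivative
      (\<lambda>y. \<Sum>b\<in>Basis. (w x0 \<bullet> b) *\<^sub>R F' b y + (w' y \<bullet> b) *\<^sub>R F x0 b)) (at x0)"
    by (intro has_derivative_sum has_derivative_scaleR has_derivative_inner_left w F)
  then have 1: "((\<lambda>x. F x (w x)) has_derivative
      (\<lambda>y. \<Sum>b\<in>Basis. (w x0 \<bullet> b) *\<^sub>R F' b y + (w' y \<bullet> b) *\<^sub>R F x0 b)) (at x0)"
    by (rule has_derivative_transform_within_open[OF _ S]) (simp add: expand)
  have "((\<lambda>x. \<Sum>b\<in>Basis. (w x0 \<bullet> b) *\<^sub>R F x b) has_derivative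
      (\<lambda>y. \<Sum>b\<in>Basis. (w x0 \<bullet> b) *\<^sub>R F' b y)) (at x0)"
    by (intro has_derivative_sum has_derivative_scaleR_right F)
  then have "((\<lambda>x. F x (w x0)) has_derivative (\<lambda>y. \<Sum>b\<in>Basis. (w x0 \<bullet> b) *\<^sub>R F' b y)) (at x0)"
    by (rule has_derivative_transform_within_open[OF _ S]) (simp add: expand)
  then have "F' (w x0) = (\<lambda>y. \<Sum>b\<in>Basis. (w x0 \<bullet> b) *\<^sub>R F' b y)"
    using has_derivative_unique[OF F] by blast
  then show ?thesis
    using 1 by (simp add: sum.distrib expand[OF S(2), symmetric])
qed

context lie_group
begin

lemma charted_M: "charted M" by unfold_locales

lemma charted_MM: "charted (prod_manifold M M)" by (rule charted_prod[OF charted_M charted_M])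

lemma in_carrier: "c \<in> atlas M \<Longrightarrow> p \<in> fst c \<Longrightarrow> p \<in> carrier G"
  using chart_dom_sub topspace_eq_carrier by blast

lemma smooth_pair_const:
  assumes a: "a \<in> carrier G"
  shows "smooth_map M (prod_manifold M M) (\<lambda>x. (a, x))" "smooth_map M (prod_manifold M M) (\<lambda>x. (x, a))"
proof -
  have a': "a \<in> topspace (mtop M)" using a topspace_eq_carrier by simp
  obtain ca where ca: "ca \<in> charts_at M a" using ex_chart[OF a'] by blast
  note caA = charts_atD[OF ca]
  have smooth: "smooth_at M (prod_manifold M M) (\<lambda>x. (a, x)) p" "smooth_at M (prod_manifold M M) (\<lambda>x. (x, a)) p"
    if p: "p \<in> topspace (mtop M)" for p
  proof -
    obtain c where c: "c \<in> charts_at M p" using ex_chart[OF p] by blast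
    note cA = charts_atD[OF c]
    have pc: "prod_chart ca c \<in> charts_at (prod_manifold M M) (a, p)" "prod_chart c ca \<in> charts_at (prod_manifold M M) (p, a)"
      using caA cA prod_chart_atlas by (simp_all add: charts_at_def)
    have o: "open (snd c ` fst c)" by (rule open_chart_image[OF cA(1)])
    have s: "smooth_on (snd c ` fst c) (\<lambda>x. (snd ca a, x))" "smooth_on (snd c ` fst c) (\<lambda>x. (x, snd ca a))"
      by (intro smooth_on_Pair o smooth_on_const smooth_on_ident)+
    have "smooth_on (snd c ` fst c) (snd (prod_chart ca c) \<circ> (\<lambda>x. (a, x)) \<circ> chart_inv c)"
      "smooth_on (snd c ` fst c) (snd (prod_chart c ca) \<circ> (\<lambda>x. (x, a)) \<circ> chart_inv c)"
      by (rule smooth_on_cong[OF o s(1)] smooth_on_cong[OF o s(2)]; simp add: chart_chart_inv)+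
    then show "smooth_at M (prod_manifold M M) (\<lambda>x. (a, x)) p" "smooth_at M (prod_manifold M M) (\<lambda>x. (x, a)) p"
      unfolding smooth_at_def using caA cA chart_dom_open[OF cA(1)]
      by (intro bexI[OF _ c] bexI[OF _ pc(1)] bexI[OF _ pc(2)] exI[of _ "fst c"]; auto)+
  qed
  show "smooth_map M (prod_manifold M M) (\<lambda>x. (a, x))" "smooth_map M (prod_manifold M M) (\<lambda>x. (x, a))"
    by (intro smooth_mapI charted_M charted_MM smooth; (simp add: mtop_prod continuous_map_pairedI a')?)+
qed

lemma smooth_left: "a \<in> carrier G \<Longrightarrow> smooth_map M M (\<lambda>x. a \<otimes> x)"
  and smooth_right: "a \<in> carrier G \<Longrightarrow> smooth_map M M (\<lambda>x. x \<otimes> a)"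
  using smooth_map_compose[OF charted_M charted_MM charted_M smooth_pair_const(1) smooth_mult]
    smooth_map_compose[OF charted_M charted_MM charted_M smooth_pair_const(2) smooth_mult]
  by (simp_all add: o_def)

lemma smooth_conj: "a \<in> carrier G \<Longrightarrow> smooth_map M M (\<lambda>x. a \<otimes> x \<otimes> inv a)"
  using smooth_map_compose[OF charted_M charted_M charted_M smooth_left smooth_right[of "inv a"], of a]
  by (simp add: o_def)

end

text \<open>The calculus on the group takes place in one chart at the identity. There
  \<open>mu\<close> is the multiplication, defined on the open set \<open>mu_dom\<close>, and the
  left-invariant fields are its partial derivatives in the second argument at
  \<open>e\<close>.\<close>

locale lie_chart = lie_group G M for G :: "('g, 'm) monoid_scheme" (structure)
    and M :: "('g, 'e::euclidean_space) manifold" +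
  fixes c :: "('g, 'e) chart"
  assumes c: "c \<in> charts_at M \<one>"
begin

abbreviation "\<phi> \<equiv> snd c"
abbreviation "\<psi> \<equiv> chart_inv c"
abbreviation "e \<equiv> \<phi> \<one>"
definition "\<Omega> = \<phi> ` fst c"
definition "mu z = \<phi> (\<psi> (fst z) \<otimes> \<psi> (snd z))"
definition "mu_dom = {z \<in> \<Omega> \<times> \<Omega>. \<psi> (fst z) \<otimes> \<psi> (snd z) \<in> fst c}"

lemmas cA = charts_atD[OF c]

lemma open_Omega: "open \<Omega>" unfolding \<Omega>_def by (rule open_chart_image[OF cA(1)])

lemma e_Omega: "e \<in> \<Omega>" using cA by (auto simp: \<Omega>_def)

lemma psi_phi: "p \<in> fst c \<Longrightarrow> \<psi> (\<phi> p) = p" by (rule chart_inv_chart[OF cA(1)])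

lemma phi_psi: "x \<in> \<Omega> \<Longrightarrow> \<phi> (\<psi> x) = x" "x \<in> \<Omega> \<Longrightarrow> \<psi> x \<in> fst c" "x \<in> \<Omega> \<Longrightarrow> \<psi> x \<in> carrier G"
  using chart_chart_inv[of x c] in_carrier[OF cA(1)] by (auto simp: \<Omega>_def)

lemma phi_Omega: "p \<in> fst c \<Longrightarrow> \<phi> p \<in> \<Omega>" by (simp add: \<Omega>_def)

lemma psi_e [simp]: "\<psi> e = \<one>" by (rule psi_phi[OF cA(2)])

lemma open_psi_preimage: "openin (mtop M) U \<Longrightarrow> open {x \<in> \<Omega>. \<psi> x \<in> U}"
  unfolding \<Omega>_def by (rule open_chart_preimage[OF cA(1)])

lemma mu_dom_eq: "snd (prod_chart c c) ` (fst (prod_chart c c) \<inter> (\<lambda>(x, y). x \<otimes> y) -` fst c) = mu_dom"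
proof (intro equalityI subsetI)
  fix z assume "z \<in> snd (prod_chart c c) ` (fst (prod_chart c c) \<inter> (\<lambda>(x, y). x \<otimes> y) -` fst c)"
  then obtain p q where "p \<in> fst c" "q \<in> fst c" "p \<otimes> q \<in> fst c" "z = (\<phi> p, \<phi> q)" by auto
  then show "z \<in> mu_dom" by (simp add: mu_dom_def psi_phi phi_Omega)
next
  fix z assume "z \<in> mu_dom"
  then obtain x y where z: "z = (x, y)" "x \<in> \<Omega>" "y \<in> \<Omega>" "\<psi> x \<otimes> \<psi> y \<in> fst c"
    by (auto simp: mu_dom_def)
  show "z \<in> snd (prod_chart c c) ` (fst (prod_chart c c) \<inter> (\<lambda>(x, y). x \<otimes> y) -` fst c)"
    by (rule image_eqI[of _ _ "(\<psi> x, \<psi> y)"]) (use z in \<open>auto simp: phi_psi\<close>)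
qed

lemma pc: "prod_chart c c \<in> atlas (prod_manifold M M)"
  using cA unfolding atlas_prod by blast

lemma open_mu_dom: "open mu_dom"
  using smooth_rep(1)[OF charted_MM charted_M smooth_mult pc cA(1)] unfolding mu_dom_eq .

lemma smooth_mu: "smooth_on mu_dom mu"
proof (rule smooth_on_cong[OF open_mu_dom])
  show "smooth_on mu_dom (\<phi> \<circ> (\<lambda>(x, y). x \<otimes> y) \<circ> chart_inv (prod_chart c c))"
    using smooth_rep(2)[OF charted_MM charted_M smooth_mult pc cA(1)] unfolding mu_dom_eq .
  fix z assume "z \<in> mu_dom"
  then show "(\<phi> \<circ> (\<lambda>(x, y). x \<otimes> y) \<circ> chart_inv (prod_chart c c)) z = mu z"
    by (cases z) (simp add: mu_dom_def mu_def \<Omega>_def prod_chart_inv[OF charted_M charted_M cA(1) cA(1)])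
qed

lemma mu_deriv: "z \<in> mu_dom \<Longrightarrow> (mu has_derivative frechet_derivative mu (at z)) (at z)"
  by (rule smooth_on_has_derivative[OF smooth_mu])

lemma mu_dom_e: "x \<in> \<Omega> \<Longrightarrow> (x, e) \<in> mu_dom" "x \<in> \<Omega> \<Longrightarrow> (e, x) \<in> mu_dom"
  by (simp_all add: mu_dom_def e_Omega phi_psi)

lemma mu_e: "x \<in> \<Omega> \<Longrightarrow> mu (x, e) = x" "x \<in> \<Omega> \<Longrightarrow> mu (e, x) = x"
  by (simp_all add: mu_def phi_psi)

lemma mu_dom_Omega: "z \<in> mu_dom \<Longrightarrow> mu z \<in> \<Omega>" "z \<in> mu_dom \<Longrightarrow> \<psi> (mu z) = \<psi> (fst z) \<otimes> \<psi> (snd z)"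
  "z \<in> mu_dom \<Longrightarrow> fst z \<in> \<Omega>" "z \<in> mu_dom \<Longrightarrow> snd z \<in> \<Omega>"
  by (auto simp: mu_dom_def mu_def phi_Omega psi_phi)

lemma mu_deriv_right:
  assumes "(x, y) \<in> mu_dom"
  shows "((\<lambda>y. mu (x, y)) has_derivative (\<lambda>v. frechet_derivative mu (at (x, y)) (0, v))) (at y)"
  by (rule has_derivative_compose[where f = "\<lambda>y. (x, y)", OF _ mu_deriv[OF assms]])
     (auto intro!: derivative_eq_intros)

lemma mu_deriv_left:
  assumes "(x, y) \<in> mu_dom"
  shows "((\<lambda>x. mu (x, y)) has_derivative (\<lambda>v. frechet_derivative mu (at (x, y)) (v, 0))) (at x)"
  by (rule has_derivative_compose[where f = "\<lambda>x. (x, y)", OF _ mu_deriv[OF assms]])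
     (auto intro!: derivative_eq_intros)

abbreviation "lfield \<equiv> left_invariant_field G c"

lemma lfield_eq: assumes "x \<in> \<Omega>" shows "lfield X x = frechet_derivative mu (at (x, e)) (0, X)"
proof -
  have "\<phi> \<circ> (\<lambda>y. \<psi> x \<otimes> y) \<circ> \<psi> = (\<lambda>y. mu (x, y))" by (auto simp: mu_def)
  then show ?thesis
    unfolding left_invariant_field_def tangent_map_def
    using frechet_derivativeI[OF mu_deriv_right[OF mu_dom_e(1)[OF assms]]] by simp
qed

lemma smooth_lfield: "smooth_on \<Omega> (lfield X)"
proof (rule smooth_on_cong[OF open_Omega])
  show "smooth_on \<Omega> (\<lambda>x. frechet_derivative mu (at (x, e)) (0, X))"
    by (rule smooth_on_compose[OF open_Omega _ smooth_on_frechet[OF smooth_mu, of "(0, X)"]])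
       (auto intro!: smooth_on_Pair smooth_on_ident smooth_on_const open_Omega mu_dom_e)
qed (simp add: lfield_eq)

lemma lfield_deriv: "x \<in> \<Omega> \<Longrightarrow> (lfield X has_derivative frechet_derivative (lfield X) (at x)) (at x)"
  by (rule smooth_on_has_derivative[OF smooth_lfield])

lemma mu_fst_snd_at_e: "frechet_derivative mu (at (e, e)) (0, X) = X" "frechet_derivative mu (at (e, e)) (X, 0) = X"
proof -
  have "((\<lambda>y. mu (e, y)) has_derivative (\<lambda>v. v)) (at e)" "((\<lambda>x. mu (x, e)) has_derivative (\<lambda>v. v)) (at e)"
    by (rule has_derivative_transform_within_open[OF has_derivative_ident open_Omega e_Omega]; simp add: mu_e)+
  then show "frechet_derivative mu (at (e, e)) (0, X) = X" "frechet_derivative mu (at (e, e)) (X, 0) = X"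
    using has_derivative_unique[OF mu_deriv_right[OF mu_dom_e(1)[OF e_Omega]]]
      has_derivative_unique[OF mu_deriv_left[OF mu_dom_e(1)[OF e_Omega]]] by metis+
qed

lemma lfield_e: "lfield X e = X"
  by (simp add: lfield_eq e_Omega mu_fst_snd_at_e)

text \<open>Associativity, differentiated in the third factor at the identity.\<close>

lemma lfield_invariant:
  assumes xy: "(x, y) \<in> mu_dom"
  shows "frechet_derivative mu (at (x, y)) (0, lfield X y) = lfield X (mu (x, y))"
proof -
  note y = mu_dom_Omega(4)[OF xy, simplified] and x = mu_dom_Omega(3)[OF xy, simplified]
  let ?U = "(\<lambda>z. (y, z)) -` mu_dom"
  have oU: "open ?U" by (intro open_vimage open_mu_dom continuous_intros)
  have eU: "e \<in> ?U" using mu_dom_e[OF y] by simp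
  have "((\<lambda>z. mu (x, mu (y, z))) has_derivative
      (\<lambda>v. frechet_derivative mu (at (x, y)) (0, frechet_derivative mu (at (y, e)) (0, v)))) (at e)"
    by (rule has_derivative_compose[where f = "\<lambda>z. mu (y, z)", OF mu_deriv_right[OF mu_dom_e(1)[OF y]]])
       (simp add: mu_e y mu_deriv_right[OF xy])
  moreover have "((\<lambda>z. mu (x, mu (y, z))) has_derivative
      (\<lambda>v. frechet_derivative mu (at (mu (x, y), e)) (0, v))) (at e)"
  proof (rule has_derivative_transform_within_open[OF mu_deriv_right[OF mu_dom_e(1)[OF mu_dom_Omega(1)[OF xy]]] oU eU])
    fix z assume "z \<in> ?U"
    then have z: "(y, z) \<in> mu_dom" by simp
    then have "z \<in> \<Omega>" using mu_dom_Omega(4) by fastforce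
    then show "mu (mu (x, y), z) = mu (x, mu (y, z))"
      using mu_dom_Omega(2)[OF xy] mu_dom_Omega(2)[OF z] x y
      by (simp add: mu_def[of "(mu (x, y), z)"] mu_def[of "(x, mu (y, z))"] m_assoc phi_psi)
  qed
  ultimately show ?thesis
    using lfield_eq[OF y] lfield_eq[OF mu_dom_Omega(1)[OF xy]] has_derivative_unique by metis
qed

end

section \<open>Conjugation and the adjoint representation in coordinates\<close>

context lie_chart
begin

abbreviation "cj g x \<equiv> g \<otimes> x \<otimes> inv g"
definition "cjl g x = \<phi> (cj g (\<psi> x))"
definition "cj_dom g = {x \<in> \<Omega>. cj g (\<psi> x) \<in> fst c}"
definition "Adl g = tangent_map c c (\<lambda>x. cj g x) \<one>"

lemma cj_mult: "g \<in> carrier G \<Longrightarrow> x \<in> carrier G \<Longrightarrow> y \<in> carrier G \<Longrightarrow> cj g (x \<otimes> y) = cj g x \<otimes> cj g y"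
  by (simp add: m_assoc inv_solve_left)

lemma cj_comp:
  assumes "g \<in> carrier G" "k \<in> carrier G" "x \<in> carrier G"
  shows "cj (g \<otimes> k) x = cj g (cj k x)"
  using assms by (simp add: m_assoc inv_mult_group)

lemma cj_dom_image: "\<phi> ` (fst c \<inter> (\<lambda>x. cj g x) -` fst c) = cj_dom g"
  unfolding cj_dom_def \<Omega>_def by (auto simp: psi_phi)

lemma open_cj_dom: "g \<in> carrier G \<Longrightarrow> open (cj_dom g)"
  using smooth_rep(1)[OF charted_M charted_M smooth_conj cA(1) cA(1)] unfolding cj_dom_image .

lemma smooth_cjl: "g \<in> carrier G \<Longrightarrow> smooth_on (cj_dom g) (cjl g)"
  using smooth_rep(2)[OF charted_M charted_M smooth_conj cA(1) cA(1)] unfolding cj_dom_image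
  by (simp add: cjl_def[abs_def] o_def)

lemma e_cj_dom: "g \<in> carrier G \<Longrightarrow> e \<in> cj_dom g"
  by (simp add: cj_dom_def e_Omega cA)

lemma cjl_e: "g \<in> carrier G \<Longrightarrow> cjl g e = e" by (simp add: cjl_def)

lemma Adl_eq: "Adl g = frechet_derivative (cjl g) (at e)"
  by (simp add: Adl_def tangent_map_def cjl_def[abs_def] o_def)

lemma Adl_deriv: "g \<in> carrier G \<Longrightarrow> (cjl g has_derivative Adl g) (at e)"
  unfolding Adl_eq by (rule smooth_on_has_derivative[OF smooth_cjl e_cj_dom])

lemma linear_Adl: "g \<in> carrier G \<Longrightarrow> linear (Adl g)"
  using Adl_deriv has_derivative_linear by blast

lemma Ad_apply: "g \<in> carrier G \<Longrightarrow> blinfun_apply (Ad G c g) = Adl g"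
  using has_derivative_bounded_linear[OF Adl_deriv]
  by (simp add: Ad_def Adl_def bounded_linear_Blinfun_apply)

lemma cjl_Omega: "x \<in> cj_dom g \<Longrightarrow> x \<in> \<Omega>" "x \<in> cj_dom g \<Longrightarrow> cjl g x \<in> \<Omega>"
  "x \<in> cj_dom g \<Longrightarrow> \<psi> (cjl g x) = cj g (\<psi> x)"
  by (auto simp: cj_dom_def cjl_def phi_Omega psi_phi)

lemma Adl_mult:
  assumes g: "g \<in> carrier G" and k: "k \<in> carrier G"
  shows "Adl (g \<otimes> k) v = Adl g (Adl k v)"
proof -
  have gk: "g \<otimes> k \<in> carrier G" using g k by simp
  have "((\<lambda>x. cjl g (cjl k x)) has_derivative (\<lambda>v. Adl g (Adl k v))) (at e)"
    by (rule has_derivative_compose[OF Adl_deriv[OF k]]) (simp add: cjl_e k Adl_deriv g)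
  moreover have "((\<lambda>x. cjl g (cjl k x)) has_derivative Adl (g \<otimes> k)) (at e)"
  proof (rule has_derivative_transform_within_open[OF Adl_deriv[OF gk] open_cj_dom[OF k] e_cj_dom[OF k]])
    fix x assume "x \<in> cj_dom k"
    then show "cjl (g \<otimes> k) x = cjl g (cjl k x)"
      using cjl_Omega[of x k] cj_comp[OF g k, of "\<psi> x"] phi_psi(3) by (simp add: cjl_def[of g] cjl_def[of "g \<otimes> k"])
  qed
  ultimately show ?thesis using has_derivative_unique by metis
qed

lemma Adl_one: "Adl \<one> v = v"
proof -
  have "(cjl \<one> has_derivative (\<lambda>v. v)) (at e)"
    by (rule has_derivative_transform_within_open[OF has_derivative_ident open_Omega e_Omega])
       (simp add: cjl_def phi_psi)
  then show ?thesis using has_derivative_unique[OF Adl_deriv[OF one_closed]] by metis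
qed

lemma Adl_inv: "g \<in> carrier G \<Longrightarrow> Adl (inv g) (Adl g v) = v" "g \<in> carrier G \<Longrightarrow> Adl g (Adl (inv g) v) = v"
  using Adl_mult[of "inv g" g v] Adl_mult[of g "inv g" v] by (simp_all add: Adl_one)

text \<open>The homomorphism property of conjugation, differentiated in the second factor at the
  identity.\<close>

lemma cjl_lfield:
  assumes g: "g \<in> carrier G" and x: "x \<in> cj_dom g"
  shows "frechet_derivative (cjl g) (at x) (lfield X x) = lfield (Adl g X) (cjl g x)"
proof -
  note x\<Omega> = cjl_Omega(1)[OF x] and cx = cjl_Omega(2)[OF x]
  let ?U = "(\<lambda>y. (x, y)) -` mu_dom \<inter> cj_dom g"
  have oU: "open ?U" by (intro open_Int open_vimage open_mu_dom continuous_intros open_cj_dom g)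
  have eU: "e \<in> ?U" using mu_dom_e[OF x\<Omega>] e_cj_dom[OF g] by simp
  have "((\<lambda>y. cjl g (mu (x, y))) has_derivative
      (\<lambda>v. frechet_derivative (cjl g) (at x) (frechet_derivative mu (at (x, e)) (0, v)))) (at e)"
    by (rule has_derivative_compose[OF mu_deriv_right[OF mu_dom_e(1)[OF x\<Omega>]]])
       (simp add: mu_e x\<Omega> smooth_on_has_derivative[OF smooth_cjl[OF g] x])
  moreover have "((\<lambda>y. mu (cjl g x, cjl g y)) has_derivative
      (\<lambda>v. frechet_derivative mu (at (cjl g x, e)) (0, Adl g v))) (at e)"
    by (rule has_derivative_compose[where f = "cjl g", OF Adl_deriv[OF g]])
       (simp add: cjl_e g mu_deriv_right[OF mu_dom_e(1)[OF cx]])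
  then have "((\<lambda>y. cjl g (mu (x, y))) has_derivative
      (\<lambda>v. frechet_derivative mu (at (cjl g x, e)) (0, Adl g v))) (at e)"
  proof (rule has_derivative_transform_within_open[OF _ oU eU])
    fix y assume "y \<in> ?U"
    then have y: "(x, y) \<in> mu_dom" "y \<in> cj_dom g" by auto
    show "mu (cjl g x, cjl g y) = cjl g (mu (x, y))"
      using cjl_Omega[OF x] cjl_Omega[OF y(2)] mu_dom_Omega(2)[OF y(1)] phi_psi(3) cj_mult[OF g]
      by (simp add: mu_def[of "(cjl g x, _)"] cjl_def[of g "mu _"])
  qed
  ultimately show ?thesis
    using lfield_eq[OF x\<Omega>] lfield_eq[OF cx] has_derivative_unique by metis
qed

text \<open>Differentiating \<open>cjl_lfield\<close> at the identity compares the derivatives of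
  the two fields up to the second derivative of the conjugation. The latter is symmetric and cancels
  in the commutator.\<close>

theorem Adl_lie_bracket:
  assumes g: "g \<in> carrier G"
  shows "Adl g (lie_bracket G c X Y) = lie_bracket G c (Adl g X) (Adl g Y)"
proof -
  let ?D = "\<lambda>X. frechet_derivative (lfield X) (at e)"
  let ?H = "\<lambda>v. frechet_derivative (\<lambda>x. frechet_derivative (cjl g) (at x) v) (at e)"
  have eq: "?H X Y + Adl g (?D X Y) = ?D (Adl g X) (Adl g Y)" for X Y
  proof -
    have "((\<lambda>x. frechet_derivative (cjl g) (at x) (lfield X x)) has_derivative
        (\<lambda>Y. ?H (lfield X e) Y + frechet_derivative (cjl g) (at e) (?D X Y))) (at e)"
    proof (rule has_derivative_family_apply[where F' = ?H and w' = "?D X", OF open_cj_dom[OF g] e_cj_dom[OF g]])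
      show "linear (frechet_derivative (cjl g) (at x))" if "x \<in> cj_dom g" for x
        using smooth_on_has_derivative[OF smooth_cjl[OF g] that] has_derivative_linear by blast
      show "((\<lambda>x. frechet_derivative (cjl g) (at x) v) has_derivative ?H v) (at e)" for v
        by (rule smooth_on_has_derivative[OF smooth_on_frechet[OF smooth_cjl[OF g]] e_cj_dom[OF g]])
    qed (rule lfield_deriv[OF e_Omega])
    moreover have "((\<lambda>x. lfield (Adl g X) (cjl g x)) has_derivative (\<lambda>Y. ?D (Adl g X) (Adl g Y))) (at e)"
      by (rule has_derivative_compose[OF Adl_deriv[OF g]]) (simp add: cjl_e g lfield_deriv e_Omega)
    then have "((\<lambda>x. frechet_derivative (cjl g) (at x) (lfield X x)) has_derivative
        (\<lambda>Y. ?D (Adl g X) (Adl g Y))) (at e)"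
      by (rule has_derivative_transform_within_open[OF _ open_cj_dom[OF g] e_cj_dom[OF g]])
         (simp add: cjl_lfield g)
    ultimately have "(\<lambda>Y. ?H (lfield X e) Y + frechet_derivative (cjl g) (at e) (?D X Y)) =
        (\<lambda>Y. ?D (Adl g X) (Adl g Y))"
      by (rule has_derivative_unique)
    from fun_cong[OF this, of Y] show ?thesis by (simp add: lfield_e flip: Adl_eq)
  qed
  have "?H X Y = ?H Y X"
    by (rule symmetric_second_derivative[OF open_cj_dom[OF g] e_cj_dom[OF g] smooth_cjl[OF g]])
  then show ?thesis
    unfolding lie_bracket_def eq[symmetric] by (simp add: linear_diff[OF linear_Adl[OF g]])
qed

section \<open>Dependence of Ad on the group element\<close>

definition "iota x = \<phi> (inv (\<psi> x))"
definition "inv_dom = {x \<in> \<Omega>. inv (\<psi> x) \<in> fst c}"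
text \<open>With \<open>kappa\<close> conjugation becomes a smooth function of both arguments, so
  that its partial derivative at the identity, which is Ad, is smooth in the conjugating
  element.\<close>

definition "kappa_dom = {z. z \<in> mu_dom \<and> fst z \<in> inv_dom \<and> (mu z, iota (fst z)) \<in> mu_dom}"
definition "kappa z = mu (mu z, iota (fst z))"

lemma inv_dom_image: "\<phi> ` (fst c \<inter> (\<lambda>x. inv x) -` fst c) = inv_dom"
  unfolding inv_dom_def \<Omega>_def by (auto simp: psi_phi)

lemma open_inv_dom: "open inv_dom"
  using smooth_rep(1)[OF charted_M charted_M smooth_inv cA(1) cA(1)] unfolding inv_dom_image .

lemma smooth_iota: "smooth_on inv_dom iota"
  using smooth_rep(2)[OF charted_M charted_M smooth_inv cA(1) cA(1)] unfolding inv_dom_image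
  by (simp add: iota_def[abs_def] o_def)

lemma e_inv_dom: "e \<in> inv_dom" by (simp add: inv_dom_def e_Omega cA)

lemma iota_Omega: "x \<in> inv_dom \<Longrightarrow> iota x \<in> \<Omega>" "x \<in> inv_dom \<Longrightarrow> \<psi> (iota x) = inv (\<psi> x)"
  "x \<in> inv_dom \<Longrightarrow> x \<in> \<Omega>"
  by (auto simp: inv_dom_def iota_def phi_Omega psi_phi)

lemma open_kappa_dom: "open kappa_dom"
proof -
  let ?A = "mu_dom \<inter> fst -` inv_dom"
  have oA: "open ?A" by (intro open_Int open_mu_dom open_vimage open_inv_dom continuous_intros)
  have "continuous_on ?A (\<lambda>z. (mu z, iota (fst z)))"
    by (intro continuous_intros continuous_on_subset[OF smooth_on_continuous[OF smooth_mu]]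
        continuous_on_compose2[OF smooth_on_continuous[OF smooth_iota]]) auto
  then have "open (?A \<inter> (\<lambda>z. (mu z, iota (fst z))) -` mu_dom)"
    by (rule continuous_open_preimage[OF _ oA open_mu_dom])
  also have "?A \<inter> (\<lambda>z. (mu z, iota (fst z))) -` mu_dom = kappa_dom"
    by (auto simp: kappa_dom_def)
  finally show ?thesis .
qed

lemma smooth_kappa: "smooth_on kappa_dom kappa"
  unfolding kappa_def
proof (rule smooth_on_compose[OF open_kappa_dom smooth_on_Pair[OF open_kappa_dom] smooth_mu])
  show "smooth_on kappa_dom mu"
    by (rule smooth_on_subset[OF smooth_mu]) (auto simp: kappa_dom_def)
  show "smooth_on kappa_dom (\<lambda>z. iota (fst z))"
    by (rule smooth_on_compose[OF open_kappa_dom smooth_on_linear[OF bounded_linear_fst open_kappa_dom] smooth_iota])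
       (auto simp: kappa_dom_def)
qed (auto simp: kappa_dom_def)

lemma kappa_dom_e: "x \<in> inv_dom \<Longrightarrow> (x, e) \<in> kappa_dom"
  using cA by (auto simp: kappa_dom_def mu_dom_e mu_e iota_Omega) (simp add: mu_dom_def iota_Omega phi_psi)

lemma kappa_eq:
  assumes "z \<in> kappa_dom"
  shows "kappa z = cjl (\<psi> (fst z)) (snd z)" "snd z \<in> cj_dom (\<psi> (fst z))"
  using assms mu_dom_Omega[of z] mu_dom_Omega(2)[of "(mu z, iota (fst z))"] iota_Omega[of "fst z"]
  by (auto simp: kappa_dom_def kappa_def mu_def[of "(_, iota _)"] cjl_def cj_dom_def)
     (simp add: mu_dom_def)

lemma Adl_kappa:
  assumes x: "x \<in> inv_dom"
  shows "Adl (\<psi> x) v = frechet_derivative kappa (at (x, e)) (0, v)"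
proof -
  let ?U = "(\<lambda>y. (x, y)) -` kappa_dom"
  have oU: "open ?U" by (intro open_vimage open_kappa_dom continuous_intros)
  have eU: "e \<in> ?U" using kappa_dom_e[OF x] by simp
  have "((\<lambda>y. kappa (x, y)) has_derivative (\<lambda>v. frechet_derivative kappa (at (x, e)) (0, v))) (at e)"
    by (rule has_derivative_compose[where f = "\<lambda>y. (x, y)", OF _ smooth_on_has_derivative[OF smooth_kappa kappa_dom_e[OF x]]])
       (auto intro!: derivative_eq_intros)
  then have "(cjl (\<psi> x) has_derivative (\<lambda>v. frechet_derivative kappa (at (x, e)) (0, v))) (at e)"
    by (rule has_derivative_transform_within_open[OF _ oU eU]) (simp add: kappa_eq)
  then show ?thesis
    using has_derivative_unique[OF Adl_deriv[OF phi_psi(3)[OF iota_Omega(3)[OF x]]]] by metis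
qed

lemma smooth_Adl: "smooth_on inv_dom (\<lambda>x. Adl (\<psi> x) v)"
proof (rule smooth_on_cong[OF open_inv_dom])
  show "smooth_on inv_dom (\<lambda>x. frechet_derivative kappa (at (x, e)) (0, v))"
    by (rule smooth_on_compose[OF open_inv_dom _ smooth_on_frechet[OF smooth_kappa, of "(0, v)"]])
       (auto intro!: smooth_on_Pair smooth_on_ident smooth_on_const open_inv_dom kappa_dom_e)
qed (simp add: Adl_kappa)

text \<open>The identity x y = (x y x^-1) x, differentiated in \<open>y\<close> at the identity: a
  left-invariant field is a right translate of the image under Ad.\<close>

lemma lfield_Adl:
  assumes x: "x \<in> \<Omega>"
  shows "frechet_derivative mu (at (e, x)) (Adl (\<psi> x) v, 0) = lfield v x"
proof -
  let ?U = "cj_dom (\<psi> x) \<inter> (\<lambda>y. (x, y)) -` mu_dom"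
  note gx = phi_psi(3)[OF x]
  have oU: "open ?U" by (intro open_Int open_vimage open_mu_dom continuous_intros open_cj_dom gx)
  have eU: "e \<in> ?U" using mu_dom_e[OF x] e_cj_dom[OF gx] by simp
  have "((\<lambda>y. mu (cjl (\<psi> x) y, x)) has_derivative
     (\<lambda>v. frechet_derivative mu (at (e, x)) (Adl (\<psi> x) v, 0))) (at e)"
    by (rule has_derivative_compose[where f = "cjl (\<psi> x)", OF Adl_deriv[OF gx]])
       (simp add: cjl_e gx mu_deriv_left[OF mu_dom_e(2)[OF x]])
  then have "((\<lambda>y. mu (x, y)) has_derivative
     (\<lambda>v. frechet_derivative mu (at (e, x)) (Adl (\<psi> x) v, 0))) (at e)"
  proof (rule has_derivative_transform_within_open[OF _ oU eU])
    fix y assume y: "y \<in> ?U"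
    then have "y \<in> \<Omega>" using cjl_Omega(1) by blast
    then have "cj (\<psi> x) (\<psi> y) \<otimes> \<psi> x = \<psi> x \<otimes> \<psi> y"
      using gx phi_psi(3) by (simp add: m_assoc)
    then show "mu (cjl (\<psi> x) y, x) = mu (x, y)"
      using y by (simp add: mu_def cjl_Omega)
  qed
  then show ?thesis
    using lfield_eq[OF x] mu_deriv_right[OF mu_dom_e(1)[OF x]] has_derivative_unique by metis
qed

text \<open>The derivative of Ad is ad. Differentiating \<open>lfield_Adl\<close> at the identity
  yields the derivative of Ad plus a mixed second derivative of \<open>mu\<close>; by symmetry this
  is the derivative in direction \<open>v\<close> of the field of \<open>X\<close>, the second term
  of the bracket.\<close>

theorem Adl_has_derivative:
  "((\<lambda>x. Adl (\<psi> x) v) has_derivative (\<lambda>X. lie_bracket G c X v)) (at e)"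
proof -
  let ?D = "\<lambda>X. frechet_derivative (lfield X) (at e)"
  let ?A = "frechet_derivative (\<lambda>x. Adl (\<psi> x) v) (at e)"
  let ?M = "\<lambda>w z. frechet_derivative mu (at z) w"
  let ?L = "\<lambda>w. frechet_derivative (?M w) (at (e, e))"
  have ee: "(e, e) \<in> mu_dom" by (rule mu_dom_e(1)[OF e_Omega])
  have A: "((\<lambda>x. Adl (\<psi> x) v) has_derivative ?A) (at e)"
    by (rule smooth_on_has_derivative[OF smooth_Adl e_inv_dom])
  have M: "(?M w has_derivative ?L w) (at (e, e))" for w
    by (rule smooth_on_has_derivative[OF smooth_on_frechet[OF smooth_mu] ee])
  have "((\<lambda>x. frechet_derivative mu (at (e, x)) (Adl (\<psi> x) v, 0)) has_derivative
      (\<lambda>X. ?L (Adl (\<psi> e) v, 0) (0, X) + frechet_derivative mu (at (e, e)) (?A X, 0))) (at e)"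
  proof (rule has_derivative_family_apply[where F = "\<lambda>x u. frechet_derivative mu (at (e, x)) (u, 0)",
        OF open_Omega e_Omega _ _ A])
    show "linear (\<lambda>u. frechet_derivative mu (at (e, x)) (u, 0))" if "x \<in> \<Omega>" for x
      by (rule has_derivative_linear[OF mu_deriv_left[OF mu_dom_e(2)[OF that]]])
    show "((\<lambda>x. frechet_derivative mu (at (e, x)) (w, 0)) has_derivative (\<lambda>X. ?L (w, 0) (0, X))) (at e)" for w
      by (rule has_derivative_compose[where f = "\<lambda>x. (e, x)", OF _ M]) (auto intro!: derivative_eq_intros)
  qed
  then have "(lfield v has_derivative
      (\<lambda>X. ?L (Adl (\<psi> e) v, 0) (0, X) + frechet_derivative mu (at (e, e)) (?A X, 0))) (at e)"
    by (rule has_derivative_transform_within_open[OF _ open_Omega e_Omega]) (simp add: lfield_Adl)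
  then have 1: "?D v X = ?L (v, 0) (0, X) + ?A X" for X
    using has_derivative_unique[OF lfield_deriv[OF e_Omega]] by (simp add: Adl_one mu_fst_snd_at_e)
  have "(lfield X has_derivative (\<lambda>w. ?L (0, X) (w, 0))) (at e)" for X
  proof (rule has_derivative_transform_within_open[OF _ open_Omega e_Omega])
    show "((\<lambda>x. frechet_derivative mu (at (x, e)) (0, X)) has_derivative (\<lambda>w. ?L (0, X) (w, 0))) (at e)"
      by (rule has_derivative_compose[where f = "\<lambda>x. (x, e)", OF _ M]) (auto intro!: derivative_eq_intros)
  qed (simp add: lfield_eq)
  then have 2: "?D X v = ?L (0, X) (v, 0)" for X
    using has_derivative_unique[OF lfield_deriv[OF e_Omega]] by metis
  have "?L (v, 0) (0, X) = ?L (0, X) (v, 0)" for X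
    by (rule symmetric_second_derivative[OF open_mu_dom ee smooth_mu])
  then have "?A X = lie_bracket G c X v" for X
    using 1[of X] 2[of X] by (simp add: lie_bracket_def)
  then have "?A = (\<lambda>X. lie_bracket G c X v)" by (rule ext)
  then show ?thesis using A by simp
qed

end

section \<open>Local flows\<close>

lemma smooth_on_bounded_derivative:
  fixes v :: "'a::euclidean_space \<Rightarrow> 'b::euclidean_space"
  assumes v: "smooth_on S v" and K: "compact K" "K \<subseteq> S"
  shows "\<exists>B\<ge>0. \<forall>x\<in>K. onorm (frechet_derivative v (at x)) \<le> B"
proof -
  have "\<exists>C. \<forall>x\<in>K. norm (frechet_derivative v (at x) b) \<le> C" for b
  proof -
    have "compact ((\<lambda>x. frechet_derivative v (at x) b) ` K)"
      by (intro compact_continuous_image K continuous_on_subset[OF smooth_on_continuous[OF smooth_on_frechet[OF v]]])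
    then have "bounded ((\<lambda>x. frechet_derivative v (at x) b) ` K)" by (rule compact_imp_bounded)
    then show ?thesis unfolding bounded_iff by auto
  qed
  then obtain C where C: "\<And>b x. x \<in> K \<Longrightarrow> norm (frechet_derivative v (at x) b) \<le> C b" by metis
  have "onorm (frechet_derivative v (at x)) \<le> (\<Sum>b\<in>Basis. \<bar>C b\<bar>)" if x: "x \<in> K" for x
  proof (rule onorm_le)
    have lin: "linear (frechet_derivative v (at x))"
      using smooth_on_has_derivative[OF v] x K has_derivative_linear by blast
    fix w
    have "norm (frechet_derivative v (at x) w) = norm (\<Sum>b\<in>Basis. (w \<bullet> b) *\<^sub>R frechet_derivative v (at x) b)"
      by (subst euclidean_representation[of w, symmetric]) (simp add: linear_sum[OF lin] linear_scale[OF lin])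
    also have "\<dots> \<le> (\<Sum>b\<in>Basis. \<bar>w \<bullet> b\<bar> * norm (frechet_derivative v (at x) b))"
      by (rule order_trans[OF norm_sum]) simp
    also have "\<dots> \<le> (\<Sum>b\<in>Basis. norm w * \<bar>C b\<bar>)"
      using order_trans[OF C[OF x] abs_ge_self] by (intro sum_mono mult_mono Basis_le_norm) auto
    finally show "norm (frechet_derivative v (at x) w) \<le> (\<Sum>b\<in>Basis. \<bar>C b\<bar>) * norm w"
      by (simp add: sum_distrib_left mult.commute)
  qed
  then show ?thesis by (intro exI[of _ "\<Sum>b\<in>Basis. \<bar>C b\<bar>"]) (auto intro: sum_nonneg)
qed

lemma smooth_on_lipschitz_cball:
  fixes v :: "'a::euclidean_space \<Rightarrow> 'b::euclidean_space"
  assumes v: "smooth_on S v" and K: "cball e r \<subseteq> S"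
  shows "\<exists>B\<ge>0. \<forall>x\<in>cball e r. \<forall>y\<in>cball e r. norm (v x - v y) \<le> B * norm (x - y)"
proof -
  have "\<exists>B\<ge>0. \<forall>x\<in>cball e r. onorm (frechet_derivative v (at x)) \<le> B"
    by (rule smooth_on_bounded_derivative[OF v _ K]) (rule compact_cball)
  then obtain B where B: "B \<ge> 0" "\<And>x. x \<in> cball e r \<Longrightarrow> onorm (frechet_derivative v (at x)) \<le> B"
    by metis
  have "norm (v x - v y) \<le> B * norm (x - y)" if "x \<in> cball e r" "y \<in> cball e r" for x y
  proof (rule differentiable_bound[where S = "cball e r" and f' = "\<lambda>z. frechet_derivative v (at z)"])
    show "(v has_derivative frechet_derivative v (at z)) (at z within cball e r)" if "z \<in> cball e r" for z
      by (rule has_derivative_at_withinI, rule smooth_on_has_derivative[OF v], rule subsetD[OF K that])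
  qed (rule convex_cball, rule B(2), assumption, fact+)
  then show ?thesis using B(1) by auto
qed

text \<open>Picard iteration as a contraction on bounded continuous functions. The last conclusion
  later confines the solution to a ball.\<close>

lemma ode_solution_global_lipschitz:
  fixes w :: "'a::euclidean_space \<Rightarrow> 'a"
  assumes K: "K \<ge> 0" "\<And>x y. norm (w x - w y) \<le> K * norm (x - y)" and B: "\<And>x. norm (w x) \<le> B"
    and \<epsilon>: "\<epsilon> > 0" "8 * K * \<epsilon> \<le> 1"
  shows "\<exists>u. u 0 = e \<and> (\<forall>t\<in>{-\<epsilon><..<\<epsilon>}. (u has_vector_derivative w (u t)) (at t)) \<and>
    (\<forall>t. norm (u t - e) \<le> 4 * \<epsilon> * B)"
proof -
  \<comment> \<open>Clamping the time extends each iterate from the interval to a bounded continuous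
    function on the whole line.\<close>
  define cl where "cl t = max (- \<epsilon>) (min \<epsilon> t)" for t :: real
  have cl: "cl t \<in> {-\<epsilon>..\<epsilon>}" for t using \<epsilon> by (auto simp: cl_def)
  have cl_id: "t \<in> {-\<epsilon>..\<epsilon>} \<Longrightarrow> cl t = t" for t by (auto simp: cl_def)
  have contcl: "continuous_on UNIV cl" unfolding cl_def by (intro continuous_intros)
  have contw: "continuous_on UNIV w"
    by (rule lipschitz_on_continuous_on[of K]) (use K in \<open>auto simp: lipschitz_on_def dist_norm\<close>)
  define I where "I u t = integral {-\<epsilon>..t} (\<lambda>s. w (apply_bcontfun u s))" for u t
  have contwu: "continuous_on T (\<lambda>s. w (apply_bcontfun u s))" for u T
    by (rule continuous_on_compose2[OF contw]) auto
  have int: "(\<lambda>s. w (apply_bcontfun u s)) integrable_on {a..b}" for u and a b :: real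
    by (rule integrable_continuous_real[OF contwu])
  have Ider: "(I u has_vector_derivative w (apply_bcontfun u t)) (at t within {-\<epsilon>..\<epsilon>})" if "t \<in> {-\<epsilon>..\<epsilon>}" for u t
    unfolding I_def by (rule integral_has_vector_derivative[OF contwu that])
  have contI: "continuous_on {-\<epsilon>..\<epsilon>} (I u)" for u
    using Ider continuous_on_eq_continuous_within has_vector_derivative_continuous by blast
  have Ibound: "norm (I u t) \<le> 2 * \<epsilon> * B" if t: "t \<in> {-\<epsilon>..\<epsilon>}" for u t
  proof -
    have B0: "B \<ge> 0" using B norm_ge_zero order_trans by blast
    have "norm (I u t) \<le> B * (t - - \<epsilon>)" unfolding I_def
      by (rule integral_bound) (use t contwu B in auto)
    also have "\<dots> \<le> B * (2 * \<epsilon>)" using t B0 by (intro mult_left_mono) auto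
    finally show ?thesis by (simp add: mult.commute)
  qed
  have Idiff: "norm (I u t - I u' t) \<le> 2 * \<epsilon> * K * dist u u'" if t: "t \<in> {-\<epsilon>..\<epsilon>}" for u u' t
  proof -
    have "norm (I u t - I u' t) = norm (integral {-\<epsilon>..t} (\<lambda>s. w (apply_bcontfun u s) - w (apply_bcontfun u' s)))"
      unfolding I_def by (simp add: integral_diff int)
    also have "\<dots> \<le> (K * dist u u') * (t - - \<epsilon>)"
    proof (rule integral_bound)
      fix s
      have "norm (w (apply_bcontfun u s) - w (apply_bcontfun u' s)) \<le> K * norm (apply_bcontfun u s - apply_bcontfun u' s)"
        by (rule K)
      also have "\<dots> \<le> K * dist u u'" using dist_bounded[of u s u'] K(1) by (intro mult_left_mono) (auto simp: dist_norm)
      finally show "norm (w (apply_bcontfun u s) - w (apply_bcontfun u' s)) \<le> K * dist u u'" .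
    qed (use t in \<open>auto intro!: continuous_on_diff contwu\<close>)
    also have "\<dots> \<le> (K * dist u u') * (2 * \<epsilon>)" using t K by (intro mult_left_mono) auto
    finally show ?thesis by (simp add: mult_ac)
  qed
  \<comment> \<open>The integral starts at -\<epsilon>; subtracting its value at 0 restores the
    initial condition. Each of the two integrals contributes \<open>2 * \<epsilon> * K\<close> to
    the Lipschitz constant, which gives at most 1/2 under the bound with the factor 8.\<close>
  define F where "F u t = e + I u (cl t) - I u 0" for u t
  have z: "0 \<in> {-\<epsilon>..\<epsilon>}" using \<epsilon> by simp
  have Fe: "norm (F u t - e) \<le> 4 * \<epsilon> * B" for u t
    using norm_triangle_ineq4[of "I u (cl t)" "I u 0"] Ibound[OF cl, of u t] Ibound[OF z, of u] by (simp add: F_def)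
  have F: "F u \<in> bcontfun" for u
  proof (rule bcontfun_normI[where b = "norm e + 4 * \<epsilon> * B"])
    show "continuous_on UNIV (F u)" unfolding F_def
      by (intro continuous_intros continuous_on_compose2[OF contI contcl]) (use cl in auto)
    show "norm (F u t) \<le> norm e + 4 * \<epsilon> * B" for t
      using norm_triangle_ineq[of "e" "F u t - e"] Fe[of u t] by simp
  qed
  have "\<exists>!u. Bcontfun (F u) = u"
  proof (rule banach_fix_type[of "1/2"])
    show "\<forall>u u'. dist (Bcontfun (F u)) (Bcontfun (F u')) \<le> 1 / 2 * dist u u'"
    proof (intro allI dist_bound)
      fix u u' t
      have "dist (F u t) (F u' t) = norm ((I u (cl t) - I u' (cl t)) - (I u 0 - I u' 0))"
        by (simp add: F_def dist_norm algebra_simps)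
      also have "\<dots> \<le> 2 * \<epsilon> * K * dist u u' + 2 * \<epsilon> * K * dist u u'"
        by (intro order_trans[OF norm_triangle_ineq4] add_mono Idiff cl z)
      also have "\<dots> = (8 * K * \<epsilon>) / 2 * dist u u'" by simp
      also have "\<dots> \<le> 1 / 2 * dist u u'" using \<epsilon> by (intro mult_right_mono) auto
      finally show "dist (apply_bcontfun (Bcontfun (F u)) t) (apply_bcontfun (Bcontfun (F u')) t) \<le> 1 / 2 * dist u u'"
        by (simp add: Bcontfun_inverse F)
    qed
  qed auto
  then obtain u where u: "Bcontfun (F u) = u" by blast
  have ut: "apply_bcontfun u t = F u t" for t using Bcontfun_inverse[OF F[of u]] u by simp
  show ?thesis
  proof (intro exI[of _ "apply_bcontfun u"] conjI allI ballI)
    show "apply_bcontfun u 0 = e" by (simp add: ut F_def cl_id[OF z])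
    show "norm (apply_bcontfun u t - e) \<le> 4 * \<epsilon> * B" for t by (simp add: ut Fe)
    fix t assume t: "t \<in> {-\<epsilon><..<\<epsilon>}"
    have "(I u has_vector_derivative w (apply_bcontfun u t)) (at t)"
      using Ider[of t u] t at_within_Icc_at[of "-\<epsilon>" t \<epsilon>] by simp
    then have "((\<lambda>t. e + I u t - I u 0) has_vector_derivative w (apply_bcontfun u t)) (at t)"
      by (auto intro!: derivative_eq_intros)
    then show "(apply_bcontfun u has_vector_derivative w (apply_bcontfun u t)) (at t)"
      by (rule has_vector_derivative_transform_within_open[of _ _ _ "{-\<epsilon><..<\<epsilon>}"])
         (use t in \<open>auto simp: ut F_def cl_id\<close>)
  qed
qed

text \<open>Gronwall for the squared distance \<open>f\<close>: from
  \<open>\<bar>f' t\<bar> \<le> 2 * K * f t\<close> it follows that exp (-2 K t) f(t) is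
  nonincreasing to the right of \<open>r\<close>, and exp (2 K t) f(t) nondecreasing to the left.
  The Lipschitz bound is required only along the two curves, as fits a field that is controlled on a
  ball.\<close>

lemma ode_unique:
  fixes x y :: "real \<Rightarrow> 'a::euclidean_space"
  assumes K: "K \<ge> 0" and t: "r \<in> {a<..<b}" "t \<in> {a<..<b}" and eq: "x r = y r"
    and x: "\<And>t. t \<in> {a<..<b} \<Longrightarrow> (x has_vector_derivative w (x t)) (at t)"
    and y: "\<And>t. t \<in> {a<..<b} \<Longrightarrow> (y has_vector_derivative w (y t)) (at t)"
    and lip: "\<And>t. t \<in> {a<..<b} \<Longrightarrow> norm (w (x t) - w (y t)) \<le> K * norm (x t - y t)"
  shows "x t = y t"
proof -
  define f where "f t = (x t - y t) \<bullet> (x t - y t)" for t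
  define f' where "f' t = 2 * ((x t - y t) \<bullet> (w (x t) - w (y t)))" for t
  have f: "(f has_real_derivative f' t) (at t)" if "t \<in> {a<..<b}" for t
  proof -
    have "((\<lambda>t. x t - y t) has_derivative (\<lambda>h. h *\<^sub>R (w (x t) - w (y t)))) (at t)"
      using has_vector_derivative_diff[OF x[OF that] y[OF that]] by (simp add: has_vector_derivative_def)
    from has_derivative_inner[OF this this] show ?thesis
      unfolding f_def f'_def has_field_derivative_def
      by (rule has_derivative_eq_rhs) (auto simp: inner_commute algebra_simps)
  qed
  have f'_le: "\<bar>f' t\<bar> \<le> 2 * K * f t" if "t \<in> {a<..<b}" for t
  proof -
    have "\<bar>(x t - y t) \<bullet> (w (x t) - w (y t))\<bar> \<le> norm (x t - y t) * (K * norm (x t - y t))"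
      using lip[OF that] by (intro order_trans[OF Cauchy_Schwarz_ineq2] mult_left_mono) auto
    then show ?thesis by (simp add: f'_def f_def abs_mult dot_square_norm power2_eq_square mult_ac)
  qed
  have f0: "f r = 0" by (simp add: f_def eq)
  have "f t \<le> 0"
  proof (cases "r \<le> t")
    case True
    have "exp (- (2 * K * t)) * f t \<le> exp (- (2 * K * r)) * f r"
    proof (rule DERIV_nonpos_imp_nonincreasing[OF True, of "\<lambda>s. exp (- (2 * K * s)) * f s"])
      fix s assume "r \<le> s" "s \<le> t"
      then have s: "s \<in> {a<..<b}" using t by auto
      show "\<exists>d. ((\<lambda>s. exp (- (2 * K * s)) * f s) has_real_derivative d) (at s) \<and> d \<le> 0"
      proof (intro exI conjI)
        show "((\<lambda>s. exp (- (2 * K * s)) * f s) has_real_derivative exp (- (2 * K * s)) * (f' s - 2 * K * f s)) (at s)"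
          by (auto intro!: derivative_eq_intros f[OF s] simp: algebra_simps)
        show "exp (- (2 * K * s)) * (f' s - 2 * K * f s) \<le> 0"
          using f'_le[OF s] by (intro mult_nonneg_nonpos) auto
      qed
    qed
    then show ?thesis by (simp add: f0 mult_le_0_iff)
  next
    case False
    have "exp (2 * K * t) * f t \<le> exp (2 * K * r) * f r"
    proof (rule DERIV_nonneg_imp_nondecreasing[of t r "\<lambda>s. exp (2 * K * s) * f s"])
      fix s assume "t \<le> s" "s \<le> r"
      then have s: "s \<in> {a<..<b}" using t by auto
      show "\<exists>d. ((\<lambda>s. exp (2 * K * s) * f s) has_real_derivative d) (at s) \<and> 0 \<le> d"
      proof (intro exI conjI)
        show "((\<lambda>s. exp (2 * K * s) * f s) has_real_derivative exp (2 * K * s) * (f' s + 2 * K * f s)) (at s)"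
          by (auto intro!: derivative_eq_intros f[OF s] simp: algebra_simps)
        show "0 \<le> exp (2 * K * s) * (f' s + 2 * K * f s)"
          using f'_le[OF s] by (intro mult_nonneg_nonneg) auto
      qed
    qed (use False in simp)
    then show ?thesis by (simp add: f0 mult_le_0_iff)
  qed
  then show ?thesis by (simp add: f_def) (metis eq_iff_diff_eq_0 inner_eq_zero_iff inner_ge_zero order_antisym)
qed

text \<open>The nearest-point map onto a ball does not increase distances, so composition with it
  makes the field bounded and globally Lipschitz. The solution never leaves the ball and thus solves
  the original equation.\<close>

lemma local_flow:
  fixes v :: "'a::euclidean_space \<Rightarrow> 'a"
  assumes S: "open S" "e \<in> S" and v: "smooth_on S v"
  obtains u \<epsilon> r K where "\<epsilon> > 0" "r > 0" "cball e r \<subseteq> S" "u 0 = e"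
    "\<And>t. t \<in> {-\<epsilon><..<\<epsilon>} \<Longrightarrow> (u has_vector_derivative v (u t)) (at t)"
    "\<And>t. u t \<in> cball e r" "K \<ge> 0"
    "\<And>x y. x \<in> cball e r \<Longrightarrow> y \<in> cball e r \<Longrightarrow> norm (v x - v y) \<le> K * norm (x - y)"
proof -
  obtain r where r: "r > 0" "cball e r \<subseteq> S" using S open_contains_cball by blast
  obtain K where K: "K \<ge> 0" "\<And>x y. x \<in> cball e r \<Longrightarrow> y \<in> cball e r \<Longrightarrow> norm (v x - v y) \<le> K * norm (x - y)"
    using smooth_on_lipschitz_cball[OF v r(2)] by metis
  define P where "P = closest_point (cball e r)"
  have ne: "cball e r \<noteq> {}" using r by auto
  have P: "P x \<in> cball e r" "norm (P x - P y) \<le> norm (x - y)" for x y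
    using closest_point_in_set[of "cball e r" x] closest_point_lipschitz[of "cball e r" x y] ne r
    by (auto simp: P_def dist_norm)
  define w where "w x = v (P x)" for x
  have lip: "norm (w x - w y) \<le> K * norm (x - y)" for x y
    unfolding w_def using P K mult_left_mono[OF P(2) K(1)] by (meson order_trans)
  have "compact (v ` cball e r)"
    by (intro compact_continuous_image compact_cball continuous_on_subset[OF smooth_on_continuous[OF v] r(2)])
  then have "bounded (v ` cball e r)" by (rule compact_imp_bounded)
  then obtain B where B: "B > 0" "\<And>x. x \<in> cball e r \<Longrightarrow> norm (v x) \<le> B"
    unfolding bounded_pos by auto
  have wB: "norm (w x) \<le> B" for x unfolding w_def by (rule B(2)[OF P(1)])
  \<comment> \<open>The first bound serves the contraction, with \<open>+ 1\<close> because
    \<open>K\<close> may be 0. The second keeps the solution within distance \<open>r\<close> of its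
    start.\<close>
  define \<epsilon> where "\<epsilon> = min (1 / (8 * K + 1)) (r / (4 * B))"
  have \<epsilon>: "\<epsilon> > 0" using K B r by (simp add: \<epsilon>_def)
  have "8 * K * \<epsilon> \<le> 8 * K * (1 / (8 * K + 1))" using K by (intro mult_left_mono) (auto simp: \<epsilon>_def)
  also have "\<dots> \<le> 1" using K by (simp add: field_simps)
  finally have e1: "8 * K * \<epsilon> \<le> 1" .
  have "4 * \<epsilon> * B \<le> 4 * (r / (4 * B)) * B" using B by (intro mult_right_mono mult_left_mono) (auto simp: \<epsilon>_def)
  also have "\<dots> = r" using B by simp
  finally have e2: "4 * \<epsilon> * B \<le> r" .
  obtain u where u: "u 0 = e" "\<And>t. t \<in> {-\<epsilon><..<\<epsilon>} \<Longrightarrow> (u has_vector_derivative w (u t)) (at t)"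
    "\<And>t. norm (u t - e) \<le> 4 * \<epsilon> * B"
    using ode_solution_global_lipschitz[OF K(1) lip wB \<epsilon> e1] by blast
  have ur: "u t \<in> cball e r" for t using u(3)[of t] e2 by (simp add: dist_norm norm_minus_commute)
  have "w (u t) = v (u t)" for t using ur by (simp add: w_def P_def closest_point_self)
  then have uv: "(u has_vector_derivative v (u t)) (at t)" if "t \<in> {-\<epsilon><..<\<epsilon>}" for t
    using u(2)[OF that] by simp
  show thesis by (rule that[of \<epsilon> r u K]) (fact \<epsilon> r u(1) uv ur K)+
qed

text \<open>Bootstrapping: if \<open>u\<close> is of class \<open>C\<^sup>k\<close>, so is its
  derivative, which is \<open>v\<close> composed with \<open>u\<close>.\<close>

lemma ode_solution_smooth:
  fixes u :: "real \<Rightarrow> 'a::euclidean_space"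
  assumes S: "open S" and v: "smooth_on S v" and I: "open I"
    and u: "\<And>t. t \<in> I \<Longrightarrow> (u has_vector_derivative v (u t)) (at t)" "u ` I \<subseteq> S"
  shows "smooth_on I u"
  unfolding smooth_on_def
proof
  fix k show "Ck_on k I u"
  proof (induction k)
    case 0
    then show ?case using u(1) by (auto intro!: continuous_at_imp_continuous_on has_vector_derivative_continuous)
  next
    case (Suc k)
    show ?case
    proof (rule Ck_on_SucI[OF I])
      show "(u has_derivative (\<lambda>h. h *\<^sub>R v (u t))) (at t)" if "t \<in> I" for t
        using u(1)[OF that] by (simp add: has_vector_derivative_def)
      show "Ck_on k I (\<lambda>t. h *\<^sub>R v (u t))" for h
        by (rule Ck_on_linear_comp[OF bounded_linear_scaleR_right I Ck_on_compose[OF I Suc smooth_onD[OF v] u(2)]])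
    qed
  qed
qed

section \<open>One-parameter subgroups\<close>

context lie_chart
begin

text \<open>For fixed \<open>s\<close> both \<gamma>(s + t) and the product of \<gamma>(s) and
  \<gamma>(t) are integral curves of the same left-invariant field with the same value at t = 0, so
  they agree.\<close>

lemma local_one_parameter:
  obtains \<gamma> \<delta> where "\<delta> > 0" "\<gamma> 0 = e" "smooth_on {-\<delta><..<\<delta>} \<gamma>"
    "\<And>t. \<bar>t\<bar> < \<delta> \<Longrightarrow> \<gamma> t \<in> \<Omega>"
    "\<And>t. \<bar>t\<bar> < \<delta> \<Longrightarrow> (\<gamma> has_vector_derivative lfield X (\<gamma> t)) (at t)"
    "\<And>s t. \<bar>s\<bar> < \<delta> \<Longrightarrow> \<bar>t\<bar> < \<delta> \<Longrightarrow> \<bar>s + t\<bar> < \<delta> \<Longrightarrow> \<psi> (\<gamma> (s + t)) = \<psi> (\<gamma> s) \<otimes> \<psi> (\<gamma> t)"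
proof -
  obtain \<gamma> \<epsilon> r K where \<epsilon>: "\<epsilon> > 0" and r: "r > 0" "cball e r \<subseteq> \<Omega>" and \<gamma>0: "\<gamma> 0 = e"
    and \<gamma>: "\<And>t. t \<in> {-\<epsilon><..<\<epsilon>} \<Longrightarrow> (\<gamma> has_vector_derivative lfield X (\<gamma> t)) (at t)"
    and \<gamma>r: "\<And>t. \<gamma> t \<in> cball e r" and K: "K \<ge> 0"
    "\<And>x y. x \<in> cball e r \<Longrightarrow> y \<in> cball e r \<Longrightarrow> norm (lfield X x - lfield X y) \<le> K * norm (x - y)"
    using local_flow[OF open_Omega e_Omega smooth_lfield[of X]] by metis
  have \<gamma>\<Omega>: "\<gamma> t \<in> \<Omega>" for t using \<gamma>r r by auto
  have cont: "continuous_on {-\<epsilon><..<\<epsilon>} \<gamma>"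
    by (intro continuous_at_imp_continuous_on ballI has_vector_derivative_continuous[OF \<gamma>])
  \<comment> \<open>Pairs whose product stays in the ball where the Lipschitz constant of the field
    is valid, as uniqueness requires.\<close>
  define V where "V = mu_dom \<inter> mu -` ball e r"
  have oV: "open V" unfolding V_def
    by (rule continuous_open_preimage[OF smooth_on_continuous[OF smooth_mu] open_mu_dom open_ball])
  have eV: "(\<gamma> 0, \<gamma> 0) \<in> V" using mu_dom_e(1)[OF e_Omega] mu_e(1)[OF e_Omega] r by (simp add: V_def \<gamma>0)
  have "\<exists>A. open A \<and> 0 \<in> A \<and> (\<forall>s\<in>A. \<forall>t\<in>A. s \<in> {-\<epsilon><..<\<epsilon>} \<and> (\<gamma> s, \<gamma> t) \<in> V)"
  proof -
    obtain A B where AB: "open A" "open B" "\<gamma> 0 \<in> A" "\<gamma> 0 \<in> B" "A \<times> B \<subseteq> V"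
      using open_prod_elim[OF oV eV] by (metis mem_Sigma_iff)
    have "open ({-\<epsilon><..<\<epsilon>} \<inter> \<gamma> -` (A \<inter> B))"
      by (rule continuous_open_preimage[OF cont]) (use AB in auto)
    then show ?thesis using AB \<epsilon> by (intro exI[of _ "{-\<epsilon><..<\<epsilon>} \<inter> \<gamma> -` (A \<inter> B)"]) auto
  qed
  then obtain A where A: "open A" "0 \<in> A" "\<And>s t. s \<in> A \<Longrightarrow> t \<in> A \<Longrightarrow> s \<in> {-\<epsilon><..<\<epsilon>} \<and> (\<gamma> s, \<gamma> t) \<in> V"
    by metis
  obtain d where d: "d > 0" "ball 0 d \<subseteq> A" using A(1,2) open_contains_ball by blast
  have inA: "\<bar>t\<bar> < d \<Longrightarrow> t \<in> A" for t using d(2) by (auto simp: subset_eq dist_real_def)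
  have small: "\<bar>t\<bar> < d \<Longrightarrow> t \<in> {-\<epsilon><..<\<epsilon>}" for t using A(3) inA by blast
  have prod: "(\<gamma> s, \<gamma> t) \<in> V" if "\<bar>s\<bar> < d" "\<bar>t\<bar> < d" for s t using A(3) inA that by blast
  \<comment> \<open>Half of \<open>d\<close>, so that sums of two parameters stay in the interval
    where \<gamma> solves the equation.\<close>
  define \<delta> where "\<delta> = d / 2"
  have \<delta>: "\<delta> > 0" "\<And>s t. \<bar>s\<bar> < \<delta> \<Longrightarrow> \<bar>t\<bar> < \<delta> \<Longrightarrow> \<bar>s + t\<bar> < d" "\<And>s. \<bar>s\<bar> < \<delta> \<Longrightarrow> \<bar>s\<bar> < d"
    using d(1) by (auto simp: \<delta>_def)
  have hom: "\<gamma> (s + t) = mu (\<gamma> s, \<gamma> t)" if s: "\<bar>s\<bar> < \<delta>" and t: "\<bar>t\<bar> < \<delta>" for s t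
  proof (rule ode_unique[where w = "lfield X" and r = 0 and a = "-\<delta>" and b = \<delta> and K = K and x = "\<lambda>t. \<gamma> (s + t)"
        and y = "\<lambda>t. mu (\<gamma> s, \<gamma> t)"])
    show "0 \<in> {-\<delta><..<\<delta>}" "t \<in> {-\<delta><..<\<delta>}" using \<delta>(1) t by auto
    show "\<gamma> (s + 0) = mu (\<gamma> s, \<gamma> 0)" by (simp add: \<gamma>0 mu_e \<gamma>\<Omega>)
    fix t assume "t \<in> {-\<delta><..<\<delta>}"
    then have t: "\<bar>t\<bar> < \<delta>" by auto
    note p = prod[OF \<delta>(3)[OF s] \<delta>(3)[OF t]]
    have "((\<lambda>t. s + t) has_vector_derivative 1) (at t)"
      by (auto intro!: derivative_eq_intros)
    from vector_diff_chain_at[OF this, of \<gamma>] \<gamma>[OF small[OF \<delta>(2)[OF s t]]]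
    show "((\<lambda>t. \<gamma> (s + t)) has_vector_derivative lfield X (\<gamma> (s + t))) (at t)"
      by (simp add: o_def)
    have p': "(\<gamma> s, \<gamma> t) \<in> mu_dom" using p by (simp add: V_def)
    have "((\<lambda>t. mu (\<gamma> s, \<gamma> t)) has_derivative
        (\<lambda>h. frechet_derivative mu (at (\<gamma> s, \<gamma> t)) (0, h *\<^sub>R lfield X (\<gamma> t)))) (at t)"
      using has_derivative_compose[OF \<gamma>[OF small[OF \<delta>(3)[OF t]], unfolded has_vector_derivative_def] mu_deriv_right[OF p']] .
    moreover have "frechet_derivative mu (at (\<gamma> s, \<gamma> t)) (0, h *\<^sub>R lfield X (\<gamma> t)) = h *\<^sub>R lfield X (mu (\<gamma> s, \<gamma> t))" for h
      using linear_scale[OF has_derivative_linear[OF mu_deriv_right[OF p']], of h "lfield X (\<gamma> t)"]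
        lfield_invariant[OF p'] by simp
    ultimately show "((\<lambda>t. mu (\<gamma> s, \<gamma> t)) has_vector_derivative lfield X (mu (\<gamma> s, \<gamma> t))) (at t)"
      by (simp add: has_vector_derivative_def)
    show "norm (lfield X (\<gamma> (s + t)) - lfield X (mu (\<gamma> s, \<gamma> t))) \<le> K * norm (\<gamma> (s + t) - mu (\<gamma> s, \<gamma> t))"
      by (rule K(2)[OF \<gamma>r]) (use p in \<open>auto simp: V_def\<close>)
  qed (rule K)
  have sub: "{-\<delta><..<\<delta>} \<subseteq> {-\<epsilon><..<\<epsilon>}" using small \<delta>(3) by (metis abs_less_iff greaterThanLessThan_iff minus_less_iff subsetI)
  show thesis
  proof (rule that[of \<delta> \<gamma>])
    show "\<delta> > 0" "\<gamma> 0 = e" by (fact \<delta>(1) \<gamma>0)+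
    show "smooth_on {-\<delta><..<\<delta>} \<gamma>"
      by (rule ode_solution_smooth[OF open_Omega smooth_lfield[of X]]) (use \<gamma> \<gamma>\<Omega> sub in auto)
    show "\<gamma> t \<in> \<Omega>" for t by (rule \<gamma>\<Omega>)
    show "(\<gamma> has_vector_derivative lfield X (\<gamma> t)) (at t)" if "\<bar>t\<bar> < \<delta>" for t
      using \<gamma>[OF small[OF \<delta>(3)[OF that]]] .
    show "\<psi> (\<gamma> (s + t)) = \<psi> (\<gamma> s) \<otimes> \<psi> (\<gamma> t)" if "\<bar>s\<bar> < \<delta>" "\<bar>t\<bar> < \<delta>" for s t
      using hom[OF that] prod[OF \<delta>(3)[OF that(1)] \<delta>(3)[OF that(2)]] mu_dom_Omega(2) by (simp add: V_def)
  qed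
qed

end

text \<open>The value at \<open>t\<close> is the \<open>2 ^ k\<close>-th power of the value at
  \<open>t / 2 ^ k\<close>, which by halving does not depend on \<open>k\<close> once this point is
  in the given interval. It is multiplicative because nearby values commute: addition of reals is
  commutative.\<close>

lemma (in group) extend_local_homomorphism:
  fixes g0 :: "real \<Rightarrow> 'a"
  assumes \<delta>: "\<delta> > 0" and g0: "\<And>t. \<bar>t\<bar> < \<delta> \<Longrightarrow> g0 t \<in> carrier G"
    and hom: "\<And>s t. \<bar>s\<bar> < \<delta> \<Longrightarrow> \<bar>t\<bar> < \<delta> \<Longrightarrow> \<bar>s + t\<bar> < \<delta> \<Longrightarrow> g0 (s + t) = g0 s \<otimes> g0 t"
  obtains g where "\<And>t. g t \<in> carrier G" "\<And>s t. g (s + t) = g s \<otimes> g t" "\<And>t. \<bar>t\<bar> < \<delta> \<Longrightarrow> g t = g0 t"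
proof -
  define q where "q k t = g0 (t / 2 ^ k) [^] (2 ^ k :: nat)" for k :: nat and t
  have q_Suc: "q (Suc k) t = q k t" if "\<bar>t / 2 ^ k\<bar> < \<delta>" for k t
  proof -
    let ?h = "t / 2 ^ Suc k"
    have h: "?h + ?h = t / 2 ^ k" by simp
    have half: "\<bar>y / 2\<bar> < \<delta>" if "\<bar>y\<bar> < \<delta>" for y :: real using that by linarith
    have "?h = (t / 2 ^ k) / 2" by simp
    then have small: "\<bar>?h\<bar> < \<delta>" using half[OF that] by presburger
    have "g0 (t / 2 ^ k) = g0 ?h \<otimes> g0 ?h" using hom[OF small small] that unfolding h by blast
    then have "g0 (t / 2 ^ k) = g0 ?h [^] (2 :: nat)" using g0[OF small] by (simp add: numeral_2_eq_2)
    then show ?thesis unfolding q_def using g0[OF small] by (simp add: nat_pow_pow mult.commute)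
  qed
  have shrink: "\<bar>t / 2 ^ k'\<bar> < \<delta>" if "\<bar>t / 2 ^ k\<bar> < \<delta>" "k \<le> k'" for t and k k' :: nat
  proof -
    have "\<bar>t\<bar> / 2 ^ k' \<le> \<bar>t\<bar> / 2 ^ k" using that(2) by (intro divide_left_mono power_increasing) auto
    then show ?thesis using that(1) by (simp add: abs_divide)
  qed
  have q_eq: "q k' t = q k t" if "\<bar>t / 2 ^ k\<bar> < \<delta>" "k \<le> k'" for t k k'
    using that(2)
  proof (induction k' rule: dec_induct)
    case (step n)
    then show ?case using q_Suc[OF shrink[OF that(1) step(1)]] by simp
  qed simp
  have ex: "\<exists>k. \<bar>t / 2 ^ k\<bar> < \<delta>" for t
  proof -
    obtain k where "\<bar>t\<bar> / \<delta> < 2 ^ k" using real_arch_pow[of 2 "\<bar>t\<bar> / \<delta>"] by auto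
    then have "\<bar>t / 2 ^ k\<bar> < \<delta>" using \<delta> by (simp add: abs_divide field_simps)
    then show ?thesis by blast
  qed
  define N where "N t = (SOME k. \<bar>t / 2 ^ k\<bar> < \<delta>)" for t
  have N: "\<bar>t / 2 ^ N t\<bar> < \<delta>" for t unfolding N_def by (rule someI_ex[OF ex])
  define g where "g t = q (N t) t" for t
  have g_eq: "g t = q k t" if "\<bar>t / 2 ^ k\<bar> < \<delta>" for t k
    using q_eq[OF N, of t "max k (N t)"] q_eq[OF that, of "max k (N t)"] by (simp add: g_def)
  have carrier: "g t \<in> carrier G" for t unfolding g_def q_def using g0[OF N] by simp
  have "g (s + t) = g s \<otimes> g t" for s t
  proof -
    define k where "k = max (N s) (max (N t) (N (s + t)))"
    have small: "\<bar>s / 2 ^ k\<bar> < \<delta>" "\<bar>t / 2 ^ k\<bar> < \<delta>" "\<bar>(s + t) / 2 ^ k\<bar> < \<delta>"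
      using shrink[OF N] by (simp_all add: k_def)
    have st: "s / 2 ^ k + t / 2 ^ k = (s + t) / 2 ^ k" "t / 2 ^ k + s / 2 ^ k = (s + t) / 2 ^ k"
      by (simp_all add: add_divide_distrib)
    have "g0 ((s + t) / 2 ^ k) = g0 (s / 2 ^ k) \<otimes> g0 (t / 2 ^ k)" "g0 ((s + t) / 2 ^ k) = g0 (t / 2 ^ k) \<otimes> g0 (s / 2 ^ k)"
      using hom[OF small(1,2)] hom[OF small(2,1)] small(3) unfolding st by auto
    then show ?thesis
      using small g0 by (simp add: g_eq[of _ k] q_def pow_mult_distrib)
  qed
  moreover have "g t = g0 t" if "\<bar>t\<bar> < \<delta>" for t
    using g_eq[of t 0] that g0[OF that] by (simp add: q_def)
  ultimately show thesis using that carrier by blast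
qed

context lie_chart
begin

text \<open>Near any t0 the extended homomorphism is a left translate of the local integral curve,
  so smoothness on the whole line follows from that of left translations.\<close>

theorem one_parameter_subgroup:
  obtains g where "smooth_map euclidean_manifold M g" "\<And>t. g t \<in> carrier G" "\<And>s t. g (s + t) = g s \<otimes> g t"
    "(\<phi> \<circ> g has_vector_derivative X) (at 0)"
proof -
  obtain \<gamma> \<delta> where \<delta>: "\<delta> > 0" and \<gamma>0: "\<gamma> 0 = e" and sm: "smooth_on {-\<delta><..<\<delta>} \<gamma>"
    and \<gamma>\<Omega>: "\<And>t. \<bar>t\<bar> < \<delta> \<Longrightarrow> \<gamma> t \<in> \<Omega>"
    and \<gamma>: "\<And>t. \<bar>t\<bar> < \<delta> \<Longrightarrow> (\<gamma> has_vector_derivative lfield X (\<gamma> t)) (at t)"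
    and hom: "\<And>s t. \<bar>s\<bar> < \<delta> \<Longrightarrow> \<bar>t\<bar> < \<delta> \<Longrightarrow> \<bar>s + t\<bar> < \<delta> \<Longrightarrow> \<psi> (\<gamma> (s + t)) = \<psi> (\<gamma> s) \<otimes> \<psi> (\<gamma> t)"
    using local_one_parameter[of X] by metis
  obtain g where gc: "\<And>t. g t \<in> carrier G" and ghom: "\<And>s t. g (s + t) = g s \<otimes> g t"
    and g\<gamma>: "\<And>t. \<bar>t\<bar> < \<delta> \<Longrightarrow> g t = \<psi> (\<gamma> t)"
    using extend_local_homomorphism[OF \<delta>, of "\<lambda>t. \<psi> (\<gamma> t)"] phi_psi(3)[OF \<gamma>\<Omega>] hom by metis
  have near: "g t = g t0 \<otimes> \<psi> (\<gamma> (t - t0))" if "t \<in> ball t0 \<delta>" for t t0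
    using ghom[of t0 "t - t0"] g\<gamma>[of "t - t0"] that by (simp add: dist_real_def)
  have shift_cont: "continuous_on (ball t0 \<delta>) (\<lambda>t. \<gamma> (t - t0))" for t0
    by (rule continuous_on_compose2[OF smooth_on_continuous[OF sm]])
       (auto intro!: continuous_intros simp: dist_real_def)
  have shift_smooth: "smooth_on (ball t0 \<delta>) (\<lambda>t. \<gamma> (t - t0))" for t0
  proof (rule smooth_on_compose[OF open_ball _ sm])
    have "smooth_on (ball t0 \<delta>) (\<lambda>t. t + - t0)"
      unfolding smooth_on_def by (intro allI Ck_on_add Ck_on_ident Ck_on_const open_ball)
    then show "smooth_on (ball t0 \<delta>) (\<lambda>t. t - t0)" by simp
  qed (auto simp: dist_real_def)
  have shift_Omega: "\<gamma> (t - t0) \<in> \<Omega>" if "t \<in> ball t0 \<delta>" for t t0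
    using that by (intro \<gamma>\<Omega>) (simp add: dist_real_def)
  have cont: "continuous_map euclidean (mtop M) g"
    unfolding continuous_map_def
  proof (intro conjI allI impI)
    show "g \<in> topspace euclidean \<rightarrow> topspace (mtop M)" using gc topspace_eq_carrier by auto
    fix V assume V: "openin (mtop M) V"
    have "open {t. g t \<in> V}"
    proof (subst open_subopen, intro ballI)
      fix t0 assume t0: "t0 \<in> {t. g t \<in> V}"
      have "openin (mtop M) {x \<in> topspace (mtop M). g t0 \<otimes> x \<in> V}"
        using smooth_left[OF gc[of t0]] V by (auto simp: smooth_map_def intro: openin_continuous_map_preimage)
      from open_psi_preimage[OF this]
      have "open (ball t0 \<delta> \<inter> (\<lambda>t. \<gamma> (t - t0)) -` {x \<in> \<Omega>. \<psi> x \<in> {x \<in> topspace (mtop M). g t0 \<otimes> x \<in> V}})" (is "open ?T")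
        by (rule continuous_open_preimage[OF shift_cont open_ball])
      moreover have "t0 \<in> ?T" using t0 \<delta> gc[of t0] by (simp add: \<gamma>0 e_Omega topspace_eq_carrier)
      moreover have "?T \<subseteq> {t. g t \<in> V}" using near by auto
      ultimately show "\<exists>T. open T \<and> t0 \<in> T \<and> T \<subseteq> {t. g t \<in> V}" by blast
    qed
    then show "openin euclidean {t \<in> topspace euclidean. g t \<in> V}" by simp
  qed
  have smooth: "smooth_map euclidean_manifold M g"
  proof (rule smooth_mapI[OF charted_euclidean charted_M])
    show "continuous_map (mtop euclidean_manifold) (mtop M) g" by (simp add: euclidean_manifold_simps cont)
    fix t0 :: real
    obtain d where d: "d \<in> charts_at M (g t0)"
      using ex_chart[of "g t0"] gc topspace_eq_carrier by blast
    note dA = charts_atD[OF d]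
    let ?L = "\<lambda>x. g t0 \<otimes> x"
    let ?W = "\<phi> ` (fst c \<inter> ?L -` fst d)"
    note rep = smooth_rep[OF charted_M charted_M smooth_left[OF gc[of t0]] cA(1) dA(1)]
    define U where "U = ball t0 \<delta> \<inter> (\<lambda>t. \<gamma> (t - t0)) -` ?W"
    have oU: "open U" unfolding U_def by (rule continuous_open_preimage[OF shift_cont open_ball rep(1)])
    have "\<gamma> (t0 - t0) \<in> ?W" using cA dA gc[of t0] by (auto simp: \<gamma>0)
    then have t0U: "t0 \<in> U" using \<delta> by (simp add: U_def)
    have gU: "g t \<in> fst d" if "t \<in> U" for t
    proof -
      obtain p where p: "p \<in> fst c" "?L p \<in> fst d" "\<gamma> (t - t0) = \<phi> p" using \<open>t \<in> U\<close> by (auto simp: U_def)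
      then have "\<psi> (\<gamma> (t - t0)) = p" using psi_phi by simp
      then show ?thesis using near[of t t0] that p by (simp add: U_def)
    qed
    have "smooth_on U (\<lambda>t. (snd d \<circ> ?L \<circ> \<psi>) (\<gamma> (t - t0)))"
      by (rule smooth_on_compose[OF oU smooth_on_subset[OF shift_smooth[of t0]] rep(2)]) (auto simp: U_def)
    then have "smooth_on U (snd d \<circ> g \<circ> chart_inv (UNIV, id))"
      by (rule smooth_on_cong[OF oU]) (use near in \<open>auto simp: chart_inv_id U_def\<close>)
    then show "smooth_at euclidean_manifold M g t0"
      unfolding smooth_at_def using oU t0U gU
      by (intro bexI[of _ "(UNIV, id)"] bexI[OF _ d] exI[of _ U])
         (auto simp: euclidean_manifold_simps charts_at_def)
  qed
  have "(\<phi> \<circ> g has_vector_derivative X) (at 0)"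
  proof (rule has_vector_derivative_transform_within_open[of \<gamma> _ _ "ball 0 \<delta>"])
    show "(\<gamma> has_vector_derivative X) (at 0)" using \<gamma>[of 0] \<delta> by (simp add: \<gamma>0 lfield_e)
    show "\<gamma> t = (\<phi> \<circ> g) t" if "t \<in> ball 0 \<delta>" for t
      using that g\<gamma>[of t] phi_psi(1)[OF \<gamma>\<Omega>[of t]] by (simp add: dist_real_def)
  qed (use \<delta> in auto)
  then show thesis using that smooth gc ghom by blast
qed

end

section \<open>Homogeneous spaces\<close>

text \<open>For a linear right inverse \<open>R\<close> of the differential, the map
  \<open>k\<close> sending \<open>y\<close> to \<open>F (x + R y)\<close> has the identity as
  derivative at 0. Inverting it locally gives the section.\<close>

lemma submersion_local_section:
  fixes F :: "'a::euclidean_space \<Rightarrow> 'b::euclidean_space"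
  assumes S: "open S" "x \<in> S" and F: "smooth_on S F" and surj: "surj (frechet_derivative F (at x))"
  shows "\<exists>V s s'. open V \<and> F x \<in> V \<and> s (F x) = x \<and> (s has_derivative s') (at (F x)) \<and>
    (\<forall>z\<in>V. s z \<in> S \<and> F (s z) = z)"
proof -
  have dF: "(F has_derivative frechet_derivative F (at z)) (at z)" if "z \<in> S" for z
    by (rule smooth_on_has_derivative[OF F that])
  obtain R where R: "linear R" "frechet_derivative F (at x) \<circ> R = id"
    using linear_surjective_right_inverse[OF has_derivative_linear[OF dF[OF S(2)]] surj] by blast
  have bR: "bounded_linear R" using R(1) by (simp add: linear_conv_bounded_linear)
  define U where "U = (\<lambda>y. x + R y) -` S"
  have contR: "continuous_on UNIV (\<lambda>y. x + R y)"
    by (intro continuous_intros bounded_linear.continuous_on[OF bR])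
  have oU: "open U" unfolding U_def by (rule open_vimage[OF S(1) contR])
  have U0: "0 \<in> U" using S(2) by (simp add: U_def linear_0[OF R(1)])
  define k where "k y = F (x + R y)" for y
  define D where "D y = (\<lambda>v. frechet_derivative F (at (x + R y)) (R v))" for y
  have dk: "(k has_derivative D y) (at y)" if "y \<in> U" for y
  proof -
    have "((\<lambda>y. x + R y) has_derivative R) (at y)"
      by (auto intro!: derivative_eq_intros bounded_linear_imp_has_derivative bR)
    then show ?thesis unfolding k_def D_def
      by (rule has_derivative_compose) (use that in \<open>simp add: U_def dF\<close>)
  qed
  have bl: "blinfun_apply (Blinfun (D y)) = D y" if "y \<in> U" for y
    by (rule bounded_linear_Blinfun_apply[OF has_derivative_bounded_linear[OF dk[OF that]]])
  have "continuous_on U (\<lambda>y. Blinfun (D y))"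
  proof (rule continuous_on_blinfun_componentwise)
    fix i :: 'b
    have "continuous_on U (\<lambda>y. D y i)" unfolding D_def
      by (rule continuous_on_compose2[OF smooth_on_continuous[OF smooth_on_frechet[OF F]]
            continuous_on_subset[OF contR]]) (auto simp: U_def)
    then show "continuous_on U (\<lambda>y. blinfun_apply (Blinfun (D y)) i)"
      by (rule continuous_on_eq) (simp add: bl)
  qed
  moreover have "id_blinfun o\<^sub>L Blinfun (D 0) = id_blinfun"
    using fun_cong[OF R(2)] by (intro blinfun_eqI) (simp add: bl U0, simp add: D_def linear_0[OF R(1)])
  ultimately obtain U' V g g' where g: "open U'" "U' \<subseteq> U" "0 \<in> U'" "open V" "k 0 \<in> V"
      "homeomorphism U' V k g" "\<And>y. y \<in> V \<Longrightarrow> (g has_derivative (g' y)) (at y)"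
    using inverse_function_theorem[OF oU, of k "\<lambda>y. Blinfun (D y)" 0 id_blinfun] dk bl U0 by metis
  have k0: "k 0 = F x" by (simp add: k_def linear_0[OF R(1)])
  have g0: "g (F x) = 0" using g(3,6) k0 by (metis homeomorphism_apply1)
  have "((\<lambda>z. x + R (g z)) has_derivative (\<lambda>v. R (g' (F x) v))) (at (F x))"
    using g(5,7) k0 by (auto intro!: derivative_eq_intros bounded_linear.has_derivative[OF bR])
  moreover have "x + R (g z) \<in> S \<and> F (x + R (g z)) = z" if "z \<in> V" for z
    using g(2,6) that homeomorphism_image2[OF g(6)] homeomorphism_apply2[OF g(6) that]
    by (auto simp: U_def k_def)
  ultimately show ?thesis
    using g(4,5) k0 g0 linear_0[OF R(1)]
    by (intro exI[of _ V] exI[of _ "\<lambda>z. x + R (g z)"] exI[of _ "\<lambda>v. R (g' (F x) v)"]) auto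
qed

lemma immersion_locally_injective:
  fixes F :: "'a::euclidean_space \<Rightarrow> 'b::euclidean_space"
  assumes S: "open S" "x \<in> S" and F: "smooth_on S F" and inj: "inj (frechet_derivative F (at x))"
  shows "\<exists>r>0. ball x r \<subseteq> S \<and> inj_on F (ball x r)"
proof -
  let ?D = "\<lambda>z. frechet_derivative F (at z)"
  have dF: "(F has_derivative ?D z) (at z)" if "z \<in> S" for z
    by (rule smooth_on_has_derivative[OF F that])
  obtain R where R: "linear R" "R \<circ> ?D x = id"
    using linear_injective_left_inverse[OF has_derivative_linear[OF dF[OF S(2)]] inj] by blast
  have bl: "blinfun_apply (Blinfun (?D z)) = ?D z" if "z \<in> S" for z
    by (rule bounded_linear_Blinfun_apply[OF has_derivative_bounded_linear[OF dF[OF that]]])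
  have cont: "continuous_on S (\<lambda>z. Blinfun (?D z))"
  proof (rule continuous_on_blinfun_componentwise)
    show "continuous_on S (\<lambda>z. blinfun_apply (Blinfun (?D z)) i)" for i
      by (rule continuous_on_eq[OF smooth_on_continuous[OF smooth_on_frechet[OF F, of i]]]) (simp add: bl)
  qed
  have "\<exists>d>0. \<forall>z. dist x z < d \<longrightarrow> onorm (\<lambda>v. ?D z v - ?D x v) < \<epsilon>" if pos: "\<epsilon> > 0" for \<epsilon>
  proof -
    obtain d1' where d1: "d1' > 0" "ball x d1' \<subseteq> S" using S open_contains_ball by blast
    have "isCont (\<lambda>z. Blinfun (?D z)) x" using cont S continuous_on_eq_continuous_at by blast
    then obtain d2 where d2: "d2 > 0" "\<And>z. dist z x < d2 \<Longrightarrow> dist (Blinfun (?D z)) (Blinfun (?D x)) < \<epsilon>"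
      unfolding continuous_at_eps_delta using pos by metis
    have "onorm (\<lambda>v. ?D z v - ?D x v) < \<epsilon>" if "dist x z < min d1' d2" for z
    proof -
      have "z \<in> S" using that d1 by auto
      then have "onorm (\<lambda>v. ?D z v - ?D x v) = norm (Blinfun (?D z) - Blinfun (?D x))"
        by (simp add: norm_blinfun.rep_eq blinfun.diff_left bl S fun_diff_def minus_blinfun.rep_eq)
      also have "\<dots> < \<epsilon>" using d2(2)[of z] that by (simp add: dist_norm norm_minus_commute)
      finally show ?thesis .
    qed
    then show ?thesis using d1 d2 by (intro exI[of _ "min d1' d2"]) auto
  qed
  then obtain r where "r > 0" "ball x r \<subseteq> S" "inj_on F (ball x r)"
    using has_derivative_locally_injective[OF S(2,1) R(1)[unfolded linear_conv_bounded_linear] R(2) dF]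
    by metis
  then show ?thesis by blast
qed

locale homogeneous = lie_chart G M c for G :: "('g, 'm) monoid_scheme" (structure)
    and M :: "('g, 'e::euclidean_space) manifold" and c +
  fixes H :: "'g set" and N :: "('g set, 'f::euclidean_space) manifold" and d :: "('g set, 'f) chart"
  assumes H: "subgroup H G" and quot: "quotient_manifold G M H N"
    and d: "d \<in> charts_at N H"
begin

definition "\<pi> a = a <# H"
definition "p x = snd d (\<pi> (\<psi> x))"
definition "Dp = tangent_map c d \<pi> \<one>"
definition "translation_map d' a = tangent_map d d' (\<lambda>q. a <# q) H"

lemma H_sub: "H \<subseteq> carrier G" by (rule subgroup.subset[OF H])

lemma pi_one: "\<pi> \<one> = H" by (simp add: \<pi>_def lcos_mult_one H_sub)

lemma smooth_N: "smooth_manifold N" and top_N: "topspace (mtop N) = lcosets H"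
  and subm: "smooth_submersion M N \<pi>"
  using quot by (auto simp: quotient_manifold_def \<pi>_def[abs_def])

lemma charted_N: "charted N"
proof -
  interpret smooth_manifold N by (rule smooth_N)
  show ?thesis by unfold_locales
qed

interpretation N: charted N by (rule charted_N)

lemmas dA = N.charts_atD[OF d]

lemma smooth_pi: "smooth_map M N \<pi>" using subm by (simp add: smooth_submersion_def)

lemma pi_mult: "a \<in> carrier G \<Longrightarrow> x \<in> carrier G \<Longrightarrow> \<pi> (a \<otimes> x) = a <# \<pi> x"
  by (simp add: \<pi>_def lcos_m_assoc H_sub)

lemma pi_eq_H: assumes "a \<in> carrier G" shows "\<pi> a = H \<longleftrightarrow> a \<in> H"
proof
  assume "\<pi> a = H" then show "a \<in> H" using lcos_self[OF assms H] by (simp add: \<pi>_def)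
next
  assume "a \<in> H" then show "\<pi> a = H" unfolding \<pi>_def
    using H assms by (metis coset_join3)
qed

lemma pi_right: assumes "a \<in> carrier G" "h \<in> H" shows "\<pi> (a \<otimes> h) = \<pi> a"
proof -
  have "h \<in> carrier G" using assms H_sub by blast
  then have "\<pi> (a \<otimes> h) = a <# H" using pi_mult[of a h] pi_eq_H[of h] assms by simp
  then show ?thesis by (simp add: \<pi>_def)
qed

definition "p_dom = {x \<in> \<Omega>. \<pi> (\<psi> x) \<in> fst d}"

lemma p_dom_image: "\<phi> ` (fst c \<inter> \<pi> -` fst d) = p_dom"
  unfolding p_dom_def \<Omega>_def by (auto simp: psi_phi)

lemma open_p_dom: "open p_dom"
  using smooth_rep(1)[OF charted_M charted_N smooth_pi cA(1) dA(1)] unfolding p_dom_image .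

lemma smooth_p: "smooth_on p_dom p"
  using smooth_rep(2)[OF charted_M charted_N smooth_pi cA(1) dA(1)] unfolding p_dom_image
  by (simp add: p_def[abs_def] o_def)

lemma e_p_dom: "e \<in> p_dom" using dA by (simp add: p_dom_def e_Omega pi_one)

lemma p_e: "p e = snd d H" by (simp add: p_def pi_one)

lemma Dp_eq: "Dp = frechet_derivative p (at e)"
  by (simp add: Dp_def tangent_map_def p_def[abs_def] o_def)

lemma Dp_deriv: "(p has_derivative Dp) (at e)"
  unfolding Dp_eq by (rule smooth_on_has_derivative[OF smooth_p e_p_dom])

lemma linear_Dp: "linear Dp" by (rule has_derivative_linear[OF Dp_deriv])

lemma surj_Dp: "surj Dp"
  using subm c d pi_one unfolding smooth_submersion_def Dp_def
  by (metis chart_dom_sub cA subsetD)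

text \<open>With a local section \<open>s\<close> of the projection, the translation of G/H near the
  base point is z -> \<pi>(a s(z)), a composite of maps with known derivatives.\<close>

lemma tau_deriv:
  assumes a: "a \<in> carrier G" and d': "d' \<in> charts_at N (\<pi> a)"
  shows "((snd d' \<circ> (\<lambda>q. a <# q) \<circ> chart_inv d) has_derivative translation_map d' a) (at (snd d H))"
proof -
  note d'A = N.charts_atD[OF d']
  obtain V s s' where V: "open V" "p e \<in> V" and s: "s (p e) = e" "(s has_derivative s') (at (p e))"
    "\<And>z. z \<in> V \<Longrightarrow> s z \<in> p_dom" "\<And>z. z \<in> V \<Longrightarrow> p (s z) = z"
    using submersion_local_section[OF open_p_dom e_p_dom smooth_p] surj_Dp unfolding Dp_eq by metis
  have sm: "smooth_map M N (\<pi> \<circ> (\<lambda>x. a \<otimes> x))"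
    by (rule smooth_map_compose[OF charted_M charted_M charted_N smooth_left[OF a] smooth_pi])
  have "d' \<in> charts_at N ((\<pi> \<circ> (\<lambda>x. a \<otimes> x)) \<one>)" using d' a by simp
  then have "((snd d' \<circ> (\<pi> \<circ> (\<lambda>x. a \<otimes> x)) \<circ> \<psi>) has_derivative tangent_map c d' (\<pi> \<circ> (\<lambda>x. a \<otimes> x)) \<one>) (at (s (p e)))"
    unfolding s(1) by (rule tangent_map_has_derivative[OF charted_M charted_N sm c])
  from has_derivative_compose[OF s(2) this]
  have "((snd d' \<circ> (\<lambda>q. a <# q) \<circ> chart_inv d) has_derivative
    (\<lambda>v. tangent_map c d' (\<pi> \<circ> (\<lambda>x. a \<otimes> x)) \<one> (s' v))) (at (p e))"
  proof (rule has_derivative_transform_within_open[OF _ V])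
    fix z assume z: "z \<in> V"
    have "\<pi> (\<psi> (s z)) \<in> fst d" "\<psi> (s z) \<in> carrier G"
      using s(3)[OF z] phi_psi(3) by (auto simp: p_dom_def)
    moreover from this have "chart_inv d z = \<pi> (\<psi> (s z))"
      using s(4)[OF z] N.chart_inv_chart[OF dA(1)] unfolding p_def by metis
    ultimately show "(snd d' \<circ> (\<pi> \<circ> (\<lambda>x. a \<otimes> x)) \<circ> \<psi>) (s z) = (snd d' \<circ> (\<lambda>q. a <# q) \<circ> chart_inv d) z"
      by (simp add: pi_mult a)
  qed
  then show ?thesis
    unfolding translation_map_def tangent_map_def p_e using differentiable_def frechet_derivative_works by blast
qed

text \<open>For \<open>a\<close> in \<open>H\<close> the right factor \<open>inv a\<close> is
  absorbed by the coset, so the projection turns conjugation by \<open>a\<close> into translation by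
  \<open>a\<close>.\<close>

lemma Dp_Adl:
  assumes a: "a \<in> H" shows "Dp (Adl a v) = translation_map d a (Dp v)"
proof -
  have ac: "a \<in> carrier G" using a H_sub by auto
  have "d \<in> charts_at N (\<pi> a)" using d pi_eq_H[OF ac] a by simp
  note tau = tau_deriv[OF ac this]
  have "((\<lambda>x. p (cjl a x)) has_derivative (\<lambda>v. Dp (Adl a v))) (at e)"
    by (rule has_derivative_compose[OF Adl_deriv[OF ac]]) (simp add: cjl_e ac Dp_deriv)
  moreover have "((\<lambda>x. (snd d \<circ> (\<lambda>q. a <# q) \<circ> chart_inv d) (p x)) has_derivative (\<lambda>v. translation_map d a (Dp v))) (at e)"
    by (rule has_derivative_compose[OF Dp_deriv]) (unfold p_e, rule tau)
  then have "((\<lambda>x. p (cjl a x)) has_derivative (\<lambda>v. translation_map d a (Dp v))) (at e)"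
  proof (rule has_derivative_transform_within_open[where s = "p_dom \<inter> cj_dom a"])
    fix x assume x: "x \<in> p_dom \<inter> cj_dom a"
    then have xc: "\<psi> x \<in> carrier G" using phi_psi(3) cjl_Omega(1) by blast
    have "\<pi> (a \<otimes> \<psi> x \<otimes> inv a) = a <# \<pi> (\<psi> x)"
      using pi_right[of "a \<otimes> \<psi> x" "inv a"] ac xc a subgroup.m_inv_closed[OF H] by (simp add: pi_mult)
    then show "(snd d \<circ> (\<lambda>q. a <# q) \<circ> chart_inv d) (p x) = p (cjl a x)"
      using x N.chart_inv_chart[OF dA(1)] by (simp add: p_def cjl_Omega p_dom_def)
  qed (use open_p_dom open_cj_dom[OF ac] e_p_dom e_cj_dom[OF ac] in auto)
  ultimately show ?thesis using has_derivative_unique by metis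
qed

section \<open>The kernel of the projection and the Lie algebra of \<open>H\<close>\<close>

lemma pow_in_H: "h \<in> H \<Longrightarrow> h [^] (n :: nat) \<in> H"
  by (induction n) (simp_all add: subgroup.one_closed[OF H] subgroup.m_closed[OF H])

lemma one_parameter_pow:
  assumes "\<And>t. g t \<in> carrier G" "\<And>s t. g (s + t) = g s \<otimes> g t"
  shows "g (real (Suc n) * t) = g t [^] Suc n"
proof (induction n)
  case 0 then show ?case using assms by simp
next
  case (Suc n)
  have "g (real (Suc (Suc n)) * t) = g (real (Suc n) * t + t)" by (simp add: algebra_simps)
  then show ?case using Suc assms by simp
qed

lemma one_parameter_zero:
  assumes "\<And>t. g t \<in> carrier G" "\<And>s t. g (s + t) = g s \<otimes> (g t :: 'g)"
  shows "g (0 :: real) = \<one>"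
  using assms(2)[of 0 0] assms(1)[of 0] by simp

lemma one_parameter_near:
  assumes g: "smooth_map euclidean_manifold M g" and U: "openin (mtop M) U" "g (0 :: real) \<in> U"
  shows "\<exists>\<epsilon>>0. \<forall>t. \<bar>t\<bar> < \<epsilon> \<longrightarrow> g t \<in> U"
proof -
  have "continuous_map euclidean (mtop M) g"
    using g by (simp add: smooth_map_def euclidean_manifold_simps)
  from openin_continuous_map_preimage[OF this U(1)] have "open {t. g t \<in> U}" by simp
  then obtain \<epsilon> where "\<epsilon> > 0" "ball 0 \<epsilon> \<subseteq> {t. g t \<in> U}" using U(2) open_contains_ball by (metis mem_Collect_eq)
  then show ?thesis by (intro exI[of _ \<epsilon>]) (auto simp: dist_real_def subset_eq)
qed

abbreviation "\<hh> \<equiv> subgroup_lie_algebra G M c H"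

lemma openin_pi_preimage: "openin (mtop N) U \<Longrightarrow> openin (mtop M) {q \<in> topspace (mtop M). \<pi> q \<in> U}"
  using smooth_pi by (auto simp: smooth_map_def intro: openin_continuous_map_preimage)

lemma p_one_parameter_deriv:
  assumes g: "smooth_map euclidean_manifold M g" "\<And>t. g t \<in> carrier G" "\<And>s t. g (s + t) = g s \<otimes> g t"
    and X: "(\<phi> \<circ> g has_vector_derivative X) (at 0)"
  shows "((\<lambda>t. snd d (\<pi> (g t))) has_vector_derivative Dp X) (at 0)"
proof -
  have g0: "g 0 = \<one>" using one_parameter_zero g(2,3) by metis
  obtain \<epsilon> where \<epsilon>: "\<epsilon> > 0" "\<And>t. \<bar>t\<bar> < \<epsilon> \<Longrightarrow> g t \<in> fst c"
    using one_parameter_near[OF g(1) chart_dom_open[OF cA(1)]] g0 cA(2) by metis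
  have "((\<lambda>t. p ((\<phi> \<circ> g) t)) has_derivative (\<lambda>h. Dp (h *\<^sub>R X))) (at 0)"
    by (rule has_derivative_compose[OF X[unfolded has_vector_derivative_def]]) (simp add: g0 Dp_deriv)
  then have "((\<lambda>t. p ((\<phi> \<circ> g) t)) has_vector_derivative Dp X) (at 0)"
    by (simp add: has_vector_derivative_def linear_scale[OF linear_Dp])
  then show ?thesis
    by (rule has_vector_derivative_transform_within_open[of _ _ _ "ball 0 \<epsilon>"])
       (use \<epsilon> in \<open>auto simp: p_def psi_phi dist_real_def\<close>)
qed

theorem kernel_Dp: "{X. Dp X = 0} = \<hh>"
proof (intro equalityI subsetI CollectI)
  fix X assume "X \<in> \<hh>"
  then obtain g where g: "smooth_map euclidean_manifold M g" "\<And>s t. g (s + t) = g s \<otimes> g t"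
    "\<And>t. g t \<in> H" "(\<phi> \<circ> g has_vector_derivative X) (at 0)"
    unfolding subgroup_lie_algebra_def by blast
  have gc: "g t \<in> carrier G" for t using g(3) H_sub by blast
  have "((\<lambda>t. snd d (\<pi> (g t))) has_vector_derivative Dp X) (at 0)"
    by (rule p_one_parameter_deriv[OF g(1) gc g(2,4)])
  moreover have "(\<lambda>t. snd d (\<pi> (g t))) = (\<lambda>t. snd d H)" using g(3) pi_eq_H[OF gc] by auto
  ultimately show "Dp X = 0"
    using vector_derivative_unique_at[of "\<lambda>t. snd d H" "Dp X" 0 0] by simp
next
  fix X assume "X \<in> {X. Dp X = 0}"
  then have X: "Dp X = 0" by simp
  obtain g where g: "smooth_map euclidean_manifold M g" and gc: "\<And>t. g t \<in> carrier G"
    and ghom: "\<And>s t. g (s + t) = g s \<otimes> g t" and gX: "(\<phi> \<circ> g has_vector_derivative X) (at 0)"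
    using one_parameter_subgroup[of X] by metis
  have g0: "g 0 = \<one>" using one_parameter_zero gc ghom by metis
  obtain \<epsilon> where \<epsilon>: "\<epsilon> > 0" "\<And>t. \<bar>t\<bar> < \<epsilon> \<Longrightarrow> g t \<in> {q \<in> topspace (mtop M). \<pi> q \<in> fst d}"
    using one_parameter_near[OF g openin_pi_preimage[OF N.chart_dom_open[OF dA(1)]]] gc[of 0] dA(2)
    by (metis (no_types, lifting) g0 mem_Collect_eq pi_one topspace_eq_carrier)
  define f where "f t = snd d (\<pi> (g t))" for t
  have der0: "(f has_derivative (\<lambda>h. 0)) (at 0)"
    using p_one_parameter_deriv[OF g gc ghom gX] X by (simp add: f_def[abs_def] has_vector_derivative_def)
  \<comment> \<open>Translation by \<open>g t0\<close> carries the projected curve near 0 to the one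
    near \<open>t0\<close>. Being differentiable at the base point, it carries velocity zero to
    velocity zero.\<close>
  have der: "(f has_derivative (\<lambda>h. 0)) (at t0)" if t0: "\<bar>t0\<bar> < \<epsilon>" for t0
  proof -
    have "\<pi> (g t0) \<in> fst d" using \<epsilon>(2)[OF t0] by simp
    then have "d \<in> charts_at N (\<pi> (g t0))" using dA by (simp add: charts_at_def)
    note tau = tau_deriv[OF gc this]
    have f0: "f 0 = snd d H" by (simp add: f_def g0 pi_one)
    have shift: "((\<lambda>t. t - t0) has_derivative (\<lambda>h. h)) (at t0)" by (auto intro!: derivative_eq_intros)
    have "((\<lambda>s. (snd d \<circ> (\<lambda>q. g t0 <# q) \<circ> chart_inv d) (f s)) has_derivative (\<lambda>h. translation_map d (g t0) 0)) (at 0)"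
      by (rule has_derivative_compose[OF der0]) (unfold f0, rule tau)
    then have "((\<lambda>t. (snd d \<circ> (\<lambda>q. g t0 <# q) \<circ> chart_inv d) (f (t - t0))) has_derivative (\<lambda>h. translation_map d (g t0) 0)) (at t0)"
      by (intro has_derivative_compose[OF shift]) simp
    moreover have "translation_map d (g t0) 0 = 0" using linear_0[OF has_derivative_linear[OF tau]] .
    ultimately have "((\<lambda>t. (snd d \<circ> (\<lambda>q. g t0 <# q) \<circ> chart_inv d) (f (t - t0))) has_derivative (\<lambda>h. 0)) (at t0)"
      by simp
    then show ?thesis
    proof (rule has_derivative_transform_within_open[where s = "ball t0 \<epsilon>"])
      fix t assume "t \<in> ball t0 \<epsilon>"
      then have "\<pi> (g (t - t0)) \<in> fst d" using \<epsilon>(2)[of "t - t0"] by (simp add: dist_real_def abs_minus_commute)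
      then have "chart_inv d (f (t - t0)) = \<pi> (g (t - t0))" unfolding f_def by (rule N.chart_inv_chart[OF dA(1)])
      moreover have "g t = g t0 \<otimes> g (t - t0)" using ghom[of t0 "t - t0"] by simp
      ultimately show "(snd d \<circ> (\<lambda>q. g t0 <# q) \<circ> chart_inv d) (f (t - t0)) = f t"
        by (simp add: f_def pi_mult gc)
    qed (use \<epsilon>(1) in auto)
  qed
  have near: "g t \<in> H" if t: "\<bar>t\<bar> < \<epsilon>" for t
  proof -
    have "f t = f 0"
    proof (rule has_derivative_zero_unique[of "ball 0 \<epsilon>" f])
      show "(f has_derivative (\<lambda>h. 0)) (at s within ball 0 \<epsilon>)" if "s \<in> ball 0 \<epsilon>" for s
        using that by (intro has_derivative_at_withinI[OF der]) (simp add: dist_real_def)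
    qed (use t \<epsilon>(1) in \<open>simp_all add: dist_real_def\<close>)
    then have "snd d (\<pi> (g t)) = snd d (\<pi> (g 0))" by (simp add: f_def)
    then have "\<pi> (g t) = \<pi> (g 0)"
      by (rule inj_onD[OF N.chart_inj[OF dA(1)]]) (use \<epsilon>(2)[OF t] \<epsilon>(2)[of 0] \<epsilon>(1) in simp_all)
    then show ?thesis using pi_eq_H[OF gc[of t]] by (simp add: g0 pi_one)
  qed
  \<comment> \<open>Any value of the subgroup is a power of a value close to the identity.\<close>
  have "g t \<in> H" for t
  proof -
    obtain n where n: "\<bar>t\<bar> / \<epsilon> < real (Suc n)" using reals_Archimedean2 by (metis less_Suc_eq of_nat_less_iff order_less_trans)
    then have "\<bar>t / real (Suc n)\<bar> < \<epsilon>" using \<epsilon>(1) by (simp add: abs_divide field_simps)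
    from pow_in_H[OF near[OF this], of "Suc n"]
    show ?thesis using one_parameter_pow[of g n "t / real (Suc n)"] gc ghom by simp
  qed
  then show "X \<in> \<hh>" unfolding subgroup_lie_algebra_def using g ghom gX by blast
qed

lemma Dp_lie_bracket_deriv:
  assumes g: "smooth_map euclidean_manifold M g" "\<And>t. g t \<in> carrier G" "\<And>s t. g (s + t) = g s \<otimes> g t"
    and X: "(\<phi> \<circ> g has_vector_derivative X) (at 0)"
  shows "((\<lambda>t. Dp (Adl (g t) v)) has_vector_derivative Dp (lie_bracket G c X v)) (at 0)"
proof -
  have g0: "g 0 = \<one>" using one_parameter_zero g(2,3) by metis
  obtain \<epsilon> where \<epsilon>: "\<epsilon> > 0" "\<And>t. \<bar>t\<bar> < \<epsilon> \<Longrightarrow> g t \<in> fst c"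
    using one_parameter_near[OF g(1) chart_dom_open[OF cA(1)]] g0 cA(2) by metis
  have "((\<lambda>t. Adl (\<psi> ((\<phi> \<circ> g) t)) v) has_derivative (\<lambda>h. lie_bracket G c (h *\<^sub>R X) v)) (at 0)"
    by (rule has_derivative_compose[OF X[unfolded has_vector_derivative_def]]) (simp add: g0 Adl_has_derivative)
  moreover have "lie_bracket G c (h *\<^sub>R X) v = h *\<^sub>R lie_bracket G c X v" for h
    using linear_scale[OF has_derivative_linear[OF Adl_has_derivative]] .
  ultimately have "((\<lambda>t. Adl (\<psi> ((\<phi> \<circ> g) t)) v) has_vector_derivative lie_bracket G c X v) (at 0)"
    by (simp add: has_vector_derivative_def)
  then have "((\<lambda>t. Adl (g t) v) has_vector_derivative lie_bracket G c X v) (at 0)"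
    by (rule has_vector_derivative_transform_within_open[of _ _ _ "ball 0 \<epsilon>"])
       (use \<epsilon> in \<open>auto simp: psi_phi dist_real_def\<close>)
  then show ?thesis
    by (rule bounded_linear.has_vector_derivative[OF linear_Dp[unfolded linear_conv_bounded_linear]])
qed

text \<open>An injective differential makes the projection injective near the identity. As
  \<open>H\<close> is one of its fibres, the identity is isolated in \<open>H\<close>, and left
  translation isolates every other point.\<close>

theorem discrete_if_kernel_trivial:
  assumes "\<And>X. Dp X = 0 \<Longrightarrow> X = 0"
  shows "subtopology (mtop M) H = discrete_topology H"
proof -
  have "inj (frechet_derivative p (at e))"
    using assms linear_injective_0[OF linear_Dp] unfolding Dp_eq by blast
  then obtain r where r: "r > 0" "ball e r \<subseteq> p_dom" "inj_on p (ball e r)"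
    using immersion_locally_injective[OF open_p_dom e_p_dom smooth_p] by blast
  define U where "U = {q \<in> fst c. \<phi> q \<in> ball e r}"
  have oU: "openin (mtop M) U" unfolding U_def by (rule chart_cont[OF cA(1) open_ball])
  have U: "q = \<one>" if "q \<in> U" "q \<in> H" for q
  proof -
    have "q \<in> carrier G" using that H_sub by blast
    then have "p (\<phi> q) = p e" using that pi_eq_H[of q] by (simp add: p_def psi_phi U_def pi_one)
    then have "\<phi> q = e" using inj_onD[OF r(3), of "\<phi> q" e] that r(1) by (simp add: U_def)
    then show ?thesis using that psi_phi[of q] by (simp add: U_def)
  qed
  have "\<exists>V. openin (mtop M) V \<and> V \<inter> H = {h}" if h: "h \<in> H" for h
  proof -
    have hc: "h \<in> carrier G" using h H_sub by blast
    define V where "V = {q \<in> topspace (mtop M). inv h \<otimes> q \<in> U}"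
    have "openin (mtop M) V"
      unfolding V_def using smooth_left[of "inv h"] hc oU
      by (auto simp: smooth_map_def intro: openin_continuous_map_preimage)
    moreover have "V \<inter> H = {h}"
    proof (intro equalityI subsetI)
      fix q assume q: "q \<in> V \<inter> H"
      then have "inv h \<otimes> q \<in> H" using h by (simp add: subgroup.m_closed[OF H] subgroup.m_inv_closed[OF H])
      then have "inv h \<otimes> q = \<one>" using U q by (simp add: V_def)
      then show "q \<in> {h}" using hc q H_sub by (metis IntE inv_equality inv_inv inv_closed singletonI subsetD)
    next
      fix q assume "q \<in> {h}"
      moreover have "\<one> \<in> U" using cA r(1) by (simp add: U_def)
      ultimately show "q \<in> V \<inter> H" using h hc by (simp add: V_def topspace_eq_carrier)
    qed
    ultimately show ?thesis by blast
  qed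
  then have "openin (subtopology (mtop M) H) {h}" if "h \<in> H" for h
    using that unfolding openin_subtopology by metis
  moreover have "topspace (subtopology (mtop M) H) = H"
    using H_sub topspace_eq_carrier by auto
  ultimately show ?thesis
    by (metis discrete_topology_unique)
qed

end

section \<open>Lorentz metrics on homogeneous spaces of \<open>SO(1,n)\<close>\<close>

text \<open>The last property is the Lorentz signature in the form needed later: negative definite
  subspaces have dimension at most 1, and so do totally isotropic ones.\<close>

lemma minkowski_polarization:
  fixes Q :: "'f::euclidean_space \<Rightarrow> real"
  assumes "minkowski_form Q"
  shows "\<exists>\<beta>. bilinear \<beta> \<and> (\<forall>v w. \<beta> v w = \<beta> w v) \<and> (\<forall>v. Q v = \<beta> v v) \<and>
    (\<forall>v. (\<forall>w. \<beta> v w = 0) \<longrightarrow> v = 0) \<and>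
    (\<forall>v w. \<beta> v v = 0 \<and> \<beta> w w = 0 \<and> \<beta> v w = 0 \<longrightarrow> (\<exists>s t. (s \<noteq> 0 \<or> t \<noteq> 0) \<and> s *\<^sub>R v + t *\<^sub>R w = 0))"
proof -
  obtain L :: "'f \<Rightarrow> 'f" and b0 where L: "linear L" "bij L" and b0: "b0 \<in> Basis"
    and Q: "\<And>v. Q v = - (L v \<bullet> b0)\<^sup>2 + (\<Sum>b\<in>Basis - {b0}. (L v \<bullet> b)\<^sup>2)"
    using assms unfolding minkowski_form_def by blast
  define \<beta> where "\<beta> v w = L v \<bullet> L w - 2 * (L v \<bullet> b0) * (L w \<bullet> b0)" for v w
  have bil: "bilinear \<beta>"
    unfolding bilinear_def \<beta>_def
    by (auto intro!: linearI simp: linear_add[OF L(1)] linear_scale[OF L(1)] inner_add_left inner_add_right algebra_simps)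
  have Q\<beta>: "Q v = \<beta> v v" for v
  proof -
    have "L v \<bullet> L v = (\<Sum>b\<in>Basis. (L v \<bullet> b)\<^sup>2)"
      by (subst euclidean_inner) (simp add: power2_eq_square)
    also have "\<dots> = (L v \<bullet> b0)\<^sup>2 + (\<Sum>b\<in>Basis - {b0}. (L v \<bullet> b)\<^sup>2)"
      by (rule sum.remove) (use b0 in auto)
    finally show ?thesis by (simp add: Q \<beta>_def power2_eq_square)
  qed
  have L0: "L v = 0 \<Longrightarrow> v = 0" for v
    using L linear_injective_0 bij_is_inj by blast
  have nondeg: "v = 0" if "\<And>w. \<beta> v w = 0" for v
  proof -
    \<comment> \<open>The time reversal of \<open>v\<close> in the coordinates of \<open>L\<close>:
      its product with \<open>v\<close> is the Euclidean square of \<open>L v\<close>.\<close>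
    obtain w where w: "L w = L v - (2 * (L v \<bullet> b0)) *\<^sub>R b0"
      using L(2) by (metis bij_pointE)
    have "\<beta> v w = L v \<bullet> L v"
      using b0 by (simp add: \<beta>_def w inner_diff_left inner_diff_right algebra_simps)
    then show ?thesis using that[of w] L0 by simp
  qed
  have iso: "\<exists>s t. (s \<noteq> 0 \<or> t \<noteq> 0) \<and> s *\<^sub>R v + t *\<^sub>R w = 0"
    if z: "\<beta> v v = 0" "\<beta> w w = 0" "\<beta> v w = 0" for v w
  proof (cases "L v \<bullet> b0 = 0 \<and> L w \<bullet> b0 = 0")
    case True
    then have "v = 0" using z(1) L0 by (simp add: \<beta>_def)
    then show ?thesis by (intro exI[of _ 1] exI[of _ 0]) simp
  next
    case False
    \<comment> \<open>The coefficients cancel the timelike coordinate of \<open>u\<close>. An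
      isotropic vector without timelike coordinate is zero.\<close>
    define s where "s = L w \<bullet> b0"
    define t where "t = - (L v \<bullet> b0)"
    define u where "u = s *\<^sub>R v + t *\<^sub>R w"
    have Lu: "L u = s *\<^sub>R L v + t *\<^sub>R L w" by (simp add: u_def linear_add[OF L(1)] linear_scale[OF L(1)])
    have "L u \<bullet> b0 = 0" by (simp add: Lu inner_add_left inner_diff_left s_def t_def)
    moreover have "\<beta> w v = 0" using z(3) by (simp add: \<beta>_def inner_commute mult_ac)
    then have "\<beta> u u = 0"
      using z by (simp add: u_def bilinear_ladd[OF bil] bilinear_radd[OF bil] bilinear_lmul[OF bil] bilinear_rmul[OF bil])
    ultimately have "u = 0" using L0 by (simp add: \<beta>_def)
    then show ?thesis using False by (intro exI[of _ s] exI[of _ t]) (auto simp: u_def s_def t_def)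
  qed
  have "\<beta> v w = \<beta> w v" for v w by (simp add: \<beta>_def inner_commute)
  then show ?thesis using bil Q\<beta> nondeg iso by blast
qed

text \<open>The closure is taken in \<open>GL\<close>, and a bounded sequence might approach a
  singular map. As the inverses obey the same bound, the pairs of a map and its inverse lie in a
  compact set \<open>K\<close> of mutually inverse pairs, so even the closure in the space of all
  operators stays in \<open>GL\<close>.\<close>

lemma compact_closure_bounded_group:
  fixes S :: "('e::euclidean_space \<Rightarrow>\<^sub>L 'e) set"
  assumes bound: "\<And>T. T \<in> S \<Longrightarrow> norm T \<le> C"
    and inv: "\<And>T. T \<in> S \<Longrightarrow> \<exists>T'\<in>S. T' o\<^sub>L T = id_blinfun \<and> T o\<^sub>L T' = id_blinfun"
  shows "compact (top_of_set GL closure_of S)"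
proof -
  define K where "K = {z. fst z o\<^sub>L snd z = (id_blinfun :: 'e \<Rightarrow>\<^sub>L 'e)} \<inter> {z. snd z o\<^sub>L fst z = id_blinfun} \<inter> (cball (0 :: 'e \<Rightarrow>\<^sub>L 'e) C \<times> cball 0 C)"
  have "closed K" unfolding K_def
    by (intro closed_Int closed_Times closed_cball closed_Collect_eq
        bounded_bilinear.continuous_on[OF bounded_bilinear_blinfun_compose] continuous_intros)
  moreover have "bounded K"
    by (rule bounded_subset[of "cball 0 C \<times> cball 0 C"]) (auto simp: K_def intro: bounded_Times)
  ultimately have "compact K" by (simp add: compact_eq_bounded_closed)
  then have cK: "compact (fst ` K)" by (intro compact_continuous_image continuous_intros)
  have "S \<subseteq> fst ` K"
  proof
    fix T assume T: "T \<in> S"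
    then obtain T' where "T' \<in> S" "T' o\<^sub>L T = id_blinfun" "T o\<^sub>L T' = id_blinfun" using inv by blast
    then have "(T, T') \<in> K" using bound T by (auto simp: K_def)
    then show "T \<in> fst ` K" by force
  qed
  then have sub: "closure S \<subseteq> fst ` K" using cK by (simp add: closure_minimal compact_imp_closed)
  have "fst ` K \<subseteq> GL" by (auto simp: K_def GL_def)
  then have GL: "closure S \<subseteq> GL" using sub by blast
  then have "S \<subseteq> GL" using closure_subset by blast
  then have "top_of_set GL closure_of S = closure S"
    using GL by (simp add: closure_of_subtopology Int_absorb1 Int_absorb2)
  moreover have "compact (closure S)"
    using sub cK by (meson closed_closure closed_Int_compact compact_Int_closed compact_closure compact_imp_bounded bounded_subset bounded_closure_image closure_subset order_trans)
  ultimately show ?thesis by simp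
qed

context homogeneous
begin

lemma bounded_Ad_imp_compact:
  assumes "\<And>a v. a \<in> H \<Longrightarrow> norm (Adl a v) \<le> C * norm v" "C \<ge> 0"
  shows "compact (top_of_set GL closure_of (Ad G c ` H))"
proof (rule compact_closure_bounded_group)
  fix T assume "T \<in> Ad G c ` H"
  then obtain a where a: "a \<in> H" "T = Ad G c a" by auto
  have ac: "a \<in> carrier G" "inv a \<in> carrier G" using a H_sub by auto
  show "norm T \<le> C" using assms a by (intro norm_blinfun_bound) (auto simp: Ad_apply ac)
  have "Ad G c (inv a) \<in> Ad G c ` H" using a subgroup.m_inv_closed[OF H] by blast
  moreover have "Ad G c (inv a) o\<^sub>L T = id_blinfun" "T o\<^sub>L Ad G c (inv a) = id_blinfun"
    by (rule blinfun_eqI; simp add: a Ad_apply ac Adl_inv)+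
  ultimately show "\<exists>T'\<in>Ad G c ` H. T' o\<^sub>L T = id_blinfun \<and> T o\<^sub>L T' = id_blinfun" by blast
qed

text \<open>The form \<open>b\<close> is the pullback of \<beta> along so(1,n) -> \<gg> -> T(G/H).
  Its radical is the image of \<hh> because \<beta> is nondegenerate and \<open>Dp\<close> is
  surjective with kernel \<hh>.\<close>

theorem lie_algebra_classification:
  fixes f :: "'e \<Rightarrow> 'n::finite lmat" and \<beta> :: "'f \<Rightarrow> 'f \<Rightarrow> real"
  assumes n: "CARD('n) \<ge> 2" and f: "lie_isomorphism_so_pq G c f"
    and noncompact: "\<not> compact (top_of_set GL closure_of (Ad G c ` H))"
    and \<beta>: "bilinear \<beta>" "\<And>v w. \<beta> v w = \<beta> w v" "\<And>v. (\<And>w. \<beta> v w = 0) \<Longrightarrow> v = 0"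
      "\<And>v w. \<beta> v v = 0 \<Longrightarrow> \<beta> w w = 0 \<Longrightarrow> \<beta> v w = 0 \<Longrightarrow> \<exists>s t. (s \<noteq> 0 \<or> t \<noteq> 0) \<and> s *\<^sub>R v + t *\<^sub>R w = 0"
    and inv: "\<And>a v w. a \<in> H \<Longrightarrow> \<beta> (translation_map d a v) (translation_map d a w) = \<beta> v w"
  shows "(\<exists>w. eta w w > 0 \<and> f ` \<hh> = {X \<in> so_pq. X *v w = 0}) \<or> (CARD('n) = 2 \<and> \<hh> = {0})"
proof -
  have fl: "linear f" and fb: "bij_betw f UNIV so_pq"
    and fbr: "\<And>X Y. f (lie_bracket G c X Y) = br (f X) (f Y)"
    using f by (auto simp: lie_isomorphism_so_pq_def br_def)
  have f_so: "f x \<in> so_pq" for x using fb by (auto simp: bij_betw_def)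
  obtain g where g: "linear g" "g \<circ> f = id"
    using linear_injective_left_inverse[OF fl] fb by (auto simp: bij_betw_def)
  have gf: "g (f x) = x" for x using fun_cong[OF g(2), of x] by simp
  have fg: "f (g X) = X" if "X \<in> so_pq" for X
  proof -
    obtain x where "X = f x" using \<open>X \<in> so_pq\<close> fb by (auto simp: bij_betw_def)
    then show ?thesis by (simp add: gf)
  qed
  have gbr: "g (br X Y) = lie_bracket G c (g X) (g Y)" if "X \<in> so_pq" "Y \<in> so_pq" for X Y
    using fbr[of "g X" "g Y"] that by (metis fg gf)
  define b where "b X Y = \<beta> (Dp (g X)) (Dp (g Y))" for X Y
  have Dg: "linear (\<lambda>X. Dp (g X))" using linear_compose[OF g(1) linear_Dp] by (simp add: o_def)
  have bil: "bilinear b"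
    unfolding bilinear_def b_def
    using linear_compose[OF Dg] \<beta>(1) unfolding bilinear_def by (auto simp: o_def)
  have fh: "f ` \<hh> = {X \<in> so_pq. \<forall>Y\<in>so_pq. b X Y = 0}"
  proof (intro equalityI subsetI)
    fix X assume "X \<in> f ` \<hh>"
    then obtain x where x: "X = f x" "Dp x = 0" unfolding kernel_Dp[symmetric] by auto
    then show "X \<in> {X \<in> so_pq. \<forall>Y\<in>so_pq. b X Y = 0}"
      by (simp add: f_so b_def gf bilinear_lzero[OF \<beta>(1)])
  next
    fix X assume X: "X \<in> {X \<in> so_pq. \<forall>Y\<in>so_pq. b X Y = 0}"
    have "Dp (g X) = 0"
    proof (rule \<beta>(3))
      fix w obtain y where "w = Dp y" using surj_Dp by blast
      then show "\<beta> (Dp (g X)) w = 0" using X f_so[of y] by (auto simp: b_def gf)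
    qed
    then have "g X \<in> \<hh>" unfolding kernel_Dp[symmetric] by simp
    then show "X \<in> f ` \<hh>" using fg X by force
  qed
  interpret lorentz_form b "f ` \<hh>"
  proof
    show "bilinear b" by (rule bil)
    show "b X Y = b Y X" for X Y by (simp add: b_def \<beta>(2))
    show "f ` \<hh> = {X \<in> so_pq. \<forall>Y\<in>so_pq. b X Y = 0}" by (rule fh)
    show "b (br X Y) Z = - b Y (br X Z)" if X: "X \<in> f ` \<hh>" and Y: "Y \<in> so_pq" and Z: "Z \<in> so_pq" for X Y Z
    proof -
      obtain x \<gamma> where x: "X = f x" and \<gamma>: "smooth_map euclidean_manifold M \<gamma>" "\<And>s t. \<gamma> (s + t) = \<gamma> s \<otimes> \<gamma> t"
        "\<And>t. \<gamma> t \<in> H" "(\<phi> \<circ> \<gamma> has_vector_derivative x) (at 0)"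
        using X unfolding subgroup_lie_algebra_def by blast
      have \<gamma>c: "\<gamma> t \<in> carrier G" for t using \<gamma>(3) H_sub by blast
      have \<gamma>0: "\<gamma> 0 = \<one>" using one_parameter_zero \<gamma>c \<gamma>(2) by metis
      have D: "((\<lambda>t. Dp (Adl (\<gamma> t) v)) has_vector_derivative Dp (lie_bracket G c x v)) (at 0)" for v
        by (rule Dp_lie_bracket_deriv[OF \<gamma>(1) \<gamma>c \<gamma>(2,4)])
      \<comment> \<open>Invariance under the one-parameter subgroup makes this function constant;
        its derivative at 0 is the infinitesimal invariance.\<close>
      have "((\<lambda>t. \<beta> (Dp (Adl (\<gamma> t) (g Y))) (Dp (Adl (\<gamma> t) (g Z)))) has_vector_derivative
        \<beta> (Dp (Adl (\<gamma> 0) (g Y))) (Dp (lie_bracket G c x (g Z))) + \<beta> (Dp (lie_bracket G c x (g Y))) (Dp (Adl (\<gamma> 0) (g Z)))) (at 0)"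
        by (rule bounded_bilinear.has_vector_derivative[OF \<beta>(1)[unfolded bilinear_conv_bounded_bilinear] D D])
      moreover have "(\<lambda>t. \<beta> (Dp (Adl (\<gamma> t) (g Y))) (Dp (Adl (\<gamma> t) (g Z)))) = (\<lambda>t. \<beta> (Dp (g Y)) (Dp (g Z)))"
        using \<gamma>(3) by (simp add: Dp_Adl inv)
      ultimately have "\<beta> (Dp (g Y)) (Dp (lie_bracket G c x (g Z))) + \<beta> (Dp (lie_bracket G c x (g Y))) (Dp (g Z)) = 0"
        using vector_derivative_unique_at[of "\<lambda>t. \<beta> (Dp (g Y)) (Dp (g Z))" _ 0 0] by (simp add: \<gamma>0 Adl_one)
      then show ?thesis
        by (simp add: b_def x gbr f_so Y Z gf)
    qed
    show "\<exists>s t. (s \<noteq> 0 \<or> t \<noteq> 0) \<and> s *\<^sub>R X + t *\<^sub>R Y \<in> f ` \<hh>"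
      if XY: "X \<in> so_pq" "Y \<in> so_pq" and z: "b X X = 0" "b Y Y = 0" "b X Y = 0" for X Y
    proof -
      obtain s t where st: "s \<noteq> 0 \<or> t \<noteq> 0" "s *\<^sub>R Dp (g X) + t *\<^sub>R Dp (g Y) = 0"
        using \<beta>(4)[of "Dp (g X)" "Dp (g Y)"] z unfolding b_def by blast
      have "Dp (g (s *\<^sub>R X + t *\<^sub>R Y)) = 0"
        using st by (simp add: linear_add[OF g(1)] linear_scale[OF g(1)] linear_add[OF linear_Dp] linear_scale[OF linear_Dp])
      then have "g (s *\<^sub>R X + t *\<^sub>R Y) \<in> \<hh>" unfolding kernel_Dp[symmetric] by simp
      moreover have "f (g (s *\<^sub>R X + t *\<^sub>R Y)) = s *\<^sub>R X + t *\<^sub>R Y" by (rule fg) (intro so_add so_scale XY)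
      ultimately show ?thesis using st(1) by (metis imageI)
    qed
    show "f ` \<hh> \<noteq> so_pq"
    proof
      assume eq: "f ` \<hh> = so_pq"
      \<comment> \<open>The model space of G/H is nonzero, and the projection maps onto it.\<close>
      obtain v :: 'f where v: "v \<in> Basis" using nonempty_Basis by blast
      obtain y where y: "v = Dp y" using surj_Dp by blast
      have "f y \<in> f ` \<hh>" using eq f_so by simp
      then have "y \<in> \<hh>" using gf by (metis imageE)
      then have "v = 0" using y unfolding kernel_Dp[symmetric] by simp
      then show False using v by auto
    qed
  qed
  \<comment> \<open>A common bound on these automorphisms, transported by \<open>f\<close> and
    \<open>g\<close>, would bound Ad on \<open>H\<close> and make the closure compact.\<close>
  have unbounded_symmetries
  proof (rule ccontr)
    assume "\<not> unbounded_symmetries"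
    then obtain K where K: "\<And>T T' Y. so_auto T T' \<Longrightarrow> (\<And>X Y. X \<in> so_pq \<Longrightarrow> Y \<in> so_pq \<Longrightarrow> b (T X) (T Y) = b X Y) \<Longrightarrow>
        Y \<in> so_pq \<Longrightarrow> norm (T Y) \<le> K * norm Y"
      unfolding unbounded_symmetries_def by (metis not_le)
    have auto: "so_auto (\<lambda>X. f (Adl a (g X))) (\<lambda>X. f (Adl (inv a) (g X)))"
      and pres: "b (f (Adl a (g X))) (f (Adl a (g Y))) = b X Y" if a: "a \<in> H" for a X Y
    proof -
      have ac: "a \<in> carrier G" "inv a \<in> carrier G" using a H_sub by auto
      have lin: "linear (\<lambda>X. f (Adl k (g X)))" if "k \<in> carrier G" for k
        using linear_compose[OF g(1) linear_compose[OF linear_Adl[OF that] fl]] by (simp add: o_def)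
      show "so_auto (\<lambda>X. f (Adl a (g X))) (\<lambda>X. f (Adl (inv a) (g X)))"
        by (rule so_auto.intro) (simp_all add: lin ac f_so gf Adl_inv fg gbr Adl_lie_bracket fbr)
      show "b (f (Adl a (g X))) (f (Adl a (g Y))) = b X Y"
        using a by (simp add: b_def gf Dp_Adl inv)
    qed
    obtain Cf where Cf: "Cf > 0" "\<And>x. norm (f x) \<le> norm x * Cf"
      using bounded_linear.pos_bounded[OF fl[unfolded linear_conv_bounded_linear]] by blast
    obtain Cg where Cg: "Cg > 0" "\<And>x. norm (g x) \<le> norm x * Cg"
      using bounded_linear.pos_bounded[OF g(1)[unfolded linear_conv_bounded_linear]] by blast
    have "norm (Adl a v) \<le> (\<bar>K\<bar> * Cf * Cg) * norm v" if a: "a \<in> H" for a v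
    proof -
      have "norm (Adl a v) = norm (g (f (Adl a (g (f v)))))" by (simp add: gf)
      also have "\<dots> \<le> norm (f (Adl a (g (f v)))) * Cg" by (rule Cg)
      also have "\<dots> \<le> (\<bar>K\<bar> * norm (f v)) * Cg"
        using order_trans[OF K[OF auto[OF a] pres[OF a] f_so[of v]] mult_right_mono[OF abs_ge_self]] Cg(1)
        by (intro mult_right_mono) auto
      also have "\<dots> \<le> (\<bar>K\<bar> * (norm v * Cf)) * Cg" using Cg(1) Cf(2) by (intro mult_right_mono mult_left_mono) auto
      finally show ?thesis by (simp add: mult_ac)
    qed
    then show False using noncompact bounded_Ad_imp_compact Cf(1) Cg(1) by (metis abs_ge_zero less_imp_le mult_nonneg_nonneg)
  qed
  from radical_classification[OF n this]
  have "(\<exists>w. eta w w > 0 \<and> f ` \<hh> = {X \<in> so_pq. X *v w = 0}) \<or> (CARD('n) = 2 \<and> f ` \<hh> = {0})" .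
  moreover have "\<hh> = {0}" if "f ` \<hh> = {0}"
  proof -
    have "\<hh> = g ` f ` \<hh>" by (simp add: image_image gf)
    then show ?thesis using that linear_0[OF g(1)] by simp
  qed
  ultimately show ?thesis by blast
qed

end

theorem proposition2p3:
  fixes G :: "('g, 'm) monoid_scheme"
    and M :: "('g, 'e::euclidean_space) manifold"
    and c :: "('g, 'e) chart"
    and H :: "'g set"
    and N :: "('g set, 'f::euclidean_space) manifold"
    and Q :: "('g set, 'f) chart \<Rightarrow> 'g set \<Rightarrow> 'f \<Rightarrow> real"
    and n :: nat
  assumes n: "n = CARD('n::finite)" "n \<ge> 2"
    and G: "lie_group G M"
    and locally_SO: "locally_isomorphic G M
           (SO_pq :: (real ^ (1 + 'n) ^ (1 + 'n)) monoid)
           (embedded_manifold (carrier SO_pq) :: (real ^ (1 + 'n) ^ (1 + 'n), 'e) manifold)"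
    and c: "c \<in> charts_at M \<one>\<^bsub>G\<^esub>"
    and H: "subgroup H G" "closedin (mtop M) H"
    and noncompact: "\<not> compact (top_of_set GL closure_of (Ad G c ` H))"
    and quotient: "quotient_manifold G M H N"
    and lorentz: "lorentz_metric N Q"
    and invariant: "\<forall>a\<in>carrier G. preserves_metric N Q (\<lambda>p. a <#\<^bsub>G\<^esub> p)"
  shows "(\<forall>f :: 'e \<Rightarrow> real ^ (1 + 'n) ^ (1 + 'n).
            lie_isomorphism_so_pq G c f \<longrightarrow>
            (\<exists>A\<in>carrier SO_pq. \<exists>j.
               f ` subgroup_lie_algebra G M c H =
               (\<lambda>X. A ** X ** matrix_inv A) ` standard_copy j)) \<or>
         (n = 2 \<and> subtopology (mtop M) H = discrete_topology H)"
proof (cases "n = 2 \<and> subtopology (mtop M) H = discrete_topology H")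
  \<comment> \<open>The second alternative does not involve the isomorphism, so it is excluded
    before \<open>f\<close> is fixed. A trivial \<hh> with n = 2 would make \<open>H\<close>
    discrete, against this case.\<close>
  case False
  interpret lie_group G M by (rule G)
  have N: "smooth_manifold N" and topN: "topspace (mtop N) = lcosets\<^bsub>G\<^esub> H"
    using quotient by (auto simp: quotient_manifold_def)
  interpret N: smooth_manifold N by (rule N)
  have H_top: "H \<in> topspace (mtop N)"
    unfolding topN LCOSETS_def using lcos_mult_one[OF subgroup.subset[OF H(1)]] one_closed by blast
  then obtain d where d: "d \<in> charts_at N H" using N.ex_chart by blast
  interpret homogeneous G M c H N d
    by (intro homogeneous.intro homogeneous_axioms.intro lie_chart.intro lie_chart_axioms.intro G c H quotient d)
  have "minkowski_form (Q d H)"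
    using lorentz H_top d by (simp add: lorentz_metric_def)
  from minkowski_polarization[OF this] obtain \<beta> where "bilinear \<beta> \<and> (\<forall>v w. \<beta> v w = \<beta> w v) \<and>
    (\<forall>v. Q d H v = \<beta> v v) \<and> (\<forall>v. (\<forall>w. \<beta> v w = 0) \<longrightarrow> v = 0) \<and>
    (\<forall>v w. \<beta> v v = 0 \<and> \<beta> w w = 0 \<and> \<beta> v w = 0 \<longrightarrow> (\<exists>s t. (s \<noteq> 0 \<or> t \<noteq> 0) \<and> s *\<^sub>R v + t *\<^sub>R w = 0))" ..
  then have \<beta>: "bilinear \<beta>" "\<And>v w. \<beta> v w = \<beta> w v" and Q: "\<And>v. Q d H v = \<beta> v v"
    and nondeg: "\<And>v. (\<And>w. \<beta> v w = 0) \<Longrightarrow> v = 0"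
    and iso: "\<And>v w. \<beta> v v = 0 \<Longrightarrow> \<beta> w w = 0 \<Longrightarrow> \<beta> v w = 0 \<Longrightarrow> \<exists>s t. (s \<noteq> 0 \<or> t \<noteq> 0) \<and> s *\<^sub>R v + t *\<^sub>R w = 0"
    by simp_all
  have inv: "\<beta> (translation_map d a v) (translation_map d a w) = \<beta> v w" if a: "a \<in> H" for a v w
  proof -
    have ac: "a \<in> carrier G" using a H_sub by blast
    have aH: "a <#\<^bsub>G\<^esub> H = H" using pi_eq_H[OF ac] a by (simp add: \<pi>_def)
    have q: "Q d H (translation_map d a v) = Q d H v" for v
      using invariant ac H_top d aH unfolding preserves_metric_def translation_map_def by metis
    have lin: "linear (translation_map d a)"
      using tau_deriv[OF ac, of d] d pi_eq_H[OF ac] a has_derivative_linear by auto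
    \<comment> \<open>The metric is given by quadratic forms; since the isotropy maps are linear,
      invariance passes to \<beta> by polarization.\<close>
    have polar: "\<beta> (v + w) (v + w) = \<beta> v v + 2 * \<beta> v w + \<beta> w w" for v w
      using \<beta>(2)[of w v] by (simp add: bilinear_ladd[OF \<beta>(1)] bilinear_radd[OF \<beta>(1)])
    show ?thesis
      using q[of "v + w"] q[of v] q[of w] unfolding Q linear_add[OF lin] polar by simp
  qed
  show ?thesis
  proof (intro disjI1 allI impI)
    fix f :: "'e \<Rightarrow> real ^ (1 + 'n) ^ (1 + 'n)"
    assume f: "lie_isomorphism_so_pq G c f"
    have "CARD('n) \<ge> 2" using n by simp
    then have "(\<exists>w. eta w w > 0 \<and> f ` \<hh> = {X \<in> so_pq. X *v w = 0}) \<or> (CARD('n) = 2 \<and> \<hh> = {0})"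
      by (rule lie_algebra_classification[OF _ f noncompact \<beta> nondeg iso inv])
    then show "\<exists>A\<in>carrier SO_pq. \<exists>j. f ` \<hh> = (\<lambda>X. A ** X ** matrix_inv A) ` standard_copy j"
    proof
      assume "\<exists>w. eta w w > 0 \<and> f ` \<hh> = {X \<in> so_pq. X *v w = 0}"
      then show ?thesis using annihilator_conjugate by fastforce
    next
      assume trivial: "CARD('n) = 2 \<and> \<hh> = {0}"
      have "subtopology (mtop M) H = discrete_topology H"
        by (rule discrete_if_kernel_trivial) (use kernel_Dp trivial in blast)
      then show ?thesis using False trivial n by simp
    qed
  qed
qed simp

end
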